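(* For any $N \in \mathbb{N}$, $z \in \mathbb{C}$ and $A,B \in \mathrm{Mat}_N(\mathbb{C})$ with eigenvalues $a_1,\dots,a_N$ and $b_1,\dots,b_N$ respectively, and with $c_1,\dots,c_N$ the eigenvalues of $C=AB$, we have $$\int_{\mathrm{U}(N)} e^{zN \mathrm{Tr}\,AUBU^{-1}}\,\mathrm{d}U = 1 + \sum_{d=1}^\infty \frac{z^d}{d!}\, \mathbb{P}(\mathrm{LIS}_d \leq N) \sum_{\alpha,\beta \vdash d} p_\alpha(a_1,\dots,a_N)\, p_\beta(b_1,\dots,b_N)\, \langle \omega_\alpha \Omega_N^{-1}\omega_\beta\rangle,$$ $$\int_{\mathrm{U}(N)} e^{zN \mathrm{Tr}(AU+BU^{-1})}\,\mathrm{d}U = 1 + \sum_{d=1}^\infty \frac{z^{2d}}{d!}\, N^d\, \mathbb{P}(\mathrm{LIS}_d \leq N) \sum_{\beta \vdash d} p_\beta(c_1,\dots,c_N)\, \langle \Omega_N^{-1}\omega_\beta\rangle.$$ These series, regarded as functions of $(z,a_1,\dots,a_N,b_1,\dots,b_N)$ and $(z,c_1,\dots,c_N)$, converge absolutely and uniformly on compact subsets of $\mathbb{C}^{2N+1}$ and $\mathbb{C}^{N+1}$, respectively.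
   Context: $\mathrm{d}U$ is the Haar probability measure on $\mathrm{U}(N)$. For $\alpha \vdash d$, $p_\alpha(x_1,\dots,x_N)=\prod_{i=1}^{\ell(\alpha)}\sum_{j=1}^N x_j^{\alpha_i}$ where $\ell(\alpha)$ is the number of rows of $\alpha$. $\mathrm{S}_N(d)$ is the set of permutations of $\{1,\dots,d\}$ having no increasing subsequence of length $N+1$, and $\mathbb{P}(\mathrm{LIS}_d\le N) = |\mathrm{S}_N(d)|/d!$. For $\lambda\vdash d$, $\dim \mathsf{V}^\lambda$ is the dimension of the irreducible representation of $\mathrm{S}(d)$ indexed by $\lambda$ (number of standard Young tableaux of shape $\lambda$), $\chi_\alpha(\lambda)$ is its character value on permutations of cycle type $\alpha$, $C_\alpha$ is the conjugacy class of permutations of cycle type $\alpha$, and $\omega_\alpha(\lambda) = |C_\alpha|\chi_\alpha(\lambda)/\dim\mathsf{V}^\lambda$. For a cell $\Box$ of $\lambda$, its content $c(\Box)$ is its column index minus its row index; for $\ell(\lambda)\le N$ set $\Omega_N(\lambda)=\prod_{\Box\in\lambda}(1+c(\Box)/N)$ and $\Omega_N^{-1}=1/\Omega_N$. Angle brackets denote expectation under row-restricted Plancherel measure: $\langle f\rangle = \sum_{\lambda\vdash d,\ \ell(\lambda)\le N} f(\lambda)\,(\dim\mathsf{V}^\lambda)^2/|\mathrm{S}_N(d)|$. *)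

theory Defs
  imports
    "HOL-Probability.Probability_Measure"
    "HOL-Library.Function_Algebras"
    "HOL-Combinatorics.Permutations"
    "HOL-Combinatorics.Orbits"
begin

section \<open>The unitary group and its Haar measure\<close>

definition adjoint_mat :: "complex^'n^'n \<Rightarrow> complex^'n^'n" where
  "adjoint_mat U = (\<chi> i j. cnj (U $ j $ i))"

definition unitary_group :: "(complex^'n^'n) set" where
  "unitary_group = {U. U ** adjoint_mat U = mat 1 \<and> adjoint_mat U ** U = mat 1}"

definition haar_prob_measure :: "(complex^'n^'n) measure \<Rightarrow> bool" where
  "haar_prob_measure \<mu> \<longleftrightarrow>
     prob_space \<mu> \<and>
     sets \<mu> = sets (restrict_space borel unitary_group) \<and>
     (\<forall>V\<in>unitary_group. distr \<mu> \<mu> (\<lambda>U. V ** U) = \<mu>)"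

text \<open>The entries of \<open>a\<close> list the eigenvalues with algebraic multiplicity.\<close>

definition has_eigenvalues :: "complex^'n^'n \<Rightarrow> complex^'n \<Rightarrow> bool" where
  "has_eigenvalues A a \<longleftrightarrow> (\<forall>x. det (mat x - A) = (\<Prod>i\<in>UNIV. x - a $ i))"


section \<open>Partitions and Young diagrams\<close>

definition partitions :: "nat \<Rightarrow> nat list set" where
  "partitions d = {\<alpha>. sorted_wrt (\<ge>) \<alpha> \<and> 0 \<notin> set \<alpha> \<and> sum_list \<alpha> = d}"

definition power_sum :: "nat list \<Rightarrow> complex^'n \<Rightarrow> complex" where
  "power_sum \<alpha> x = (\<Prod>i<length \<alpha>. \<Sum>j\<in>UNIV. x $ j ^ (\<alpha> ! i))"

text \<open>Cells are pairs (row, column), both counted from 0.\<close>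

definition cells :: "nat list \<Rightarrow> (nat \<times> nat) set" where
  "cells \<nu> = {(i, j). i < length \<nu> \<and> j < \<nu> ! i}"

definition cell_content :: "nat \<times> nat \<Rightarrow> int" where
  "cell_content c = int (snd c) - int (fst c)"

definition Omega :: "nat \<Rightarrow> nat list \<Rightarrow> complex" where
  "Omega N \<nu> = (\<Prod>c\<in>cells \<nu>. 1 + of_int (cell_content c) / of_nat N)"


section \<open>Permutations\<close>

definition perms :: "nat \<Rightarrow> (nat \<Rightarrow> nat) set" where
  "perms d = {p. p permutes {1..d}}"

text \<open>\<open>no_long_inc N d\<close>: no increasing subsequence of length \<open>N + 1\<close>; \<open>I\<close> is the set of positions.\<close>

definition no_long_inc :: "nat \<Rightarrow> nat \<Rightarrow> (nat \<Rightarrow> nat) set" where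
  "no_long_inc N d = {p \<in> perms d. \<not> (\<exists>I\<subseteq>{1..d}. card I = N + 1 \<and> strict_mono_on I p)}"

definition prob_LIS_le :: "nat \<Rightarrow> nat \<Rightarrow> real" where
  "prob_LIS_le d N = real (card (no_long_inc N d)) / fact d"

text \<open>Orbit sizes, fixed points included.\<close>

definition cycle_type :: "nat \<Rightarrow> (nat \<Rightarrow> nat) \<Rightarrow> nat multiset" where
  "cycle_type d p = image_mset card (mset_set (orbit p ` {1..d}))"

definition conj_class :: "nat list \<Rightarrow> (nat \<Rightarrow> nat) set" where
  "conj_class \<alpha> = {p \<in> perms (sum_list \<alpha>). cycle_type (sum_list \<alpha>) p = mset \<alpha>}"


section \<open>Irreducible representations of the symmetric group\<close>

text \<open>
  The complex vector space of complex-valued functions on permutations. The group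
  algebra of the symmetric group on \<open>{1..d}\<close> is the subspace of functions supported
  on \<^term>\<open>perms d\<close>, with convolution as product.
\<close>

definition fscale :: "complex \<Rightarrow> ('a \<Rightarrow> complex) \<Rightarrow> 'a \<Rightarrow> complex" where
  "fscale c f = (\<lambda>x. c * f x)"

global_interpretation fvec: vector_space "fscale :: complex \<Rightarrow> ('a \<Rightarrow> complex) \<Rightarrow> 'a \<Rightarrow> complex"
  by unfold_locales (auto simp: fscale_def fun_eq_iff algebra_simps)

definition group_algebra :: "nat \<Rightarrow> ((nat \<Rightarrow> nat) \<Rightarrow> complex) set" where
  "group_algebra d = {f. \<forall>p. p \<notin> perms d \<longrightarrow> f p = 0}"

definition conv :: "nat \<Rightarrow> ((nat \<Rightarrow> nat) \<Rightarrow> complex) \<Rightarrow> ((nat \<Rightarrow> nat) \<Rightarrow> complex)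
    \<Rightarrow> (nat \<Rightarrow> nat) \<Rightarrow> complex" where
  "conv d f g = (\<lambda>p. if p \<in> perms d then \<Sum>q\<in>perms d. f q * g (inv q \<circ> p) else 0)"

definition basis_elt :: "(nat \<Rightarrow> nat) \<Rightarrow> (nat \<Rightarrow> nat) \<Rightarrow> complex" where
  "basis_elt p = (\<lambda>q. if q = p then 1 else 0)"

text \<open>
  The canonical tableau of shape \<open>\<nu>\<close>, filled with \<open>1, ..., d\<close> row by row, and its row and
  column stabilizers.
\<close>

definition tableau :: "nat list \<Rightarrow> nat \<times> nat \<Rightarrow> nat" where
  "tableau \<nu> c = sum_list (take (fst c) \<nu>) + snd c + 1"

definition row_group :: "nat list \<Rightarrow> (nat \<Rightarrow> nat) set" where
  "row_group \<nu> = {p \<in> perms (sum_list \<nu>).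
     \<forall>c\<in>cells \<nu>. \<exists>c'\<in>cells \<nu>. fst c' = fst c \<and> p (tableau \<nu> c) = tableau \<nu> c'}"

definition col_group :: "nat list \<Rightarrow> (nat \<Rightarrow> nat) set" where
  "col_group \<nu> = {p \<in> perms (sum_list \<nu>).
     \<forall>c\<in>cells \<nu>. \<exists>c'\<in>cells \<nu>. snd c' = snd c \<and> p (tableau \<nu> c) = tableau \<nu> c'}"

definition young_symmetrizer :: "nat list \<Rightarrow> (nat \<Rightarrow> nat) \<Rightarrow> complex" where
  "young_symmetrizer \<nu> =
     conv (sum_list \<nu>) (\<Sum>p\<in>row_group \<nu>. basis_elt p)
       (\<Sum>q\<in>col_group \<nu>. fscale (of_int (sign q)) (basis_elt q))"

text \<open>
  The irreducible representation indexed by \<open>\<nu>\<close> (Specht module): the left ideal of the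
  group algebra generated by the Young symmetrizer, with the symmetric group acting by
  left multiplication. In this convention one-row partitions give trivial representations
  and one-column partitions give sign representations.
\<close>

definition specht :: "nat list \<Rightarrow> ((nat \<Rightarrow> nat) \<Rightarrow> complex) set" where
  "specht \<nu> = (\<lambda>f. conv (sum_list \<nu>) f (young_symmetrizer \<nu>)) ` group_algebra (sum_list \<nu>)"

definition dim_specht :: "nat list \<Rightarrow> nat" where
  "dim_specht \<nu> = fvec.dim (specht \<nu>)"

text \<open>Trace of an endomorphism of a finite-dimensional subspace, computed in some basis.\<close>

definition trace_on :: "('a \<Rightarrow> complex) set \<Rightarrow> (('a \<Rightarrow> complex) \<Rightarrow> ('a \<Rightarrow> complex)) \<Rightarrow> complex" where
  "trace_on W T =
     (let B = (SOME B. fvec.independent B \<and> fvec.span B = W)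
      in \<Sum>b\<in>B. fvec.representation B (T b) b)"

definition irr_character :: "nat list \<Rightarrow> (nat \<Rightarrow> nat) \<Rightarrow> complex" where
  "irr_character \<nu> p = trace_on (specht \<nu>) (conv (sum_list \<nu>) (basis_elt p))"

definition chi :: "nat list \<Rightarrow> nat list \<Rightarrow> complex" where
  "chi \<alpha> \<nu> = irr_character \<nu> (SOME p. p \<in> conj_class \<alpha>)"

definition omega :: "nat list \<Rightarrow> nat list \<Rightarrow> complex" where
  "omega \<alpha> \<nu> = of_nat (card (conj_class \<alpha>)) * chi \<alpha> \<nu> / of_nat (dim_specht \<nu>)"

text \<open>Expectation under row-restricted Plancherel measure.\<close>

definition plancherel_expectation :: "nat \<Rightarrow> nat \<Rightarrow> (nat list \<Rightarrow> complex) \<Rightarrow> complex" where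
  "plancherel_expectation N d f =
     (\<Sum>\<nu> | \<nu> \<in> partitions d \<and> length \<nu> \<le> N. f \<nu> * of_nat (dim_specht \<nu>) ^ 2 / of_nat (card (no_long_inc N d)))"


section \<open>The terms of the two series\<close>

definition hciz_term :: "nat \<Rightarrow> complex \<Rightarrow> complex^'n \<Rightarrow> complex^'n \<Rightarrow> complex" where
  "hciz_term d z a b =
     (let N = CARD('n) in
      z ^ d / fact d * of_real (prob_LIS_le d N) *
      (\<Sum>\<alpha>\<in>partitions d. \<Sum>\<beta>\<in>partitions d. power_sum \<alpha> a * power_sum \<beta> b *
         plancherel_expectation N d (\<lambda>\<nu>. omega \<alpha> \<nu> * inverse (Omega N \<nu>) * omega \<beta> \<nu>)))"

definition bgw_term :: "nat \<Rightarrow> complex \<Rightarrow> complex^'n \<Rightarrow> complex" where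
  "bgw_term d z c =
     (let N = CARD('n) in
      z ^ (2 * d) / fact d * of_nat N ^ d * of_real (prob_LIS_le d N) *
      (\<Sum>\<beta>\<in>partitions d. power_sum \<beta> c *
         plancherel_expectation N d (\<lambda>\<nu>. inverse (Omega N \<nu>) * omega \<beta> \<nu>)))"

end

theory Submission
  imports Defs "HOL-Computational_Algebra.Fundamental_Theorem_Algebra"
begin

text \<open>
  Expanding the exponentials reduces both formulas to integrals of products of matrix entries of
  a unitary matrix and its inverse. As a kernel on words (indices of the tensor power of
  \<open>\<complex>\<^sup>N\<close>), such an integral commutes with the diagonal action of \<open>gl\<^sub>N\<close>, by left invariance of Haar
  measure. Contracting this relation in the last tensor factor shows that the Jucys-Murphy
  element \<open>N + \<Sum>\<^sub>k (k d)\<close>, applied to the kernel, is a sum of contractions of lower degree. This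
  element is invertible on the tensor power because it divides the Gram element
  \<open>G = \<Sum>\<^sub>\<sigma> N\<^bsup>cycles(\<sigma>)\<^esup> \<sigma>\<close>, so by induction the kernel is a combination of place permutations, and its
  coefficients are given by the pseudo-inverse \<open>W\<close> of \<open>G\<close>. The element \<open>G\<close> acts on the Specht module
  of \<open>\<nu>\<close> by \<open>N\<^sup>d \<Omega>\<^sub>N(\<nu>)\<close>, and Specht modules of shapes with more than \<open>N\<close> rows do not occur in the
  tensor power; hence \<open>W\<close> is the sum of the central idempotents of the remaining shapes divided by
  \<open>N\<^sup>d \<Omega>\<^sub>N(\<nu>)\<close>. The number of permutations without long increasing subsequences cancels.
\<close>

section \<open>The group algebra of the symmetric group\<close>

text \<open>For \<open>d > N\<close> the Gram element is singular in the group algebra and the place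
  permutations are linearly dependent on the tensor power, so coefficients of kernels are not
  unique. Hence the inversion of the Gram element is stated for the action on words
  (\<open>perm_act_gram_weingarten\<close>), and kernels are compared by traces, not by
  coefficients.

  Characters are handled as single elements: the class average of a normalised Young symmetrizer is
  the character of its left ideal, so orthogonality, completeness and scalar action become
  computations in the group algebra.

  \<open>has_eigenvalues\<close> speaks of the characteristic polynomial only. Power sums are
  therefore reached through determinants of polynomials in \<open>A\<close>, without
  diagonalisation.

  In the second integral, moments with different powers of \<open>U\<close> and its inverse vanish
  by invariance under a scalar matrix. This leaves even powers of \<open>z\<close>, and the central
  binomial coefficient turns \<open>(2d)!\<close> into \<open>(d!)^2\<close>.

  Convergence needs no estimate of characters: every term is a Haar moment for diagonal matrices,
  hence bounded by \<open>C^d / d!\<close>.\<close>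

abbreviation transp :: "nat \<Rightarrow> nat \<Rightarrow> nat \<Rightarrow> nat" where
  "transp \<equiv> Transposition.transpose"

lemma finite_perms [simp]: "finite (perms d)"
  unfolding perms_def by (rule finite_permutations) simp

lemma id_in_perms [simp]: "id \<in> perms d"
  by (simp add: perms_def permutes_id)

lemma comp_in_perms [simp]: "p \<in> perms d \<Longrightarrow> q \<in> perms d \<Longrightarrow> p \<circ> q \<in> perms d"
  by (simp add: perms_def permutes_compose)

lemma inv_in_perms [simp]: "p \<in> perms d \<Longrightarrow> inv p \<in> perms d"
  by (simp add: perms_def permutes_inv)

lemma transp_in_perms [simp]: "i \<in> {1..d} \<Longrightarrow> j \<in> {1..d} \<Longrightarrow> transp i j \<in> perms d"
  by (simp add: perms_def permutes_swap_id)

lemma perms_inv [simp]: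
  assumes "p \<in> perms d"
  shows "p \<circ> inv p = id" "inv p \<circ> p = id" "inv (inv p) = p"
    "p \<circ> (inv p \<circ> f) = f" "inv p \<circ> (p \<circ> f) = f"
    "p (inv p k) = k" "inv p (p k) = k"
  using assms unfolding perms_def
  by (auto simp: permutes_inv_o permutes_inv_inv permutes_inverses fun_eq_iff)

lemma inv_comp_perms: "p \<in> perms d \<Longrightarrow> q \<in> perms d \<Longrightarrow> inv (p \<circ> q) = inv q \<circ> inv p"
  by (simp add: o_inv_distrib perms_def permutes_bij)

lemma perms_permutation: "p \<in> perms d \<Longrightarrow> permutation p"
  unfolding perms_def using finite_atLeastAtMost permutation_permutes by blast

lemma sign_comp_perms: "p \<in> perms d \<Longrightarrow> q \<in> perms d \<Longrightarrow> sign (p \<circ> q) = sign p * sign q"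
  by (simp add: sign_compose perms_permutation)

lemma sign_inv_perms: "p \<in> perms d \<Longrightarrow> sign (inv p) = sign p"
  by (simp add: sign_inverse perms_permutation)

lemma perms_in_iff [simp]: "p \<in> perms d \<Longrightarrow> p k \<in> {1..d} \<longleftrightarrow> k \<in> {1..d}"
  unfolding perms_def by (simp only: permutes_in_image mem_Collect_eq)

lemma perms_in_iff_Suc [simp]: "p \<in> perms d \<Longrightarrow> p k \<in> {Suc 0..d} \<longleftrightarrow> k \<in> {Suc 0..d}"
  using perms_in_iff by simp

lemma sum_perms_inv: "(\<Sum>q\<in>perms d. f (inv q)) = sum f (perms d)"
  unfolding perms_def by (rule sum_permutations_inverse[symmetric])

lemma sum_perms_left: "p \<in> perms d \<Longrightarrow> (\<Sum>q\<in>perms d. f (p \<circ> q)) = sum f (perms d)"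
  unfolding perms_def by (rule setum_permutations_compose_left[symmetric]) simp

lemma sum_perms_right: "p \<in> perms d \<Longrightarrow> (\<Sum>q\<in>perms d. f (q \<circ> p)) = sum f (perms d)"
  unfolding perms_def by (rule sum_permutations_compose_right[symmetric]) simp

lemma card_perms: "card (perms d) = fact d"
  unfolding perms_def by (subst card_permutations) auto

lemma conv_apply: "p \<in> perms d \<Longrightarrow> conv d f g p = (\<Sum>q\<in>perms d. f q * g (inv q \<circ> p))"
  by (simp add: conv_def)

lemma conv_apply_right:
  assumes "p \<in> perms d"
  shows "conv d f g p = (\<Sum>q\<in>perms d. f (p \<circ> inv q) * g q)"
proof -
  have "conv d f g p = (\<Sum>q\<in>perms d. f q * g (inv q \<circ> p))" by (simp add: conv_def assms)
  also have "\<dots> = (\<Sum>q\<in>perms d. f (p \<circ> q) * g (inv (p \<circ> q) \<circ> p))"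
    by (rule sum_perms_left[OF assms, symmetric])
  also have "\<dots> = (\<Sum>q\<in>perms d. f (p \<circ> q) * g (inv q))"
    by (intro sum.cong refl) (simp add: inv_comp_perms[OF assms] comp_assoc perms_inv[OF assms])
  also have "\<dots> = (\<Sum>q\<in>perms d. f (p \<circ> inv q) * g (inv (inv q)))"
    by (rule sum_perms_inv[symmetric])
  finally show ?thesis by simp
qed

lemma conv_outside: "p \<notin> perms d \<Longrightarrow> conv d f g p = 0"
  by (simp add: conv_def)

lemma conv_in_group_algebra [simp]: "conv d f g \<in> group_algebra d"
  by (simp add: group_algebra_def conv_def)

lemma conv_assoc: "conv d (conv d f g) h = conv d f (conv d g h)"
proof
  fix p
  show "conv d (conv d f g) h p = conv d f (conv d g h) p"
  proof (cases "p \<in> perms d")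
    case p: True
    have "conv d (conv d f g) h p = (\<Sum>q\<in>perms d. conv d f g (p \<circ> inv q) * h q)"
      by (rule conv_apply_right[OF p])
    also have "\<dots> = (\<Sum>q\<in>perms d. \<Sum>r\<in>perms d. f r * (g (inv r \<circ> (p \<circ> inv q)) * h q))"
      using p by (intro sum.cong refl) (simp add: conv_apply sum_distrib_right mult.assoc)
    also have "\<dots> = (\<Sum>r\<in>perms d. \<Sum>q\<in>perms d. f r * (g (inv r \<circ> (p \<circ> inv q)) * h q))"
      by (rule sum.swap)
    also have "\<dots> = (\<Sum>r\<in>perms d. f r * conv d g h (inv r \<circ> p))"
      using p by (intro sum.cong refl) (simp add: conv_apply_right sum_distrib_left comp_assoc)
    also have "\<dots> = conv d f (conv d g h) p"
      by (rule conv_apply[OF p, symmetric])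
    finally show ?thesis .
  qed (simp add: conv_outside)
qed

lemma conv_add_left: "conv d (f + g) h = conv d f h + conv d g h"
  by (auto simp: conv_def fun_eq_iff algebra_simps sum.distrib)

lemma conv_add_right: "conv d f (g + h) = conv d f g + conv d f h"
  by (auto simp: conv_def fun_eq_iff algebra_simps sum.distrib)

lemma conv_scale_left: "conv d (fscale c f) h = fscale c (conv d f h)"
  by (auto simp: conv_def fscale_def fun_eq_iff algebra_simps sum_distrib_left)

lemma conv_scale_right: "conv d f (fscale c h) = fscale c (conv d f h)"
  by (auto simp: conv_def fscale_def fun_eq_iff algebra_simps sum_distrib_left)

lemma sum_fun_apply: "(\<Sum>i\<in>I. F i) x = (\<Sum>i\<in>I. F i x)" for F :: "'i \<Rightarrow> 'a \<Rightarrow> 'b::comm_monoid_add"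
  by (induction I rule: infinite_finite_induct) auto

lemma conv_zero [simp]: "conv d 0 f = 0" "conv d f 0 = 0"
  by (auto simp: conv_def fun_eq_iff)

lemma conv_sum_left: "conv d (\<Sum>i\<in>I. F i) h = (\<Sum>i\<in>I. conv d (F i) h)"
  by (induction I rule: infinite_finite_induct) (simp_all only: conv_zero conv_add_left sum.insert sum.empty sum.infinite not_False_eq_True)

lemma conv_sum_right: "conv d h (\<Sum>i\<in>I. F i) = (\<Sum>i\<in>I. conv d h (F i))"
  by (induction I rule: infinite_finite_induct) (simp_all only: conv_zero conv_add_right sum.insert sum.empty sum.infinite not_False_eq_True)

lemma conv_basis_left:
  assumes "s \<in> perms d" "p \<in> perms d"
  shows "conv d (basis_elt s) f p = f (inv s \<circ> p)"
  using assms by (simp add: conv_apply basis_elt_def mult_delta_left mult_delta_right)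

lemma conv_basis_right:
  assumes "s \<in> perms d" "p \<in> perms d"
  shows "conv d f (basis_elt s) p = f (p \<circ> inv s)"
  using assms by (simp add: conv_apply_right basis_elt_def mult_delta_left mult_delta_right)

lemma conv_id_left [simp]: "f \<in> group_algebra d \<Longrightarrow> conv d (basis_elt id) f = f"
  by (rule ext, case_tac "x \<in> perms d") (auto simp: conv_basis_left conv_outside group_algebra_def)

lemma conv_id_right [simp]: "f \<in> group_algebra d \<Longrightarrow> conv d f (basis_elt id) = f"
  by (rule ext, case_tac "x \<in> perms d") (auto simp: conv_basis_right conv_outside group_algebra_def)

lemma basis_elt_in [simp]: "s \<in> perms d \<Longrightarrow> basis_elt s \<in> group_algebra d"
  by (auto simp: group_algebra_def basis_elt_def)

lemma fscale_in [simp]: "f \<in> group_algebra d \<Longrightarrow> fscale c f \<in> group_algebra d"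
  by (auto simp: group_algebra_def fscale_def)

lemma group_algebra_eqI:
  "f \<in> group_algebra d \<Longrightarrow> g \<in> group_algebra d \<Longrightarrow> (\<And>p. p \<in> perms d \<Longrightarrow> f p = g p) \<Longrightarrow> f = g"
  by (rule ext, case_tac "x \<in> perms d") (simp_all add: group_algebra_def)

lemma conv_id_commute: "conv d f g id = conv d g f id"
  by (simp add: conv_apply[of _ _ f] conv_apply_right[of _ _ g] mult.commute)

text \<open>This is the centre of the group algebra: \<open>class_fun_central\<close> and
  \<open>class_fun_conv_basis\<close> give the two inclusions.\<close>

definition class_fun :: "nat \<Rightarrow> ((nat \<Rightarrow> nat) \<Rightarrow> complex) \<Rightarrow> bool" where
  "class_fun d f \<longleftrightarrow> f \<in> group_algebra d \<and> (\<forall>p\<in>perms d. \<forall>s\<in>perms d. f (s \<circ> p \<circ> inv s) = f p)"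

lemma class_funD: "class_fun d f \<Longrightarrow> p \<in> perms d \<Longrightarrow> s \<in> perms d \<Longrightarrow> f (s \<circ> p \<circ> inv s) = f p"
  by (simp add: class_fun_def)

lemma class_fun_commute:
  assumes "class_fun d f" "p \<in> perms d" "q \<in> perms d"
  shows "f (p \<circ> q) = f (q \<circ> p)"
  using class_funD[OF assms(1), of "p \<circ> q" "q"] assms by (simp add: comp_assoc)

lemma class_fun_central:
  assumes "class_fun d f" shows "conv d f g = conv d g f"
  by (rule group_algebra_eqI[of _ d])
    (auto simp: conv_apply[of _ _ g] conv_apply_right[of _ _ f] class_fun_commute[OF assms] mult.commute)

lemma class_fun_conv_basis:
  assumes "f \<in> group_algebra d" "\<And>s. s \<in> perms d \<Longrightarrow> conv d (basis_elt s) f = conv d f (basis_elt s)"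
  shows "class_fun d f"
  unfolding class_fun_def
proof (intro conjI ballI)
  fix p s assume ps: "p \<in> perms d" "s \<in> perms d"
  from assms(2)[OF ps(2)] have "conv d (basis_elt s) f (s \<circ> p) = conv d f (basis_elt s) (s \<circ> p)" by simp
  then show "f (s \<circ> p \<circ> inv s) = f p" using ps by (simp add: conv_basis_left conv_basis_right)
qed (use assms in auto)

section \<open>Young symmetrizers\<close>

text \<open>With \<open>f\<close> a row or column index this is the row or column group of a
  filling. As \<open>d\<close> is a separate argument, the same \<open>f\<close> also serves for the
  first \<open>m\<close> entries alone.\<close>

definition stab :: "nat \<Rightarrow> (nat \<Rightarrow> nat) \<Rightarrow> (nat \<Rightarrow> nat) set" where
  "stab d f = {p \<in> perms d. \<forall>k\<in>{1..d}. f (p k) = f k}"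

lemma stab_perms: "p \<in> stab d f \<Longrightarrow> p \<in> perms d"
  by (simp add: stab_def)

lemma stabD: "p \<in> stab d f \<Longrightarrow> k \<in> {1..d} \<Longrightarrow> f (p k) = f k"
  by (simp add: stab_def)

lemma finite_stab [simp]: "finite (stab d f)"
  by (simp add: stab_def)

lemma id_in_stab [simp]: "id \<in> stab d f"
  by (simp add: stab_def)

lemma comp_in_stab:
  assumes "p \<in> stab d f" "q \<in> stab d f" shows "p \<circ> q \<in> stab d f"
proof -
  have pq: "p \<in> perms d" "q \<in> perms d" using assms by (auto simp: stab_def)
  have "f (p (q k)) = f k" if "k \<in> {1..d}" for k
    using that stabD[OF assms(2), of k] stabD[OF assms(1), of "q k"] perms_in_iff[OF pq(2), of k] by simp
  then show ?thesis using pq by (simp add: stab_def)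
qed

lemma inv_in_stab:
  assumes "p \<in> stab d f" shows "inv p \<in> stab d f"
proof -
  have p: "p \<in> perms d" using assms by (auto simp: stab_def)
  have "f (inv p k) = f k" if "k \<in> {1..d}" for k
    using that stabD[OF assms(1), of "inv p k"] perms_in_iff[OF inv_in_perms[OF p], of k]
      perms_inv(6)[OF p, of k] by simp
  then show ?thesis using p by (simp add: stab_def)
qed

lemma comp_stab_iff:
  assumes "p \<in> stab d f" "q \<in> perms d"
  shows "p \<circ> q \<in> stab d f \<longleftrightarrow> q \<in> stab d f" "q \<circ> p \<in> stab d f \<longleftrightarrow> q \<in> stab d f"
proof -
  have p: "p \<in> perms d" using assms by (auto simp: stab_def)
  show "p \<circ> q \<in> stab d f \<longleftrightarrow> q \<in> stab d f"
    using comp_in_stab[OF assms(1), of q] comp_in_stab[OF inv_in_stab[OF assms(1)], of "p \<circ> q"] p by auto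
  have "(q \<circ> p) \<circ> inv p = q" using p by (simp add: comp_assoc)
  then show "q \<circ> p \<in> stab d f \<longleftrightarrow> q \<in> stab d f"
    using comp_in_stab[OF _ assms(1), of q] comp_in_stab[OF _ inv_in_stab[OF assms(1)], of "q \<circ> p"] by auto
qed

lemma transp_in_stab:
  "i \<in> {1..d} \<Longrightarrow> j \<in> {1..d} \<Longrightarrow> f i = f j \<Longrightarrow> transp i j \<in> stab d f"
  using transp_in_perms[of i d j] by (auto simp: stab_def Transposition.transpose_def)

definition row_sum :: "nat \<Rightarrow> (nat \<Rightarrow> nat) \<Rightarrow> (nat \<Rightarrow> nat) \<Rightarrow> complex" where
  "row_sum d rw = (\<lambda>p. if p \<in> stab d rw then 1 else 0)"

definition col_sum :: "nat \<Rightarrow> (nat \<Rightarrow> nat) \<Rightarrow> (nat \<Rightarrow> nat) \<Rightarrow> complex" where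
  "col_sum d cl = (\<lambda>p. if p \<in> stab d cl then of_int (sign p) else 0)"

text \<open>The Young symmetrizer of a filling given by coordinate functions;
  \<open>young_symmetrizer_ysym\<close> links it to the one built from a list of row
  lengths.\<close>

definition ysym :: "nat \<Rightarrow> (nat \<Rightarrow> nat) \<Rightarrow> (nat \<Rightarrow> nat) \<Rightarrow> (nat \<Rightarrow> nat) \<Rightarrow> complex" where
  "ysym d rw cl = conv d (row_sum d rw) (col_sum d cl)"

text \<open>Together with the sign rule \<open>col_sum_right\<close>, this invariance determines a
  product of row sum, arbitrary middle factor and column sum up to a scalar, see
  \<open>row_col_scalar\<close>.\<close>

lemma row_sum_left:
  assumes "t \<in> stab d rw" "p \<in> perms d"
  shows "conv d (row_sum d rw) x (t \<circ> p) = conv d (row_sum d rw) x p"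
proof -
  have t: "t \<in> perms d" using assms by (auto simp: stab_def)
  have "conv d (row_sum d rw) x (t \<circ> p) = (\<Sum>q\<in>perms d. row_sum d rw q * x (inv q \<circ> (t \<circ> p)))"
    using t assms by (simp add: conv_apply)
  also have "\<dots> = (\<Sum>q\<in>perms d. row_sum d rw (t \<circ> q) * x (inv (t \<circ> q) \<circ> (t \<circ> p)))"
    by (rule sum_perms_left[OF t, symmetric])
  also have "\<dots> = (\<Sum>q\<in>perms d. row_sum d rw q * x (inv q \<circ> p))"
    using t assms
    by (intro sum.cong refl) (simp add: row_sum_def comp_stab_iff inv_comp_perms[of _ d] comp_assoc)
  finally show ?thesis using assms by (simp add: conv_apply)
qed

lemma col_sum_right:
  assumes "t \<in> stab d cl" "p \<in> perms d"
  shows "conv d x (col_sum d cl) (p \<circ> t) = of_int (sign t) * conv d x (col_sum d cl) p"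
proof -
  have t: "t \<in> perms d" using assms by (auto simp: stab_def)
  have "conv d x (col_sum d cl) (p \<circ> t) = (\<Sum>q\<in>perms d. x (p \<circ> t \<circ> inv q) * col_sum d cl q)"
    using t assms by (simp add: conv_apply_right)
  also have "\<dots> = (\<Sum>q\<in>perms d. x (p \<circ> t \<circ> inv (q \<circ> t)) * col_sum d cl (q \<circ> t))"
    by (rule sum_perms_right[OF t, symmetric])
  also have "\<dots> = (\<Sum>q\<in>perms d. of_int (sign t) * (x (p \<circ> inv q) * col_sum d cl q))"
    using t assms
    by (intro sum.cong refl)
      (simp add: col_sum_def comp_stab_iff inv_comp_perms[of _ d] comp_assoc sign_comp_perms[of _ d])
  finally show ?thesis using assms by (simp add: conv_apply_right sum_distrib_left)
qed

text \<open>Induction by removing the maximum, which is at least \<open>card S - 1\<close>. Equality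
  forces the maximum to be exactly that, and the rest to be an initial segment.\<close>

lemma sum_initial_segment_le:
  fixes S :: "nat set"
  assumes "finite S"
  shows "\<Sum>{..<card S} \<le> \<Sum>S \<and> (\<Sum>{..<card S} = \<Sum>S \<longrightarrow> S = {..<card S})"
  using assms
proof (induction "card S" arbitrary: S)
  case (Suc n)
  define m where "m = Max S"
  have ne: "S \<noteq> {}" using Suc(2) by auto
  have m: "m \<in> S" unfolding m_def by (rule Max_in[OF Suc(3) ne])
  have c: "card (S - {m}) = n" using Suc m by simp
  have "S \<subseteq> {..m}" using Suc by (auto simp: m_def)
  then have "card S \<le> Suc m" using card_mono[of "{..m}" S] by simp
  then have nm: "n \<le> m" using Suc by simp
  have s: "\<Sum>S = m + \<Sum>(S - {m})" using Suc m by (simp add: sum.remove)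
  have IH: "\<Sum>{..<n} \<le> \<Sum>(S - {m}) \<and> (\<Sum>{..<n} = \<Sum>(S - {m}) \<longrightarrow> S - {m} = {..<n})"
    using Suc(1)[of "S - {m}"] c Suc by simp
  have t: "\<Sum>{..<Suc n} = n + \<Sum>{..<n}" by simp
  have "S = {..<Suc n}" if "\<Sum>{..<Suc n} = \<Sum>S"
  proof -
    have "m = n" "S - {m} = {..<n}" using that s t nm IH by auto
    moreover have "S = insert m (S - {m})" using m by blast
    ultimately show ?thesis by (simp add: lessThan_Suc)
  qed
  moreover have "\<Sum>{..<Suc n} \<le> \<Sum>S" using s t nm IH by linarith
  ultimately show ?case unfolding Suc(2)[symmetric] by blast
qed simp

lemma down_closed_eq_lessThan:
  fixes S :: "nat set"
  assumes "finite S" "\<And>i j. i \<in> S \<Longrightarrow> j \<le> i \<Longrightarrow> j \<in> S"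
  shows "S = {..<card S}"
proof (cases "S = {}")
  case False
  have "S = {..Max S}" using assms False by (auto intro: Max_in)
  then show ?thesis by (metis card_atMost lessThan_Suc_atMost)
qed simp

section \<open>Comparing the shapes of two fillings\<close>

definition shape :: "nat \<Rightarrow> (nat \<Rightarrow> nat) \<Rightarrow> (nat \<Rightarrow> nat) \<Rightarrow> (nat \<times> nat) set" where
  "shape d rw cl = (\<lambda>k. (rw k, cl k)) ` {1..d}"

definition fibre :: "nat \<Rightarrow> (nat \<Rightarrow> nat) \<Rightarrow> nat \<Rightarrow> nat set" where
  "fibre d f j = {k \<in> {1..d}. f k = j}"

lemma finite_fibre [simp]: "finite (fibre d f j)"
  by (simp add: fibre_def)

lemma sum_fibres: "(\<Sum>j\<in>f ` {1..d}. \<Sum>k\<in>fibre d f j. h k) = (\<Sum>k\<in>{1..d}. h k)"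
  unfolding fibre_def by (rule sum.group) auto

text \<open>A bijective filling of a Young diagram, encoded by the coordinates of each entry.
  \<open>down\<close> says that the occupied cells are closed towards the corner; the entries need
  not increase along rows or columns.\<close>

locale young =
  fixes d :: nat and rw cl :: "nat \<Rightarrow> nat"
  assumes inj: "inj_on (\<lambda>k. (rw k, cl k)) {1..d}"
    and down: "\<And>k i j. k \<in> {1..d} \<Longrightarrow> i \<le> rw k \<Longrightarrow> j \<le> cl k \<Longrightarrow> \<exists>l\<in>{1..d}. rw l = i \<and> cl l = j"
begin

lemma eqI: "k \<in> {1..d} \<Longrightarrow> l \<in> {1..d} \<Longrightarrow> rw k = rw l \<Longrightarrow> cl k = cl l \<Longrightarrow> k = l"
  by (rule inj_onD[OF inj]) simp_all

lemma inj_col: "inj_on rw (fibre d cl j)"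
  by (rule inj_onI, rule eqI) (auto simp: fibre_def)

lemma inj_row: "inj_on cl (fibre d rw j)"
  by (rule inj_onI, rule eqI) (auto simp: fibre_def)

lemma rows_of_col: "rw ` fibre d cl j = {..<card (fibre d cl j)}"
proof -
  have "rw ` fibre d cl j = {..<card (rw ` fibre d cl j)}"
  proof (rule down_closed_eq_lessThan)
    fix i i' assume "i \<in> rw ` fibre d cl j" "i' \<le> i"
    then show "i' \<in> rw ` fibre d cl j"
      using down[of _ i' j] unfolding fibre_def by force
  qed simp
  then show ?thesis by (simp add: card_image inj_col)
qed

lemma cols_of_row: "cl ` fibre d rw j = {..<card (fibre d rw j)}"
proof -
  have "cl ` fibre d rw j = {..<card (cl ` fibre d rw j)}"
  proof (rule down_closed_eq_lessThan)
    fix i i' assume "i \<in> cl ` fibre d rw j" "i' \<le> i"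
    then show "i' \<in> cl ` fibre d rw j"
      using down[of _ j i'] unfolding fibre_def by force
  qed simp
  then show ?thesis by (simp add: card_image inj_row)
qed

lemma shape_iff: "(i, j) \<in> shape d rw cl \<longleftrightarrow> j < card (fibre d rw i)"
proof -
  have "(i, j) \<in> shape d rw cl \<longleftrightarrow> j \<in> cl ` fibre d rw i"
    by (auto simp: shape_def fibre_def)
  then show ?thesis by (simp add: cols_of_row)
qed

end

text \<open>In each column the row indices form a set of prescribed size, and the sum of such a set is
  least for an initial segment. Hence \<open>\<Sum> rw\<close> is a statistic that orders the shapes.\<close>

lemma young_weight_le:
  assumes y: "young d rw cl" and y': "young d rw' cl'" and g: "g \<in> perms d"
    and inj: "inj_on (\<lambda>k. (rw k, cl' (inv g k))) {1..d}"
  shows "(\<Sum>k\<in>{1..d}. rw' k) \<le> (\<Sum>k\<in>{1..d}. rw k)"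
    "(\<Sum>k\<in>{1..d}. rw' k) = (\<Sum>k\<in>{1..d}. rw k) \<Longrightarrow> (\<lambda>k. (rw k, cl' (inv g k))) ` {1..d} = shape d rw' cl'"
proof -
  interpret y': young d rw' cl' by (rule y')
  define c where "c k = cl' (inv g k)" for k
  have F: "fibre d c j = g ` fibre d cl' j" for j
  proof
    show "fibre d c j \<subseteq> g ` fibre d cl' j"
    proof
      fix k assume k: "k \<in> fibre d c j"
      have "inv g k \<in> fibre d cl' j" using k g by (auto simp: fibre_def c_def simp del: atLeastAtMost_iff)
      moreover have "k = g (inv g k)" using g by simp
      ultimately show "k \<in> g ` fibre d cl' j" by blast
    qed
    show "g ` fibre d cl' j \<subseteq> fibre d c j"
      using g by (auto simp: fibre_def c_def simp del: atLeastAtMost_iff)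
  qed
  have "inj g" using g by (simp add: perms_def permutes_inj)
  then have cF: "card (fibre d c j) = card (fibre d cl' j)" for j
    by (simp add: F card_image inj_on_subset)
  have inj': "inj_on rw (fibre d c j)" for j
    by (rule inj_onI, rule inj_onD[OF inj]) (simp_all add: fibre_def c_def)
  have J: "c ` {1..d} = cl' ` {1..d}"
  proof -
    have "inv g ` {1..d} = {1..d}" using inv_in_perms[OF g] by (simp add: perms_def permutes_image)
    then show ?thesis unfolding c_def by (metis image_image)
  qed
  let ?S = "\<lambda>j. rw ` fibre d c j"
  have cS: "card (?S j) = card (fibre d cl' j)" for j
    by (simp add: card_image inj' cF)
  have s1: "(\<Sum>k\<in>{1..d}. rw k) = (\<Sum>j\<in>cl' ` {1..d}. \<Sum>(?S j))"
    by (subst sum_fibres[of rw d c, symmetric]) (simp add: J[simplified] sum.reindex[OF inj'])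
  have s2: "(\<Sum>k\<in>{1..d}. rw' k) = (\<Sum>j\<in>cl' ` {1..d}. \<Sum>{..<card (?S j)})"
  proof (subst sum_fibres[of rw' d cl', symmetric], rule sum.cong[OF refl])
    fix j
    have "\<Sum>{..<card (fibre d cl' j)} = \<Sum>(rw' ` fibre d cl' j)" by (simp add: y'.rows_of_col)
    also have "\<dots> = (\<Sum>k\<in>fibre d cl' j. rw' k)" by (subst sum.reindex[OF y'.inj_col]) simp
    finally show "(\<Sum>k\<in>fibre d cl' j. rw' k) = \<Sum>{..<card (?S j)}" by (simp add: cS)
  qed
  have le: "\<Sum>{..<card (?S j)} \<le> \<Sum>(?S j)" for j
    using sum_initial_segment_le[of "?S j"] by simp
  show "(\<Sum>k\<in>{1..d}. rw' k) \<le> (\<Sum>k\<in>{1..d}. rw k)"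
    unfolding s1 s2 by (intro sum_mono le)
  assume "(\<Sum>k\<in>{1..d}. rw' k) = (\<Sum>k\<in>{1..d}. rw k)"
  then have eq: "(\<Sum>j\<in>cl' ` {1..d}. \<Sum>{..<card (?S j)}) = (\<Sum>j\<in>cl' ` {1..d}. \<Sum>(?S j))"
    unfolding s1 s2 .
  have "\<Sum>{..<card (?S j)} = \<Sum>(?S j)" if "j \<in> cl' ` {1..d}" for j
    by (rule sum_mono_inv[OF eq]) (use le that in auto)
  then have "?S j = {..<card (?S j)}" if "j \<in> cl' ` {1..d}" for j
    using sum_initial_segment_le[of "?S j"] that by simp
  then have S: "?S j = rw' ` fibre d cl' j" if "j \<in> cl' ` {1..d}" for j
    using that by (simp add: y'.rows_of_col cS)
  have "(i, j) \<in> (\<lambda>k. (rw k, c k)) ` {1..d} \<longleftrightarrow> (i, j) \<in> shape d rw' cl'" for i j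
  proof -
    have "(i, j) \<in> (\<lambda>k. (rw k, c k)) ` {1..d} \<longleftrightarrow> j \<in> cl' ` {1..d} \<and> i \<in> ?S j"
      unfolding J[symmetric] by (auto simp: fibre_def)
    also have "\<dots> \<longleftrightarrow> j \<in> cl' ` {1..d} \<and> i \<in> rw' ` fibre d cl' j" using S by blast
    also have "\<dots> \<longleftrightarrow> (i, j) \<in> shape d rw' cl'" by (auto simp: fibre_def shape_def)
    finally show ?thesis .
  qed
  then show "(\<lambda>k. (rw k, cl' (inv g k))) ` {1..d} = shape d rw' cl'"
    unfolding c_def by (intro set_eqI) (metis surj_pair)
qed

text \<open>The pigeonhole principle for tableaux: two entries share a row of the first filling and
  a column of the second one translated by \<open>g\<close>. Otherwise the weights would agree and
  the equality case of \<open>young_weight_le\<close> would apply; counting cells row by row, both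
  shapes would have equal row lengths.\<close>

lemma young_not_inj:
  assumes y: "young d rw cl" and y': "young d rw' cl'" and g: "g \<in> perms d"
    and le: "(\<Sum>k\<in>{1..d}. rw k) \<le> (\<Sum>k\<in>{1..d}. rw' k)" and ne: "shape d rw cl \<noteq> shape d rw' cl'"
  shows "\<not> inj_on (\<lambda>k. (rw k, cl' (inv g k))) {1..d}"
proof
  interpret y: young d rw cl by (rule y)
  interpret y': young d rw' cl' by (rule y')
  assume inj: "inj_on (\<lambda>k. (rw k, cl' (inv g k))) {1..d}"
  have "(\<Sum>k\<in>{1..d}. rw' k) = (\<Sum>k\<in>{1..d}. rw k)"
    using young_weight_le(1)[OF y y' g inj] le by simp
  then have im: "(\<lambda>k. (rw k, cl' (inv g k))) ` {1..d} = shape d rw' cl'"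
    by (rule young_weight_le(2)[OF y y' g inj])
  have "card (fibre d rw i) = card (fibre d rw' i)" for i
  proof -
    have "card (fibre d rw i) = card ((\<lambda>k. (rw k, cl' (inv g k))) ` fibre d rw i)"
      by (rule card_image[symmetric], rule inj_on_subset[OF inj]) (auto simp: fibre_def)
    also have "(\<lambda>k. (rw k, cl' (inv g k))) ` fibre d rw i = {c \<in> shape d rw' cl'. fst c = i}"
      unfolding im[symmetric] by (auto simp: fibre_def)
    also have "\<dots> = (\<lambda>k. (rw' k, cl' k)) ` fibre d rw' i"
      by (auto simp: fibre_def shape_def)
    also have "card \<dots> = card (fibre d rw' i)"
      by (rule card_image, rule inj_on_subset[OF y'.inj]) (auto simp: fibre_def)
    finally show ?thesis .
  qed
  then have "shape d rw cl = shape d rw' cl'"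
    by (intro set_eqI) (auto simp: y.shape_iff y'.shape_iff)
  with ne show False ..
qed

text \<open>By the equality case of \<open>young_weight_le\<close> the row of \<open>k\<close> and
  the column of \<open>inv g k\<close> always meet in a cell. Moving \<open>k\<close> within its row
  to that cell is a row permutation \<open>r\<close>, and \<open>r\<close> after \<open>g\<close>
  preserves columns.\<close>

lemma (in young) factor_if_inj:
  assumes g: "g \<in> perms d" and inj': "inj_on (\<lambda>k. (rw k, cl (inv g k))) {1..d}"
  obtains r q where "r \<in> stab d rw" "q \<in> stab d cl" "g = r \<circ> q"
proof -
  have im: "(\<lambda>k. (rw k, cl (inv g k))) ` {1..d} = shape d rw cl"
    by (rule young_weight_le(2)[OF young_axioms young_axioms g inj' refl])
  have "\<exists>l\<in>{1..d}. (rw k, cl (inv g k)) = (rw l, cl l)" if "k \<in> {1..d}" for k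
  proof -
    have "(rw k, cl (inv g k)) \<in> shape d rw cl" using that im by blast
    then show ?thesis by (auto simp: shape_def)
  qed
  then obtain h where h: "\<And>k. k \<in> {1..d} \<Longrightarrow> h k \<in> {1..d} \<and> rw (h k) = rw k \<and> cl (h k) = cl (inv g k)"
    by (metis prod.inject)
  define r where "r k = (if k \<in> {1..d} then h k else k)" for k
  have "inj_on r {1..d}"
  proof (rule inj_onI)
    fix k l assume kl: "k \<in> {1..d}" "l \<in> {1..d}" "r k = r l"
    then have "h k = h l" by (simp add: r_def)
    then have "rw k = rw l" "cl (inv g k) = cl (inv g l)" using h kl(1,2) by metis+
    then show "k = l" using inj_onD[OF inj', of k l] kl(1,2) by simp
  qed
  moreover have "r ` {1..d} \<subseteq> {1..d}" using h by (auto simp: r_def)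
  ultimately have "bij_betw r {1..d} {1..d}"
    unfolding bij_betw_def by (simp add: endo_inj_surj)
  then have "r permutes {1..d}"
    by (rule bij_imp_permutes) (auto simp: r_def)
  then have rp: "r \<in> perms d" by (simp add: perms_def)
  have r: "r \<in> stab d rw" using rp h by (auto simp: stab_def r_def)
  have "r \<circ> g \<in> stab d cl"
  proof -
    have "cl (r (g k)) = cl k" if "k \<in> {1..d}" for k
    proof -
      have "g k \<in> {1..d}" using that g by (simp del: atLeastAtMost_iff)
      then show ?thesis using h[of "g k"] g by (simp add: r_def)
    qed
    then show ?thesis using rp g by (simp add: stab_def)
  qed
  moreover have "g = inv r \<circ> (r \<circ> g)" using rp by simp
  ultimately show ?thesis using that inv_in_stab[OF r] by blast
qed

text \<open>Two entries in a common row and a common translated column give a transposition in the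
  row group whose conjugate by \<open>g\<close> lies in the column group. The first leaves the value
  at \<open>g\<close> unchanged, the second changes its sign.\<close>

lemma young_vanish_at:
  assumes g: "g \<in> perms d" and ninj: "\<not> inj_on (\<lambda>k. (rw k, cl (inv g k))) {1..d}"
  shows "conv d (row_sum d rw) (conv d x (col_sum d cl)) g = 0"
proof -
  obtain k l where kl: "k \<in> {1..d}" "l \<in> {1..d}" "k \<noteq> l" "rw k = rw l" "cl (inv g k) = cl (inv g l)"
    using ninj unfolding inj_on_def prod.inject by blast
  let ?y = "conv d (row_sum d rw) (conv d x (col_sum d cl))"
  let ?k = "inv g k" and ?l = "inv g l"
  have kl': "?k \<in> {1..d}" "?l \<in> {1..d}" using g kl by (simp_all del: atLeastAtMost_iff)
  have ne: "?k \<noteq> ?l" using kl perms_inv(6)[OF g] by metis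
  have eq: "transp k l \<circ> g = g \<circ> transp ?k ?l"
  proof
    fix m
    have "g m = k \<longleftrightarrow> m = ?k" "g m = l \<longleftrightarrow> m = ?l" using perms_inv(6,7)[OF g] by metis+
    then show "(transp k l \<circ> g) m = (g \<circ> transp ?k ?l) m"
      using perms_inv(6)[OF g] by (auto simp: Transposition.transpose_def)
  qed
  have "?y g = ?y (transp k l \<circ> g)"
    using row_sum_left[OF transp_in_stab[of k d l rw] g] kl by simp
  also have "\<dots> = - ?y g"
    unfolding eq conv_assoc[symmetric]
    using col_sum_right[OF transp_in_stab[of ?k d ?l cl] g, of "conv d (row_sum d rw) x"] kl kl' ne
    by (simp add: sign_swap_id)
  finally show ?thesis by (simp add: eq_neg_iff_add_eq_0)
qed

lemma young_vanish:
  assumes y: "young d rw cl" and y': "young d rw' cl'"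
    and le: "(\<Sum>k\<in>{1..d}. rw k) \<le> (\<Sum>k\<in>{1..d}. rw' k)" and ne: "shape d rw cl \<noteq> shape d rw' cl'"
  shows "conv d (row_sum d rw) (conv d x (col_sum d cl')) = 0"
  by (rule group_algebra_eqI[of _ d])
    (use young_not_inj[OF y y' _ le ne] in \<open>auto simp: young_vanish_at group_algebra_def conv_outside\<close>)

lemma sum_perms_inter:
  "(\<Sum>q\<in>perms d. if q \<in> stab d f then h q else 0) = (\<Sum>q\<in>stab d f. h q)"
  by (subst sum.inter_filter[symmetric]) (auto simp: stab_def intro!: sum.cong)

context young
begin

lemma stab_inter:
  assumes "p \<in> stab d rw" "p \<in> stab d cl" shows "p = id"
proof
  fix k show "p k = id k"
  proof (cases "k \<in> {1..d}")
    case True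
    have p: "p \<in> perms d" using assms by (simp add: stab_def)
    have "p k \<in> {1..d}" using p True by (simp del: atLeastAtMost_iff)
    then show ?thesis using eqI[of "p k" k] stabD[OF assms(1) True] stabD[OF assms(2) True] True by simp
  next
    case False
    then show ?thesis using assms(1) by (simp add: stab_def perms_def permutes_def)
  qed
qed

text \<open>Only the identity lies in both the row and the column group, so a single term
  contributes. This normalisation lets the scalars below be read off at \<open>id\<close>.\<close>

lemma ysym_id: "ysym d rw cl id = 1"
proof -
  have "ysym d rw cl id = (\<Sum>q\<in>perms d. row_sum d rw q * col_sum d cl (inv q))"
    by (simp add: ysym_def conv_apply)
  also have "\<dots> = (\<Sum>q\<in>perms d. if q = id then 1 else 0)"
  proof (intro sum.cong refl)
    fix q assume q: "q \<in> perms d"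
    show "row_sum d rw q * col_sum d cl (inv q) = (if q = id then 1 else 0)"
      using stab_inter[of q] inv_in_stab[of "inv q" d cl] perms_inv(3)[OF q]
      by (auto simp: row_sum_def col_sum_def)
  qed
  also have "\<dots> = 1" by simp
  finally show ?thesis .
qed

text \<open>Row invariance on the left and the sign rule on the right fix the values on all products
  of a row and a column permutation. At every other permutation both sides vanish by
  \<open>young_vanish_at\<close>.\<close>

lemma row_col_scalar:
  "conv d (row_sum d rw) (conv d x (col_sum d cl)) =
    fscale (conv d (row_sum d rw) (conv d x (col_sum d cl)) id) (ysym d rw cl)"
proof -
  have val: "conv d (row_sum d rw) (conv d z (col_sum d cl)) (r \<circ> q) =
      of_int (sign q) * conv d (row_sum d rw) (conv d z (col_sum d cl)) id"
    if "r \<in> stab d rw" "q \<in> stab d cl" for r q z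
  proof -
    have q: "q \<in> perms d" using that by (simp add: stab_def)
    have "conv d (row_sum d rw) (conv d z (col_sum d cl)) (r \<circ> q) =
      conv d (conv d (row_sum d rw) z) (col_sum d cl) (id \<circ> q)"
      using row_sum_left[OF that(1) q] by (simp add: conv_assoc)
    also have "\<dots> = of_int (sign q) * conv d (conv d (row_sum d rw) z) (col_sum d cl) id"
      by (rule col_sum_right[OF that(2)]) simp
    finally show ?thesis by (simp add: conv_assoc)
  qed
  \<comment> \<open>The identity inserted as middle factor makes \<open>val\<close> and
    \<open>young_vanish_at\<close> applicable to the symmetrizer itself.\<close>
  have ys: "ysym d rw cl = conv d (row_sum d rw) (conv d (basis_elt id) (col_sum d cl))"
    by (simp add: ysym_def group_algebra_def col_sum_def stab_def)
  show ?thesis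
  proof (rule group_algebra_eqI[of _ d])
    show "fscale (conv d (row_sum d rw) (conv d x (col_sum d cl)) id) (ysym d rw cl) \<in> group_algebra d"
      by (simp add: ysym_def)
    fix g assume g: "g \<in> perms d"
    show "conv d (row_sum d rw) (conv d x (col_sum d cl)) g =
      fscale (conv d (row_sum d rw) (conv d x (col_sum d cl)) id) (ysym d rw cl) g"
    proof (cases "inj_on (\<lambda>k. (rw k, cl (inv g k))) {1..d}")
      case True
      then obtain r q where rq: "r \<in> stab d rw" "q \<in> stab d cl" "g = r \<circ> q"
        using factor_if_inj[OF g] by blast
      have "ysym d rw cl g = of_int (sign q)"
        unfolding ys rq(3) val[OF rq(1,2)] unfolding ys[symmetric] ysym_id by simp
      then show ?thesis unfolding rq(3) val[OF rq(1,2)] by (simp add: fscale_def)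
    next
      case False
      then show ?thesis unfolding ys fscale_def by (simp add: young_vanish_at[OF g])
    qed
  qed simp
qed

end

lemma conv_inv:
  assumes "p \<in> perms d"
  shows "conv d f g (inv p) = conv d (\<lambda>q. g (inv q)) (\<lambda>q. f (inv q)) p"
proof -
  have "conv d f g (inv p) = (\<Sum>q\<in>perms d. f (inv p \<circ> inv q) * g q)"
    using assms by (simp add: conv_apply_right)
  also have "\<dots> = (\<Sum>q\<in>perms d. f (inv p \<circ> inv (inv q)) * g (inv q))"
    by (rule sum_perms_inv[symmetric])
  also have "\<dots> = (\<Sum>q\<in>perms d. g (inv q) * f (inv (inv q \<circ> p)))"
    using assms by (intro sum.cong refl) (simp add: inv_comp_perms[of _ d])
  finally show ?thesis using assms by (simp add: conv_apply)
qed

lemma row_sum_in [simp]: "row_sum d rw \<in> group_algebra d"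
  by (simp add: row_sum_def group_algebra_def stab_def)

lemma col_sum_in [simp]: "col_sum d cl \<in> group_algebra d"
  by (simp add: col_sum_def group_algebra_def stab_def)

lemma ysym_in [simp]: "ysym d rw cl \<in> group_algebra d"
  by (simp add: ysym_def)

lemma row_sum_inv: "p \<in> perms d \<Longrightarrow> row_sum d rw (inv p) = row_sum d rw p"
  using inv_in_stab[of p d rw] inv_in_stab[of "inv p" d rw] by (auto simp: row_sum_def)

lemma col_sum_inv: "p \<in> perms d \<Longrightarrow> col_sum d cl (inv p) = col_sum d cl p"
  using inv_in_stab[of p d cl] inv_in_stab[of "inv p" d cl] by (auto simp: col_sum_def sign_inv_perms)

lemma conv_cong:
  "(\<And>p. p \<in> perms d \<Longrightarrow> f p = f' p) \<Longrightarrow> (\<And>p. p \<in> perms d \<Longrightarrow> g p = g' p) \<Longrightarrow> conv d f g = conv d f' g'"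
  unfolding conv_def by (intro ext if_cong sum.cong refl) simp_all

lemma row_sum_square: "conv d (row_sum d rw) (row_sum d rw) = fscale (of_nat (card (stab d rw))) (row_sum d rw)"
proof (rule group_algebra_eqI[of _ d])
  fix p assume p: "p \<in> perms d"
  have "conv d (row_sum d rw) (row_sum d rw) p = (\<Sum>q\<in>perms d. if q \<in> stab d rw then row_sum d rw p else 0)"
    using p comp_stab_iff(1)[OF inv_in_stab, of _ d rw p]
    by (auto simp: conv_apply row_sum_def intro!: sum.cong)
  then show "conv d (row_sum d rw) (row_sum d rw) p = fscale (of_nat (card (stab d rw))) (row_sum d rw) p"
    by (simp add: sum_perms_inter fscale_def)
qed simp_all

lemma conv_Reals:
  assumes "\<And>p. f p \<in> \<real>" "\<And>p. g p \<in> \<real>" shows "conv d f g p \<in> \<real>"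
  using assms by (auto simp: conv_def intro!: sum_in_Reals)

lemma fscale_fscale [simp]: "fscale a (fscale b f) = fscale (a * b) f"
  by (simp add: fscale_def mult.assoc)

lemma fscale_0 [simp]: "fscale 0 f = 0" "fscale a 0 = 0"
  by (auto simp: fscale_def fun_eq_iff)

lemma fscale_1 [simp]: "fscale 1 f = f"
  by (simp add: fscale_def)

text \<open>Left without a factor \<open>1 / d!\<close>: for an idempotent \<open>e\<close> the
  values of \<open>class_avg d e\<close> are then, up to inversion of the argument, the character of
  the left ideal generated by \<open>e\<close>.\<close>

definition class_avg :: "nat \<Rightarrow> ((nat \<Rightarrow> nat) \<Rightarrow> complex) \<Rightarrow> (nat \<Rightarrow> nat) \<Rightarrow> complex" where
  "class_avg d f = (\<lambda>p. if p \<in> perms d then \<Sum>s\<in>perms d. f (inv s \<circ> p \<circ> s) else 0)"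

lemma class_avg_in [simp]: "class_avg d f \<in> group_algebra d"
  by (simp add: class_avg_def group_algebra_def)

lemma class_avg_alt:
  "class_avg d f = (\<Sum>s\<in>perms d. conv d (basis_elt s) (conv d f (basis_elt (inv s))))"
proof
  fix p show "class_avg d f p = (\<Sum>s\<in>perms d. conv d (basis_elt s) (conv d f (basis_elt (inv s)))) p"
    by (cases "p \<in> perms d")
      (simp_all add: class_avg_def sum_fun_apply conv_basis_left conv_basis_right conv_outside)
qed

lemma class_fun_class_avg: "class_fun d (class_avg d f)"
  unfolding class_fun_def
proof (intro conjI ballI)
  fix p s assume ps: "p \<in> perms d" "s \<in> perms d"
  have "class_avg d f (s \<circ> p \<circ> inv s) = (\<Sum>t\<in>perms d. f (inv t \<circ> (s \<circ> p \<circ> inv s) \<circ> t))"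
    using ps by (simp add: class_avg_def)
  also have "\<dots> = (\<Sum>t\<in>perms d. f (inv (s \<circ> t) \<circ> (s \<circ> p \<circ> inv s) \<circ> (s \<circ> t)))"
    by (rule sum_perms_left[OF ps(2), symmetric])
  also have "\<dots> = class_avg d f p"
    using ps by (auto simp: class_avg_def inv_comp_perms[of _ d] comp_assoc intro!: sum.cong)
  finally show "class_avg d f (s \<circ> p \<circ> inv s) = class_avg d f p" .
qed simp

lemma class_avg_scale: "class_avg d (fscale a f) = fscale a (class_avg d f)"
  by (auto simp: class_avg_def fscale_def sum_distrib_left fun_eq_iff)

lemma class_avg_id: "class_avg d f id = fact d * f id"
  by (simp add: class_avg_def card_perms)

lemma conv_class_avg:
  assumes "class_fun d z" shows "conv d z (class_avg d f) = class_avg d (conv d z f)"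
  unfolding class_avg_alt conv_sum_right
proof (rule sum.cong[OF refl])
  fix s
  have "conv d z (conv d (basis_elt s) (conv d f (basis_elt (inv s)))) =
    conv d (conv d z (basis_elt s)) (conv d f (basis_elt (inv s)))"
    by (simp only: conv_assoc)
  also have "\<dots> = conv d (conv d (basis_elt s) z) (conv d f (basis_elt (inv s)))"
    by (simp only: class_fun_central[OF assms])
  finally show "conv d z (conv d (basis_elt s) (conv d f (basis_elt (inv s)))) =
    conv d (basis_elt s) (conv d (conv d z f) (basis_elt (inv s)))"
    by (simp only: conv_assoc)
qed

lemma class_fun_scale: "class_fun d f \<Longrightarrow> class_fun d (fscale a f)"
  by (simp add: class_fun_def) (simp add: fscale_def)

context young
begin

abbreviation "ys \<equiv> ysym d rw cl"

text \<open>The scalar that separates \<open>ys\<close> from an idempotent. By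
  \<open>dim_specht_eq\<close> it equals \<open>d!\<close> over the dimension, which is the product
  of the hook lengths.\<close>

definition hook :: complex where "hook = conv d ys ys id"

lemma ys_scalar: "conv d ys (conv d x ys) = fscale (conv d ys (conv d x ys) id) ys"
proof -
  have "conv d ys (conv d x ys) = conv d (row_sum d rw) (conv d (conv d (conv d (col_sum d cl) x) (row_sum d rw)) (col_sum d cl))"
    by (simp add: ysym_def conv_assoc)
  then show ?thesis using row_col_scalar by metis
qed

lemma ys_square: "conv d ys ys = fscale hook ys"
  using ys_scalar[of "basis_elt id"] by (simp add: hook_def)

text \<open>With \<open>a\<close>, \<open>b\<close> the row and column sums, the element \<open>y = a b a\<close> is real and invariant under
  inversion, and \<open>y y\<close> is a multiple of \<open>hook y\<close>, whose coefficient at \<open>id\<close> is a sum of squares.\<close>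

lemma hook_nonzero: "hook \<noteq> 0"
proof -
  let ?a = "row_sum d rw" and ?b = "col_sum d cl"
  define y where "y = conv d ?a (conv d ?b ?a)"
  define R where "R = (of_nat (card (stab d rw)) :: complex)"
  have "card (stab d rw) \<noteq> 0" using id_in_stab[of d rw] by (metis card_0_eq empty_iff finite_stab)
  then have R: "R \<noteq> 0" by (simp add: R_def)
  have aa: "conv d ?a ?a = fscale R ?a" by (simp add: row_sum_square R_def)
  have ysab: "ys = conv d ?a ?b" by (simp add: ysym_def)
  have yid: "y id = R"
  proof -
    have "y id = conv d (conv d ?b ?a) ?a id" unfolding y_def by (rule conv_id_commute)
    also have "\<dots> = R * conv d ?b ?a id" by (simp add: conv_assoc aa conv_scale_right) (simp add: fscale_def)
    also have "conv d ?b ?a id = conv d ?a ?b id" by (rule conv_id_commute)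
    also have "\<dots> = 1" using ysym_id by (simp add: ysym_def)
    finally show ?thesis by (simp only: mult_1_right)
  qed
  have yinv: "y (inv p) = y p" if "p \<in> perms d" for p
  proof -
    have "conv d ?b ?a (inv q) = conv d ?a ?b q" if "q \<in> perms d" for q
      unfolding conv_inv[OF that] by (rule conv_cong[THEN fun_cong]) (simp_all add: row_sum_inv col_sum_inv)
    then have "y (inv p) = conv d (conv d ?a ?b) ?a p"
      unfolding y_def conv_inv[OF that] by (intro conv_cong[THEN fun_cong]) (simp_all add: row_sum_inv)
    then show ?thesis by (simp add: y_def conv_assoc)
  qed
  have yreal: "y p \<in> \<real>" for p
    unfolding y_def by (intro conv_Reals) (simp_all add: row_sum_def col_sum_def)
  have "conv d y y = fscale (R * hook) y"
  proof -
    have "conv d y y = conv d ?a (conv d ?b (conv d (conv d ?a ?a) (conv d ?b ?a)))"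
      by (simp add: y_def conv_assoc)
    also have "\<dots> = fscale R (conv d (conv d ys ys) ?a)"
      by (simp add: aa ysym_def conv_scale_left conv_scale_right conv_assoc)
    also have "\<dots> = fscale (R * hook) y"
      by (simp only: ys_square) (simp add: ysym_def y_def conv_scale_left conv_assoc)
    finally show ?thesis .
  qed
  then have yy: "conv d y y id = R * hook * R" by (simp add: fscale_def yid)
  have "conv d y y id = (\<Sum>q\<in>perms d. y q * y (inv q))" by (simp add: conv_apply)
  also have "\<dots> = (\<Sum>q\<in>perms d. of_real ((Re (y q))\<^sup>2))"
  proof (rule sum.cong[OF refl])
    fix q assume "q \<in> perms d"
    then show "y q * y (inv q) = of_real ((Re (y q))\<^sup>2)"
      using yinv[of q] of_real_Re[OF yreal[of q]] by (metis of_real_power power2_eq_square)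
  qed
  also have "\<dots> = of_real (\<Sum>q\<in>perms d. (Re (y q))\<^sup>2)" by simp
  also have "\<dots> \<noteq> 0"
  proof -
    have "(Re (y id))\<^sup>2 > 0" using R yid by (simp add: R_def)
    then have "(\<Sum>q\<in>perms d. (Re (y q))\<^sup>2) > 0"
      by (intro sum_pos2[of _ id]) simp_all
    then show ?thesis unfolding of_real_eq_0_iff by linarith
  qed
  finally show ?thesis using yy by auto
qed

text \<open>The class average of a primitive idempotent. As a function of permutations it is the
  character of the left ideal generated by \<open>ys\<close>.\<close>

definition char_elt :: "(nat \<Rightarrow> nat) \<Rightarrow> complex" where
  "char_elt = fscale (1 / hook) (class_avg d ys)"

lemma class_fun_char_elt: "class_fun d char_elt"
  unfolding char_elt_def by (intro class_fun_scale class_fun_class_avg)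

lemma char_elt_in [simp]: "char_elt \<in> group_algebra d"
  using class_fun_char_elt by (simp add: class_fun_def)

lemma char_elt_id: "char_elt id = fact d / hook"
  unfolding char_elt_def by (simp add: fscale_def class_avg_id ysym_id)

text \<open>Schur's lemma for a central \<open>z\<close>: as \<open>ys\<close> is idempotent up to
  \<open>hook\<close>, the product of \<open>z\<close> with \<open>ys\<close> can be written with
  \<open>ys\<close> on both sides of \<open>z\<close>, and \<open>ys_scalar\<close> applies. The
  scalar is the value at \<open>id\<close>, since \<open>ys\<close> is 1 there.\<close>

lemma class_fun_ys:
  assumes "class_fun d z" shows "conv d z ys = fscale (conv d z ys id) ys"
proof -
  have "fscale hook (conv d z ys) = conv d z (conv d ys ys)"
    by (simp add: ys_square conv_scale_right)
  also have "\<dots> = conv d ys (conv d z ys)"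
    using class_fun_central[OF assms] by (metis conv_assoc)
  also have "\<dots> = fscale (conv d ys (conv d z ys) id) ys" by (rule ys_scalar)
  finally have "fscale hook (conv d z ys) = fscale (conv d ys (conv d z ys) id) ys" .
  then have "fscale (1 / hook) (fscale hook (conv d z ys)) = fscale (1 / hook) (fscale (conv d ys (conv d z ys) id) ys)"
    by simp
  then obtain t where t: "conv d z ys = fscale t ys" using hook_nonzero by auto
  then have "conv d z ys id = t" using ysym_id by (simp add: fscale_def)
  with t show ?thesis by simp
qed

lemma class_fun_char_elt_conv:
  assumes "class_fun d z" shows "conv d z char_elt = fscale (conv d z ys id) char_elt"
proof -
  have "conv d z char_elt = fscale (1 / hook) (class_avg d (conv d z ys))"
    unfolding char_elt_def by (simp add: conv_scale_right conv_class_avg[OF assms])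
  also have "\<dots> = fscale (conv d z ys id) char_elt"
    by (subst class_fun_ys[OF assms]) (simp add: class_avg_scale char_elt_def)
  finally show ?thesis .
qed

text \<open>The product of \<open>ys\<close>, its class average and \<open>ys\<close> is evaluated
  at \<open>id\<close> in two ways. Expanding the average and applying \<open>ys_scalar\<close> to
  each term gives \<open>hook ^ 3\<close>; moving the central factor to the front gives
  \<open>hook\<close> times the value sought for the class average.\<close>

lemma char_elt_ys: "conv d char_elt ys id = hook"
proof -
  define S where "S s = conv d ys (conv d (basis_elt s) ys) id" for s
  have ysS: "conv d ys (conv d (basis_elt s) ys) = fscale (S s) ys" for s
    unfolding S_def by (rule ys_scalar)
  have S: "S s = hook * ys (inv s)" if s: "s \<in> perms d" for s
  proof -
    have "S s = conv d (conv d (basis_elt s) ys) ys id" unfolding S_def by (rule conv_id_commute)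
    also have "\<dots> = hook * conv d (basis_elt s) ys id"
      by (simp add: conv_assoc ys_square conv_scale_right) (simp add: fscale_def)
    finally show ?thesis using s by (simp add: conv_basis_left)
  qed
  have "conv d ys (conv d (class_avg d ys) ys) =
     (\<Sum>s\<in>perms d. conv d ys (conv d (basis_elt s) (conv d ys (conv d (basis_elt (inv s)) ys))))"
    by (simp add: class_avg_alt conv_sum_left conv_sum_right conv_assoc)
  also have "\<dots> = (\<Sum>s\<in>perms d. fscale (hook\<^sup>2 * (ys (inv s) * ys s)) ys)"
    by (rule sum.cong[OF refl])
      (simp add: ysS conv_scale_right S power2_eq_square algebra_simps)
  finally have "conv d ys (conv d (class_avg d ys) ys) id = hook\<^sup>2 * (\<Sum>s\<in>perms d. ys (inv s) * ys s)"
    by (simp add: sum_fun_apply fscale_def ysym_id sum_distrib_left)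
  also have "(\<Sum>s\<in>perms d. ys (inv s) * ys s) = hook"
    by (simp add: hook_def conv_apply_right)
  finally have 1: "conv d ys (conv d (class_avg d ys) ys) id = hook ^ 3"
    by (simp only: power2_eq_square power3_eq_cube)
  have "conv d ys (conv d (class_avg d ys) ys) = conv d (class_avg d ys) (conv d ys ys)"
    using class_fun_central[OF class_fun_class_avg] by (metis conv_assoc)
  then have "conv d ys (conv d (class_avg d ys) ys) id = hook * conv d (class_avg d ys) ys id"
    by (simp add: ys_square conv_scale_right) (simp add: fscale_def)
  with 1 have "conv d (class_avg d ys) ys id = hook\<^sup>2"
    using hook_nonzero by (simp add: power2_eq_square power3_eq_cube)
  then have "1 / hook * conv d (class_avg d ys) ys id = hook"
    using hook_nonzero by (simp add: power2_eq_square)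
  then show ?thesis unfolding char_elt_def by (simp add: conv_scale_left) (simp add: fscale_def)
qed

text \<open>Hence dividing \<open>char_elt\<close> by \<open>hook\<close> yields a central
  idempotent.\<close>

lemma char_elt_square: "conv d char_elt char_elt = fscale hook char_elt"
  using class_fun_char_elt_conv[OF class_fun_char_elt] by (simp add: char_elt_ys)

end

lemma char_elt_orthogonal:
  assumes y: "young d rw cl" and y': "young d rw' cl'" and ne: "shape d rw cl \<noteq> shape d rw' cl'"
  shows "conv d (young.char_elt d rw cl) (young.char_elt d rw' cl') = 0"
proof -
  \<comment> \<open>The vanishing lemma is one-sided: the filling of smaller weight has to stand on
    the left. The other order follows because class functions are central.\<close>
  have main: "conv d (young.char_elt d rw cl) (young.char_elt d rw' cl') = 0"
    if y: "young d rw cl" and y': "young d rw' cl'" and ne: "shape d rw cl \<noteq> shape d rw' cl'"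
    and le: "(\<Sum>k\<in>{1..d}. rw k) \<le> (\<Sum>k\<in>{1..d}. rw' k)" for rw cl rw' cl'
  proof -
    interpret y: young d rw cl by (rule y)
    interpret y': young d rw' cl' by (rule y')
    have 0: "conv d (ysym d rw cl) (conv d x (ysym d rw' cl')) = 0" for x
    proof -
      have "conv d (ysym d rw cl) (conv d x (ysym d rw' cl')) =
        conv d (row_sum d rw) (conv d (conv d (col_sum d cl) (conv d x (row_sum d rw'))) (col_sum d cl'))"
        by (simp add: ysym_def conv_assoc)
      then show ?thesis by (simp add: young_vanish[OF y y' le ne])
    qed
    have "conv d (class_avg d (ysym d rw cl)) (ysym d rw' cl') = 0"
      by (simp add: class_avg_alt conv_sum_left conv_assoc 0)
    then show ?thesis
      unfolding y'.char_elt_def using conv_class_avg[OF y.class_fun_char_elt, of "ysym d rw' cl'"]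
      by (simp add: conv_scale_right y.char_elt_def conv_scale_left)
         (simp add: class_avg_def fun_eq_iff fscale_def)
  qed
  show ?thesis
  proof (cases "(\<Sum>k\<in>{1..d}. rw k) \<le> (\<Sum>k\<in>{1..d}. rw' k)")
    case True then show ?thesis by (rule main[OF y y' ne])
  next
    case False
    then have "conv d (young.char_elt d rw' cl') (young.char_elt d rw cl) = 0"
      by (intro main[OF y' y]) (use ne in auto)
    then show ?thesis using class_fun_central[OF young.class_fun_char_elt[OF y]] by metis
  qed
qed

section \<open>Cycle types and conjugacy classes\<close>

lemma bij_betw_orbit:
  assumes "permutation p"
  shows "bij_betw (\<lambda>i. (p ^^ i) x) {..<card (orbit p x)} (orbit p x)"
proof -
  have x: "x \<in> orbit p x" by (rule permutation_self_in_orbit[OF assms])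
  let ?m = "funpow_dist1 p x x"
  have b: "bij_betw (\<lambda>i. (p ^^ i) x) {0..<?m} (orbit p x)"
    using inj_on_funpow_dist1[OF x] orbit_conv_funpow_dist1[OF x] by (simp add: bij_betw_def)
  then have "card (orbit p x) = ?m" using bij_betw_same_card[OF b] by simp
  with b show ?thesis by (simp add: atLeast0LessThan)
qed

lemma funpow_card_orbit:
  assumes "permutation p"
  shows "(p ^^ card (orbit p x)) x = x"
proof -
  have x: "x \<in> orbit p x" by (rule permutation_self_in_orbit[OF assms])
  have b: "bij_betw (\<lambda>i. (p ^^ i) x) {0..<funpow_dist1 p x x} (orbit p x)"
    using inj_on_funpow_dist1[OF x] orbit_conv_funpow_dist1[OF x] by (simp add: bij_betw_def)
  show ?thesis using bij_betw_same_card[OF b] funpow_dist1_prop[OF x] by simp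
qed

lemma card_orbit_pos: "permutation p \<Longrightarrow> card (orbit p x) > 0"
  using finite_orbit permutation_self_in_orbit card_gt_0_iff by (metis empty_iff)

lemma funpow_eq_iff_orbit:
  assumes "permutation p"
  shows "(p ^^ i) x = (p ^^ j) x \<longleftrightarrow> i mod card (orbit p x) = j mod card (orbit p x)"
proof -
  let ?m = "card (orbit p x)"
  have m: "(p ^^ (k mod ?m)) x = (p ^^ k) x" for k
    by (rule funpow_mod_eq[OF funpow_card_orbit[OF assms]])
  have "inj_on (\<lambda>i. (p ^^ i) x) {..<?m}" using bij_betw_orbit[OF assms] by (simp add: bij_betw_def)
  then have "(p ^^ (i mod ?m)) x = (p ^^ (j mod ?m)) x \<longleftrightarrow> i mod ?m = j mod ?m"
    using card_orbit_pos[OF assms, of x] by (auto dest!: inj_onD)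
  then show ?thesis by (simp add: m)
qed

lemma orbit_funpowE:
  assumes "permutation p" "y \<in> orbit p x" obtains n where "(p ^^ n) x = y"
  using assms by (auto simp: orbit_altdef_permutation)

lemma orbit_eq:
  assumes "permutation p" "y \<in> orbit p x" shows "orbit p y = orbit p x"
  by (metis assms cyclic_on_orbit' orbit_cyclic_eq3)

lemma orbit_subset_perms: "p \<in> perms d \<Longrightarrow> x \<in> {1..d} \<Longrightarrow> orbit p x \<subseteq> {1..d}"
  by (rule permutes_orbit_subset) (simp_all add: perms_def)

text \<open>The conjugator matches the orbits of \<open>p\<close> and \<open>q\<close> by a size preserving bijection and then
  the points \<open>p\<^sup>n x\<close> and \<open>q\<^sup>n y\<close> for chosen base points \<open>x\<close> and \<open>y\<close> of matching orbits.\<close>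

lemma cycle_type_conjugate:
  assumes p: "p \<in> perms d" and q: "q \<in> perms d" and eq: "cycle_type d p = cycle_type d q"
  obtains s where "s \<in> perms d" "q = s \<circ> p \<circ> inv s"
proof -
  let ?D = "{1..d}"
  define P where "P = orbit p ` ?D"
  define Q where "Q = orbit q ` ?D"
  note pp = perms_permutation[OF p] and qp = perms_permutation[OF q]
  have fin: "finite P" "finite Q" by (simp_all add: P_def Q_def)
  have "size (cycle_type d p) = card P" "size (cycle_type d q) = card Q"
    by (simp_all add: cycle_type_def P_def Q_def)
  then have "card P = card Q" using eq by simp
  then obtain e where e: "bij_betw e P Q" using finite_same_card_bij[OF fin] by blast
  have "image_mset card (mset_set P) = image_mset card (mset_set (e ` P))"
    using eq e by (simp add: cycle_type_def P_def Q_def bij_betw_def)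
  also have "\<dots> = image_mset (\<lambda>Z. card (e Z)) (mset_set P)"
    using e by (subst image_mset_mset_set[of e P, symmetric]) (auto simp: bij_betw_def multiset.map_comp o_def)
  \<comment> \<open>An arbitrary bijection \<open>e\<close> between the two sets of orbits preserves
    sizes after correction by a permutation \<open>u\<close> of its source.\<close>
  finally obtain u where u: "u permutes P" "\<forall>Z\<in>P. card Z = card (e (u Z))"
    using image_mset_eq_implies_permutes[OF fin(1)] by metis
  define \<beta> where "\<beta> Z = e (u Z)" for Z
  have \<beta>: "bij_betw \<beta> P Q" "\<And>Z. Z \<in> P \<Longrightarrow> card (\<beta> Z) = card Z"
    unfolding \<beta>_def using bij_betw_trans[OF permutes_imp_bij[OF u(1)] e] u(2) by (simp_all add: o_def)
  define bp where "bp Z = (SOME x. x \<in> ?D \<and> orbit p x = Z)" for Z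
  define bq where "bq Z = (SOME x. x \<in> ?D \<and> orbit q x = Z)" for Z
  have bp: "bp Z \<in> ?D" "orbit p (bp Z) = Z" if "Z \<in> P" for Z
    using that someI_ex[of "\<lambda>x. x \<in> ?D \<and> orbit p x = Z"] unfolding P_def bp_def by blast+
  have bq: "bq Z \<in> ?D" "orbit q (bq Z) = Z" if "Z \<in> Q" for Z
    using that someI_ex[of "\<lambda>x. x \<in> ?D \<and> orbit q x = Z"] unfolding Q_def bq_def by blast+
  have inQ: "\<beta> (orbit p k) \<in> Q" if "k \<in> ?D" for k
    using that \<beta>(1) by (auto simp: bij_betw_def P_def)
  have orb: "orbit p k \<in> P" if "k \<in> ?D" for k using that by (auto simp: P_def)
  have ex: "\<exists>n. (p ^^ n) (bp (orbit p k)) = k" if "k \<in> ?D" for k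
  proof -
    have "k \<in> orbit p (bp (orbit p k))"
      using bp(2)[OF orb[OF that]] permutation_self_in_orbit[OF pp] by simp
    then show ?thesis by (rule orbit_funpowE[OF pp]) blast
  qed
  define n where "n k = (SOME n. (p ^^ n) (bp (orbit p k)) = k)" for k
  have n: "(p ^^ n k) (bp (orbit p k)) = k" if "k \<in> ?D" for k
    unfolding n_def by (rule someI_ex[OF ex[OF that]])
  define s where "s k = (if k \<in> ?D then (q ^^ n k) (bq (\<beta> (orbit p k))) else k)" for k
  \<comment> \<open>Any exponent reaching \<open>k\<close> gives the same value, because matched
    orbits have the same length. This well-definedness yields the intertwining relation
    below.\<close>
  have s_val: "s k = (q ^^ m) (bq (\<beta> (orbit p k)))" if k: "k \<in> ?D" "(p ^^ m) (bp (orbit p k)) = k" for k m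
  proof -
    have "(p ^^ m) (bp (orbit p k)) = (p ^^ n k) (bp (orbit p k))" using k n by simp
    then have "m mod card (orbit p k) = n k mod card (orbit p k)"
      unfolding funpow_eq_iff_orbit[OF pp] bp(2)[OF orb[OF k(1)]] .
    then have "(q ^^ m) (bq (\<beta> (orbit p k))) = (q ^^ n k) (bq (\<beta> (orbit p k)))"
      unfolding funpow_eq_iff_orbit[OF qp] bq(2)[OF inQ[OF k(1)]] \<beta>(2)[OF orb[OF k(1)]] .
    then show ?thesis using k by (simp add: s_def)
  qed
  have s_orb: "s k \<in> \<beta> (orbit p k)" if "k \<in> ?D" for k
  proof -
    have "(q ^^ n k) (bq (\<beta> (orbit p k))) \<in> orbit q (bq (\<beta> (orbit p k)))"
      by (rule funpow_in_orbit[OF permutation_self_in_orbit[OF qp]])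
    then show ?thesis unfolding s_def bq(2)[OF inQ[OF that]] using that by simp
  qed
  have s_in: "s k \<in> ?D" if "k \<in> ?D" for k
    using s_orb[OF that] orbit_subset_perms[OF q bq(1)[OF inQ[OF that]]] bq(2)[OF inQ[OF that]] by auto
  have s_orbit: "orbit q (s k) = \<beta> (orbit p k)" if "k \<in> ?D" for k
    using orbit_eq[OF qp, of "s k" "bq (\<beta> (orbit p k))"] s_orb[OF that] bq(2)[OF inQ[OF that]] by simp
  have "inj_on s ?D"
  proof (rule inj_onI)
    fix k l assume kl: "k \<in> ?D" "l \<in> ?D" "s k = s l"
    have "\<beta> (orbit p k) = \<beta> (orbit p l)" using s_orbit kl by metis
    then have o: "orbit p k = orbit p l" using \<beta>(1) orb kl by (auto simp: bij_betw_def dest: inj_onD)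
    have "(q ^^ n k) (bq (\<beta> (orbit p k))) = (q ^^ n l) (bq (\<beta> (orbit p k)))"
      using kl o by (simp add: s_def)
    then have "n k mod card (orbit p k) = n l mod card (orbit p k)"
      unfolding funpow_eq_iff_orbit[OF qp] bq(2)[OF inQ[OF kl(1)]] \<beta>(2)[OF orb[OF kl(1)]] .
    then have "(p ^^ n k) (bp (orbit p k)) = (p ^^ n l) (bp (orbit p k))"
      unfolding funpow_eq_iff_orbit[OF pp] bp(2)[OF orb[OF kl(1)]] .
    moreover have "(p ^^ n k) (bp (orbit p k)) = k" by (rule n[OF kl(1)])
    moreover have "(p ^^ n l) (bp (orbit p k)) = l" using n[OF kl(2)] unfolding o .
    ultimately show "k = l" by (simp only:)
  qed
  moreover have "s ` ?D \<subseteq> ?D" using s_in by blast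
  ultimately have "bij_betw s ?D ?D" unfolding bij_betw_def by (simp add: endo_inj_surj)
  then have s: "s \<in> perms d" unfolding perms_def mem_Collect_eq
    by (rule bij_imp_permutes) (simp only: s_def if_False)
  have "s \<circ> p = q \<circ> s"
  proof
    fix k show "(s \<circ> p) k = (q \<circ> s) k"
    proof (cases "k \<in> ?D")
      case True
      have pk: "p k \<in> ?D" using perms_in_iff[OF p] True by blast
      have o: "orbit p (p k) = orbit p k" by (rule permutation_orbit_step[OF pp])
      have "(p ^^ Suc (n k)) (bp (orbit p (p k))) = p k" using n[OF True] o by simp
      from s_val[OF pk this] show ?thesis using True o by (simp add: s_def)
    next
      case False
      then have "p k = k" "q k = k" using p q by (auto simp: perms_def permutes_def)
      then show ?thesis using False by (simp only: s_def if_False o_apply)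
    qed
  qed
  then have "q = s \<circ> p \<circ> inv s" using s by (metis comp_assoc comp_id perms_inv(1))
  with s that show ?thesis by blast
qed

section \<open>Conjugacy classes indexed by partitions\<close>

lemma orbits_partition:
  assumes "p \<in> perms d"
  shows "\<Union>(orbit p ` {1..d}) = {1..d}" "disjoint (orbit p ` {1..d})"
proof -
  note pp = perms_permutation[OF assms]
  show "\<Union>(orbit p ` {1..d}) = {1..d}"
  proof
    show "{1..d} \<subseteq> \<Union>(orbit p ` {1..d})" using permutation_self_in_orbit[OF pp] by blast
  qed (use orbit_subset_perms[OF assms] in blast)
  show "disjoint (orbit p ` {1..d})"
    unfolding disjoint_def using orbit_eq[OF pp] by blast
qed

lemma sum_cycle_type:
  assumes "p \<in> perms d" shows "sum_mset (cycle_type d p) = d" "0 \<notin># cycle_type d p"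
proof -
  note pp = perms_permutation[OF assms]
  have fin: "finite Z" if "Z \<in> orbit p ` {1..d}" for Z
    using that by (auto intro!: finite_orbit permutation_self_in_orbit[OF pp])
  have "sum_mset (cycle_type d p) = (\<Sum>Z\<in>orbit p ` {1..d}. card Z)"
    by (simp add: cycle_type_def sum_unfold_sum_mset)
  also have "\<dots> = card (\<Union>(orbit p ` {1..d}))"
    by (rule card_Union_disjoint[symmetric]) (use orbits_partition(2)[OF assms] fin in auto)
  finally show "sum_mset (cycle_type d p) = d" by (simp only: orbits_partition(1)[OF assms] card_atLeastAtMost diff_Suc_1)
  show "0 \<notin># cycle_type d p"
  proof
    assume "0 \<in># cycle_type d p"
    then obtain k where "card (orbit p k) = 0" by (auto simp: cycle_type_def)
    then show False using card_orbit_pos[OF pp, of k] by simp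
  qed
qed

lemma finite_partitions [simp]: "finite (partitions d)"
proof (rule finite_subset)
  show "partitions d \<subseteq> {xs. set xs \<subseteq> {0..d} \<and> length xs \<le> d}"
  proof
    fix xs assume xs: "xs \<in> partitions d"
    then have s: "sum_list xs = d" "0 \<notin> set xs" by (auto simp: partitions_def)
    have "set xs \<subseteq> {0..d}" unfolding s(1)[symmetric] by (auto intro: member_le_sum_list)
    moreover have "length xs \<le> sum_list xs" using s(2)
      by (induction xs) (auto simp: Suc_le_eq intro: add_less_le_mono)
    ultimately show "xs \<in> {xs. set xs \<subseteq> {0..d} \<and> length xs \<le> d}" using s by simp
  qed
qed (rule finite_lists_length_le, simp)

lemma partitions_mset_unique:
  assumes "\<alpha> \<in> partitions d" "\<beta> \<in> partitions d" "mset \<alpha> = mset \<beta>" shows "\<alpha> = \<beta>"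
proof -
  have "sorted (rev \<alpha>)" "sorted (rev \<beta>)" using assms by (auto simp: partitions_def sorted_wrt_rev)
  then have "sort (rev \<alpha>) = rev \<beta>" using assms by (intro properties_for_sort) auto
  then show ?thesis using \<open>sorted (rev \<alpha>)\<close> by (simp add: sorted_sort_id)
qed

lemma conj_class_perms: "\<alpha> \<in> partitions d \<Longrightarrow> conj_class \<alpha> = {p \<in> perms d. cycle_type d p = mset \<alpha>}"
  by (simp add: conj_class_def partitions_def)

lemma ex_conj_class:
  assumes "p \<in> perms d" obtains \<alpha> where "\<alpha> \<in> partitions d" "p \<in> conj_class \<alpha>"
proof -
  define \<alpha> where "\<alpha> = rev (sorted_list_of_multiset (cycle_type d p))"
  have m: "mset \<alpha> = cycle_type d p" by (simp add: \<alpha>_def)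
  have "sum_list \<alpha> = d" using sum_cycle_type(1)[OF assms] m by (metis sum_mset_sum_list)
  moreover have "0 \<notin> set \<alpha>" using sum_cycle_type(2)[OF assms] m by (metis set_mset_mset)
  moreover have "sorted_wrt (\<ge>) \<alpha>" by (simp add: \<alpha>_def sorted_wrt_rev)
  ultimately have "\<alpha> \<in> partitions d" by (simp add: partitions_def)
  with that m assms show ?thesis by (simp add: conj_class_perms)
qed

lemma conj_class_disjoint:
  "\<alpha> \<in> partitions d \<Longrightarrow> \<beta> \<in> partitions d \<Longrightarrow> p \<in> conj_class \<alpha> \<Longrightarrow> p \<in> conj_class \<beta> \<Longrightarrow> \<alpha> = \<beta>"
  using partitions_mset_unique by (auto simp: conj_class_perms)

lemma sum_conj_classes:
  "(\<Sum>\<alpha>\<in>partitions d. \<Sum>p\<in>conj_class \<alpha>. f p) = (\<Sum>p\<in>perms d. f p)"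
proof -
  have "(\<Union>\<alpha>\<in>partitions d. conj_class \<alpha>) = perms d"
  proof
    show "perms d \<subseteq> (\<Union>\<alpha>\<in>partitions d. conj_class \<alpha>)" using ex_conj_class by blast
  qed (auto simp: conj_class_perms)
  moreover have "(\<Sum>p\<in>(\<Union>\<alpha>\<in>partitions d. conj_class \<alpha>). f p) = (\<Sum>\<alpha>\<in>partitions d. \<Sum>p\<in>conj_class \<alpha>. f p)"
    by (rule sum.UNION_disjoint) (auto simp: conj_class_perms dest: partitions_mset_unique)
  ultimately show ?thesis by simp
qed

lemma class_fun_conj_class:
  assumes "class_fun d f" "\<alpha> \<in> partitions d" "p \<in> conj_class \<alpha>" "q \<in> conj_class \<alpha>"
  shows "f p = f q"
proof -
  have pq: "p \<in> perms d" "q \<in> perms d" "cycle_type d p = cycle_type d q"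
    using assms by (auto simp: conj_class_perms)
  then obtain s where "s \<in> perms d" "q = s \<circ> p \<circ> inv s" using cycle_type_conjugate by blast
  then show ?thesis using class_funD[OF assms(1) pq(1)] by simp
qed

text \<open>A permutation and its inverse have the same orbits, hence the same cycle type. This
  removes the inverses that appear in traces of left multiplications and of place
  permutations.\<close>

lemma class_fun_inv:
  assumes "class_fun d f" "p \<in> perms d" shows "f (inv p) = f p"
proof -
  obtain \<alpha> where \<alpha>: "\<alpha> \<in> partitions d" "p \<in> conj_class \<alpha>" using ex_conj_class[OF assms(2)] .
  have "orbit (inv p) = orbit p" using orbit_inv_eq[OF perms_permutation[OF assms(2)]] by blast
  then have "inv p \<in> conj_class \<alpha>" using \<alpha> assms(2) by (simp add: conj_class_perms cycle_type_def)
  then show ?thesis using class_fun_conj_class[OF assms(1) \<alpha>(1)] \<alpha>(2) by blast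
qed

section \<open>Central idempotents and characters\<close>

lemma cells_snoc: "cells (\<nu> @ [n]) = cells \<nu> \<union> {length \<nu>} \<times> {..<n}"
  by (auto simp: cells_def nth_append less_Suc_eq)

lemma tableau_bij: "bij_betw (tableau \<nu>) (cells \<nu>) {1..sum_list \<nu>}"
proof (induction \<nu> rule: rev_induct)
  case Nil
  then show ?case by (simp add: cells_def bij_betw_def)
next
  case (snoc n \<nu>)
  have "bij_betw (tableau (\<nu> @ [n])) (cells \<nu>) {1..sum_list \<nu>}"
    using snoc by (rule bij_betw_cong[THEN iffD1, rotated]) (auto simp: cells_def tableau_def)
  moreover have "bij_betw (tableau (\<nu> @ [n])) ({length \<nu>} \<times> {..<n}) {sum_list \<nu> + 1..sum_list \<nu> + n}"
    by (rule bij_betw_byWitness[where f' = "\<lambda>k. (length \<nu>, k - sum_list \<nu> - 1)"]) (auto simp: tableau_def)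
  ultimately have "bij_betw (tableau (\<nu> @ [n])) (cells \<nu> \<union> {length \<nu>} \<times> {..<n})
      ({1..sum_list \<nu>} \<union> {sum_list \<nu> + 1..sum_list \<nu> + n})"
    by (rule bij_betw_combine) auto
  moreover have "{1..sum_list \<nu>} \<union> {sum_list \<nu> + 1..sum_list \<nu> + n} = {1..sum_list (\<nu> @ [n])}" by auto
  ultimately show ?case by (simp only: cells_snoc)
qed

lemma finite_cells [simp]: "finite (cells \<nu>)"
  using bij_betw_finite[OF tableau_bij[of \<nu>]] by simp

definition cell_of :: "nat list \<Rightarrow> nat \<Rightarrow> nat \<times> nat" where
  "cell_of \<nu> = inv_into (cells \<nu>) (tableau \<nu>)"

definition row_of :: "nat list \<Rightarrow> nat \<Rightarrow> nat" where "row_of \<nu> k = fst (cell_of \<nu> k)"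
definition col_of :: "nat list \<Rightarrow> nat \<Rightarrow> nat" where "col_of \<nu> k = snd (cell_of \<nu> k)"

lemma cell_of_bij: "bij_betw (cell_of \<nu>) {1..sum_list \<nu>} (cells \<nu>)"
  unfolding cell_of_def by (rule bij_betw_inv_into[OF tableau_bij])

lemma cell_of_tableau: "c \<in> cells \<nu> \<Longrightarrow> cell_of \<nu> (tableau \<nu> c) = c"
  unfolding cell_of_def by (rule bij_betw_inv_into_left[OF tableau_bij])

lemma tableau_cell_of: "k \<in> {1..sum_list \<nu>} \<Longrightarrow> tableau \<nu> (cell_of \<nu> k) = k"
  unfolding cell_of_def by (rule bij_betw_inv_into_right[OF tableau_bij])

lemma cell_of_in: "k \<in> {1..sum_list \<nu>} \<Longrightarrow> cell_of \<nu> k \<in> cells \<nu>"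
  by (rule bij_betwE[OF cell_of_bij, rule_format])

lemma tableau_in: "c \<in> cells \<nu> \<Longrightarrow> tableau \<nu> c \<in> {1..sum_list \<nu>}"
  by (rule bij_betwE[OF tableau_bij, rule_format])

lemma cell_of_pair: "(\<lambda>k. (row_of \<nu> k, col_of \<nu> k)) = cell_of \<nu>"
  by (simp add: row_of_def col_of_def)

lemma shape_cells: "shape (sum_list \<nu>) (row_of \<nu>) (col_of \<nu>) = cells \<nu>"
  unfolding shape_def cell_of_pair using cell_of_bij by (simp add: bij_betw_def)

lemma cells_down:
  assumes "sorted_wrt (\<ge>) \<nu>" "(i, j) \<in> cells \<nu>" "i' \<le> i" "j' \<le> j"
  shows "(i', j') \<in> cells \<nu>"
proof -
  have "\<nu> ! i \<le> \<nu> ! i'" using assms sorted_wrt_nth_less[OF assms(1), of i' i]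
    by (cases "i' = i") (auto simp: cells_def)
  then show ?thesis using assms by (auto simp: cells_def)
qed

lemma young_partition:
  assumes "\<nu> \<in> partitions d" shows "young d (row_of \<nu>) (col_of \<nu>)"
proof
  have d: "sum_list \<nu> = d" and s: "sorted_wrt (\<ge>) \<nu>" using assms by (auto simp: partitions_def)
  show "inj_on (\<lambda>k. (row_of \<nu> k, col_of \<nu> k)) {1..d}"
    unfolding cell_of_pair using cell_of_bij[of \<nu>] d by (simp add: bij_betw_def)
  fix k i j assume k: "k \<in> {1..d}" "i \<le> row_of \<nu> k" "j \<le> col_of \<nu> k"
  have "(row_of \<nu> k, col_of \<nu> k) \<in> cells \<nu>" using cell_of_in[of k \<nu>] k(1) d by (simp add: row_of_def col_of_def)
  then have c: "(i, j) \<in> cells \<nu>" using cells_down[OF s] k by blast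
  then show "\<exists>l\<in>{1..d}. row_of \<nu> l = i \<and> col_of \<nu> l = j"
    using tableau_in[OF c] d cell_of_tableau[OF c]
    by (intro bexI[of _ "tableau \<nu> (i, j)"]) (auto simp: row_of_def col_of_def)
qed

text \<open>Without rows of length 0 the number of rows is visible in column 0, and each row length
  is the number of cells in that row.\<close>

lemma cells_eqD:
  assumes "cells \<nu> = cells \<mu>" "0 \<notin> set \<nu>" "0 \<notin> set \<mu>" shows "\<nu> = \<mu>"
proof -
  have len: "i < length \<kappa> \<longleftrightarrow> (i, 0) \<in> cells \<kappa>" if "0 \<notin> set \<kappa>" for \<kappa> i
    using that by (auto simp: cells_def) (metis nth_mem gr0I)
  have nth: "\<kappa> ! i = card {j. (i, j) \<in> cells \<kappa>}" if "i < length \<kappa>" for \<kappa> i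
    using that by (simp add: cells_def)
  have "\<And>i. i < length \<nu> \<longleftrightarrow> i < length \<mu>" using len assms by metis
  then have "length \<nu> = length \<mu>" by (metis linorder_neqE_nat less_irrefl)
  then show ?thesis by (rule nth_equalityI) (metis nth assms(1) \<open>length \<nu> = length \<mu>\<close>)
qed

lemma shape_partition_inj:
  assumes "\<nu> \<in> partitions d" "\<mu> \<in> partitions d" "\<nu> \<noteq> \<mu>"
  shows "shape d (row_of \<nu>) (col_of \<nu>) \<noteq> shape d (row_of \<mu>) (col_of \<mu>)"
proof -
  have "shape d (row_of \<nu>) (col_of \<nu>) = cells \<nu>" "shape d (row_of \<mu>) (col_of \<mu>) = cells \<mu>"
    using shape_cells[of \<nu>] shape_cells[of \<mu>] assms by (auto simp: partitions_def)
  then show ?thesis using cells_eqD[of \<nu> \<mu>] assms by (auto simp: partitions_def)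
qed

lemma ball_cells: "(\<forall>c\<in>cells \<nu>. P c) \<longleftrightarrow> (\<forall>k\<in>{1..sum_list \<nu>}. P (cell_of \<nu> k))"
  using cell_of_bij[of \<nu>] unfolding bij_betw_def by (metis (no_types, lifting) imageE imageI)

lemma same_fibre_iff:
  assumes p: "p \<in> perms (sum_list \<nu>)"
  shows "(\<forall>c\<in>cells \<nu>. \<exists>c'\<in>cells \<nu>. f c' = f c \<and> p (tableau \<nu> c) = tableau \<nu> c')
    \<longleftrightarrow> (\<forall>k\<in>{1..sum_list \<nu>}. f (cell_of \<nu> (p k)) = f (cell_of \<nu> k))"
  unfolding ball_cells
proof (rule ball_cong[OF refl])
  fix k assume k: "k \<in> {1..sum_list \<nu>}"
  have pk: "p k \<in> {1..sum_list \<nu>}" using perms_in_iff[OF p] k by blast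
  show "(\<exists>c'\<in>cells \<nu>. f c' = f (cell_of \<nu> k) \<and> p (tableau \<nu> (cell_of \<nu> k)) = tableau \<nu> c')
      \<longleftrightarrow> f (cell_of \<nu> (p k)) = f (cell_of \<nu> k)"
    unfolding tableau_cell_of[OF k]
    using cell_of_tableau[of _ \<nu>] tableau_cell_of[OF pk] cell_of_in[OF pk] by metis
qed

lemma row_group_stab: "row_group \<nu> = stab (sum_list \<nu>) (row_of \<nu>)"
  unfolding row_group_def stab_def row_of_def using same_fibre_iff[of _ \<nu> fst] by blast

lemma col_group_stab: "col_group \<nu> = stab (sum_list \<nu>) (col_of \<nu>)"
  unfolding col_group_def stab_def col_of_def using same_fibre_iff[of _ \<nu> snd] by blast

lemma young_symmetrizer_ysym:
  "young_symmetrizer \<nu> = ysym (sum_list \<nu>) (row_of \<nu>) (col_of \<nu>)"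
proof -
  have "(\<Sum>p\<in>stab d f. basis_elt p) = row_sum d f" for d f
    by (rule ext) (simp add: sum_fun_apply basis_elt_def row_sum_def)
  moreover have "(\<Sum>p\<in>stab d f. fscale (of_int (sign p)) (basis_elt p)) = col_sum d f" for d f
    by (rule ext) (simp add: sum_fun_apply basis_elt_def col_sum_def fscale_def mult_delta_right)
  ultimately show ?thesis
    unfolding young_symmetrizer_def ysym_def row_group_stab col_group_stab by simp
qed

text \<open>The character of the Specht module as an element of the group algebra
  (\<open>irr_character_eq\<close>), and at the same time \<open>hook\<close> times the central
  idempotent of the shape.\<close>

definition chi_elt :: "nat list \<Rightarrow> (nat \<Rightarrow> nat) \<Rightarrow> complex" where
  "chi_elt \<nu> = young.char_elt (sum_list \<nu>) (row_of \<nu>) (col_of \<nu>)"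

definition hook :: "nat list \<Rightarrow> complex" where
  "hook \<nu> = young.hook (sum_list \<nu>) (row_of \<nu>) (col_of \<nu>)"

context
  fixes \<nu> d assumes \<nu>: "\<nu> \<in> partitions d"
begin

lemma sum_list_partition: "sum_list \<nu> = d"
  using \<nu> by (simp add: partitions_def)

lemma young_partition': "young (sum_list \<nu>) (row_of \<nu>) (col_of \<nu>)"
  using young_partition[OF \<nu>] sum_list_partition by simp

lemma chi_elt_class_fun: "class_fun d (chi_elt \<nu>)"
  using young.class_fun_char_elt[OF young_partition'] sum_list_partition by (simp add: chi_elt_def)

lemma chi_elt_in: "chi_elt \<nu> \<in> group_algebra d"
  using chi_elt_class_fun by (simp add: class_fun_def)

lemma chi_elt_id: "chi_elt \<nu> id = fact d / hook \<nu>"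
  using young.char_elt_id[OF young_partition'] sum_list_partition by (simp add: chi_elt_def hook_def)

lemma hook_nonzero: "hook \<nu> \<noteq> 0"
  using young.hook_nonzero[OF young_partition'] by (simp add: hook_def)

lemma chi_elt_square: "conv d (chi_elt \<nu>) (chi_elt \<nu>) = fscale (hook \<nu>) (chi_elt \<nu>)"
  using young.char_elt_square[OF young_partition'] sum_list_partition by (simp add: chi_elt_def hook_def)

lemma conv_chi_elt:
  "class_fun d z \<Longrightarrow> conv d z (chi_elt \<nu>) = fscale (conv d z (young_symmetrizer \<nu>) id) (chi_elt \<nu>)"
  using young.class_fun_char_elt_conv[OF young_partition', of z] sum_list_partition
  by (simp add: chi_elt_def young_symmetrizer_ysym)

lemma chi_elt_eq: "chi_elt \<nu> = fscale (1 / hook \<nu>) (class_avg d (young_symmetrizer \<nu>))"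
  using young.char_elt_def[OF young_partition'] sum_list_partition
  by (simp add: chi_elt_def hook_def young_symmetrizer_ysym)

lemma young_symmetrizer_square: "conv d (young_symmetrizer \<nu>) (young_symmetrizer \<nu>) = fscale (hook \<nu>) (young_symmetrizer \<nu>)"
  using young.ys_square[OF young_partition'] sum_list_partition
  by (simp add: hook_def young_symmetrizer_ysym)

lemma young_symmetrizer_id: "young_symmetrizer \<nu> id = 1"
  using young.ysym_id[OF young_partition'] by (simp add: young_symmetrizer_ysym)

end

lemma chi_elt_orthogonal:
  assumes "\<nu> \<in> partitions d" "\<mu> \<in> partitions d" "\<nu> \<noteq> \<mu>"
  shows "conv d (chi_elt \<nu>) (chi_elt \<mu>) = 0"
  using char_elt_orthogonal[OF young_partition[OF assms(1)] young_partition[OF assms(2)] shape_partition_inj[OF assms]]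
    sum_list_partition[OF assms(1)] sum_list_partition[OF assms(2)]
  by (simp add: chi_elt_def)

lemma chi_elt_nonzero: "\<nu> \<in> partitions d \<Longrightarrow> chi_elt \<nu> \<noteq> 0"
  using chi_elt_id[of \<nu> d] hook_nonzero[of \<nu> d] by auto

lemma chi_elt_inj: "inj_on chi_elt (partitions d)"
proof (rule inj_onI, rule ccontr)
  fix \<nu> \<mu> assume a: "\<nu> \<in> partitions d" "\<mu> \<in> partitions d" "chi_elt \<nu> = chi_elt \<mu>" "\<nu> \<noteq> \<mu>"
  have "fscale (hook \<nu>) (chi_elt \<nu>) = 0"
    using chi_elt_orthogonal[OF a(1,2,4)] chi_elt_square[OF a(1)] a(3) by simp
  then show False using hook_nonzero[OF a(1)] chi_elt_nonzero[OF a(1)] by (simp only: fvec.scale_eq_0_iff simp_thms)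
qed

text \<open>Orthogonality leaves one summand, so multiplication by a character extracts a
  coefficient. This gives both the independence of the characters and the expansion of the
  identity.\<close>

lemma conv_chi_elt_sum:
  assumes "\<mu> \<in> partitions d"
  shows "conv d (chi_elt \<mu>) (\<Sum>\<nu>\<in>partitions d. fscale (u \<nu>) (chi_elt \<nu>)) = fscale (u \<mu> * hook \<mu>) (chi_elt \<mu>)"
proof -
  have "conv d (chi_elt \<mu>) (\<Sum>\<nu>\<in>partitions d. fscale (u \<nu>) (chi_elt \<nu>)) =
    (\<Sum>\<nu>\<in>partitions d. if \<nu> = \<mu> then fscale (u \<mu> * hook \<mu>) (chi_elt \<mu>) else 0)"
    unfolding conv_sum_right
  proof (rule sum.cong[OF refl])
    fix \<nu> assume \<nu>: "\<nu> \<in> partitions d"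
    show "conv d (chi_elt \<mu>) (fscale (u \<nu>) (chi_elt \<nu>)) = (if \<nu> = \<mu> then fscale (u \<mu> * hook \<mu>) (chi_elt \<mu>) else 0)"
      using chi_elt_square[OF assms] chi_elt_orthogonal[OF assms \<nu>]
      by (cases "\<nu> = \<mu>") (simp_all only: conv_scale_right fscale_fscale fscale_0 if_True if_False refl not_sym simp_thms)
  qed
  also have "\<dots> = fscale (u \<mu> * hook \<mu>) (chi_elt \<mu>)" by (subst sum.delta) (simp_all add: assms)
  finally show ?thesis .
qed

lemma chi_elt_independent: "fvec.independent (chi_elt ` partitions d)"
proof
  assume "fvec.dependent (chi_elt ` partitions d)"
  then obtain u v where v: "v \<in> chi_elt ` partitions d" "u v \<noteq> 0"
      and s: "(\<Sum>v\<in>chi_elt ` partitions d. fscale (u v) v) = 0"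
    by (subst (asm) fvec.dependent_finite) auto
  obtain \<mu> where \<mu>: "\<mu> \<in> partitions d" "v = chi_elt \<mu>" using v by blast
  have "(\<Sum>\<nu>\<in>partitions d. fscale (u (chi_elt \<nu>)) (chi_elt \<nu>)) = 0"
    using s by (simp add: sum.reindex[OF chi_elt_inj])
  then have "fscale (u (chi_elt \<mu>) * hook \<mu>) (chi_elt \<mu>) = 0"
    using conv_chi_elt_sum[OF \<mu>(1), of "\<lambda>\<nu>. u (chi_elt \<nu>)"] by (simp only: conv_zero)
  then show False using v \<mu> hook_nonzero[OF \<mu>(1)] chi_elt_nonzero[OF \<mu>(1)]
    by (simp only: fvec.scale_eq_0_iff mult_eq_0_iff simp_thms)
qed

text \<open>Provides the upper bound for the dimension of the centre that is compared with the
  number of independent characters in \<open>basis_id_decomposition\<close>.\<close>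

lemma class_fun_span:
  assumes "class_fun d f"
  shows "f \<in> fvec.span ((\<lambda>\<alpha> p. if p \<in> conj_class \<alpha> then 1 else 0) ` partitions d)"
proof -
  let ?I = "\<lambda>\<alpha> p. if p \<in> conj_class \<alpha> then 1 else (0::complex)"
  define u where "u \<alpha> = f (SOME p. p \<in> conj_class \<alpha>)" for \<alpha>
  have "f = (\<Sum>\<alpha>\<in>partitions d. fscale (u \<alpha>) (?I \<alpha>))"
  proof
    fix p
    show "f p = (\<Sum>\<alpha>\<in>partitions d. fscale (u \<alpha>) (?I \<alpha>)) p"
    proof (cases "p \<in> perms d")
      case True
      then obtain \<alpha> where \<alpha>: "\<alpha> \<in> partitions d" "p \<in> conj_class \<alpha>" using ex_conj_class by blast
      have "(\<Sum>\<beta>\<in>partitions d. fscale (u \<beta>) (?I \<beta>)) p = (\<Sum>\<beta>\<in>partitions d. if \<beta> = \<alpha> then u \<alpha> else 0)"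
        unfolding sum_fun_apply fscale_def
        by (rule sum.cong[OF refl]) (use \<alpha> conj_class_disjoint in auto)
      also have "\<dots> = u \<alpha>" using \<alpha> by simp
      also have "u \<alpha> = f p"
        unfolding u_def using class_fun_conj_class[OF assms \<alpha>(1) _ \<alpha>(2)] someI[of "\<lambda>p. p \<in> conj_class \<alpha>"] \<alpha>(2) by blast
      finally show ?thesis by simp
    next
      case False
      then have "f p = 0" using assms by (simp add: class_fun_def group_algebra_def)
      moreover have "fscale (u \<alpha>) (?I \<alpha>) p = 0" if "\<alpha> \<in> partitions d" for \<alpha>
        using that False by (simp add: fscale_def conj_class_perms)
      ultimately show ?thesis by (simp add: sum_fun_apply)
    qed
  qed
  also have "\<dots> \<in> fvec.span (?I ` partitions d)"
    by (intro fvec.span_sum fvec.span_scale fvec.span_base) simp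
  finally show ?thesis .
qed

lemma class_fun_basis_id: "class_fun d (basis_elt id)"
proof (rule class_fun_conv_basis)
  show "conv d (basis_elt s) (basis_elt id) = conv d (basis_elt id) (basis_elt s)" if "s \<in> perms d" for s
    using that by simp
qed simp

text \<open>The characters span the class functions, because there are as many of them as cycle types.\<close>

lemma basis_id_decomposition:
  "basis_elt id = (\<Sum>\<nu>\<in>partitions d. fscale (1 / hook \<nu>) (chi_elt \<nu>))"
proof -
  let ?I = "\<lambda>\<alpha> p. if p \<in> conj_class \<alpha> then 1 else (0::complex)"
  let ?E = "chi_elt ` partitions d"
  have "basis_elt id \<in> fvec.span ?E"
  proof (rule ccontr)
    assume n: "basis_elt id \<notin> fvec.span ?E"
    then have i: "fvec.independent (insert (basis_elt id) ?E)"
      using chi_elt_independent by (simp add: fvec.independent_insert)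
    have "insert (basis_elt id) ?E \<subseteq> fvec.span (?I ` partitions d)"
      using class_fun_span class_fun_basis_id chi_elt_class_fun by blast
    then have "card (insert (basis_elt id) ?E) \<le> card (?I ` partitions d)"
      using fvec.independent_span_bound[OF _ i] by simp
    also have "\<dots> \<le> card (partitions d)" by (rule card_image_le) simp
    finally have "card (insert (basis_elt id) ?E) \<le> card ?E"
      by (simp add: card_image[OF chi_elt_inj])
    moreover have "basis_elt id \<notin> ?E" using n fvec.span_base by blast
    ultimately show False by simp
  qed
  then obtain w where "basis_elt id = (\<Sum>v\<in>?E. fscale (w v) v)"
    by (auto simp: fvec.span_finite)
  then have w: "basis_elt id = (\<Sum>\<nu>\<in>partitions d. fscale (w (chi_elt \<nu>)) (chi_elt \<nu>))"
    by (simp add: sum.reindex[OF chi_elt_inj])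
  have "w (chi_elt \<mu>) = 1 / hook \<mu>" if \<mu>: "\<mu> \<in> partitions d" for \<mu>
  proof -
    have "chi_elt \<mu> = fscale (w (chi_elt \<mu>) * hook \<mu>) (chi_elt \<mu>)"
      using conv_chi_elt_sum[OF \<mu>, of "\<lambda>\<nu>. w (chi_elt \<nu>)"] unfolding w[symmetric]
      by (simp only: conv_id_right chi_elt_in[OF \<mu>])
    then have "chi_elt \<mu> id = w (chi_elt \<mu>) * hook \<mu> * chi_elt \<mu> id" by (metis fscale_def)
    then show ?thesis using chi_elt_id[OF \<mu>] hook_nonzero[OF \<mu>] by (simp add: field_simps)
  qed
  then show ?thesis by (subst w) (intro sum.cong refl, simp)
qed

text \<open>Composing with a projection onto \<open>W\<close>, the trace can be read off in the standard basis of the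
  function space, whichever basis of \<open>W\<close> was chosen.\<close>

lemma trace_on_projection:
  assumes S: "finite S"
    and W: "fvec.subspace W" "\<And>w x. w \<in> W \<Longrightarrow> x \<notin> S \<Longrightarrow> w x = 0"
    and P: "\<And>f g. P (f + g) = P f + P g" "\<And>a f. P (fscale a f) = fscale a (P f)"
      "\<And>x. x \<in> S \<Longrightarrow> P (\<lambda>y. if y = x then 1 else 0) \<in> W" "\<And>w. w \<in> W \<Longrightarrow> P w = w"
    and T: "\<And>f g. T (f + g) = T f + T g" "\<And>a f. T (fscale a f) = fscale a (T f)"
      "\<And>w. w \<in> W \<Longrightarrow> T w \<in> W"
  shows "trace_on W T = (\<Sum>x\<in>S. T (P (\<lambda>y. if y = x then 1 else 0)) x)"
    and "of_nat (fvec.dim W) = (\<Sum>x\<in>S. P (\<lambda>y. if y = x then 1 else 0) x)"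
proof -
  define e :: "'a \<Rightarrow> 'a \<Rightarrow> complex" where "e x = (\<lambda>y. if y = x then 1 else 0)" for x
  have expand: "f = (\<Sum>x\<in>S. fscale (f x) (e x))" if "\<And>x. x \<notin> S \<Longrightarrow> f x = 0" for f
    using that by (intro ext) (simp add: sum_fun_apply fscale_def e_def mult_delta_right S)
  have "\<exists>B. fvec.independent B \<and> fvec.span B = W"
    using fvec.basis_exists[of W] fvec.span_mono fvec.span_subspace[OF _ _ W(1)] by metis
  define B where "B = (SOME B. fvec.independent B \<and> fvec.span B = W)"
  have B: "fvec.independent B" "fvec.span B = W"
    using someI_ex[OF \<open>\<exists>B. fvec.independent B \<and> fvec.span B = W\<close>] by (auto simp: B_def)
  have BW: "b \<in> W" if "b \<in> B" for b using that B(2) fvec.span_base by blast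
  have "B \<subseteq> fvec.span (e ` S)"
  proof
    fix b assume "b \<in> B"
    then have "b = (\<Sum>x\<in>S. fscale (b x) (e x))" using expand W(2)[OF BW] by blast
    also have "\<dots> \<in> fvec.span (e ` S)" by (intro fvec.span_sum fvec.span_scale fvec.span_base) simp
    finally show "b \<in> fvec.span (e ` S)" .
  qed
  then have fB: "finite B" using fvec.independent_span_bound[OF _ B(1)] S by blast
  have P0: "P 0 = 0" using P(2)[of 0 0] by simp
  have Psum: "P (\<Sum>i\<in>I. F i) = (\<Sum>i\<in>I. P (F i))" for F and I :: "'a set"
    by (induction I rule: infinite_finite_induct) (simp_all only: P0 P(1) sum.insert sum.empty sum.infinite not_False_eq_True)
  \<comment> \<open>Stated for every such map, because the identity map will give the
    dimension.\<close>
  have main: "(\<Sum>x\<in>S. T (P (e x)) x) = (\<Sum>b\<in>B. fvec.representation B (T b) b)"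
    if T: "\<And>f g. T (f + g) = T f + T g" "\<And>a f. T (fscale a f) = fscale a (T f)"
      "\<And>w. w \<in> W \<Longrightarrow> T w \<in> W" for T
  proof -
    have T0: "T 0 = 0" using T(2)[of 0 0] by simp
    have Tsum: "T (\<Sum>i\<in>I. F i) = (\<Sum>i\<in>I. T (F i))" for F and I :: "('a \<Rightarrow> complex) set"
      by (induction I rule: infinite_finite_induct) (simp_all only: T0 T(1) sum.insert sum.empty sum.infinite not_False_eq_True)
    let ?r = "fvec.representation B"
    have "(\<Sum>x\<in>S. T (P (e x)) x) = (\<Sum>x\<in>S. \<Sum>b\<in>B. ?r (P (e x)) b * T b x)"
    proof (rule sum.cong[OF refl])
      fix x assume x: "x \<in> S"
      have "P (e x) = (\<Sum>b\<in>B. fscale (?r (P (e x)) b) b)"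
        using fvec.sum_representation_eq[OF B(1) _ fB subset_refl, of "P (e x)"] P(3)[OF x] B(2) by (simp add: e_def)
      from arg_cong[OF this, of T]
      have "T (P (e x)) = (\<Sum>b\<in>B. fscale (?r (P (e x)) b) (T b))"
        unfolding Tsum T(2) .
      then show "T (P (e x)) x = (\<Sum>b\<in>B. ?r (P (e x)) b * T b x)"
        by (simp add: sum_fun_apply fscale_def)
    qed
    also have "\<dots> = (\<Sum>b\<in>B. \<Sum>x\<in>S. ?r (P (e x)) b * T b x)" by (rule sum.swap)
    also have "\<dots> = (\<Sum>b\<in>B. ?r (T b) b)"
    proof (rule sum.cong[OF refl])
      fix b assume b: "b \<in> B"
      have TbW: "T b \<in> W" using T(3) BW b by blast
      have "T b = P (\<Sum>x\<in>S. fscale (T b x) (e x))"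
        by (subst expand[of "T b", symmetric]) (use W(2)[OF TbW] P(4)[OF TbW] in simp_all)
      also have "\<dots> = (\<Sum>x\<in>S. fscale (T b x) (P (e x)))" by (simp only: Psum P(2))
      finally have "?r (T b) b = ?r (\<Sum>x\<in>S. fscale (T b x) (P (e x))) b" by simp
      also have "\<dots> = (\<Sum>x\<in>S. ?r (fscale (T b x) (P (e x))) b)"
        by (rule fvec.representation_sum[OF B(1), THEN fun_cong])
          (use P(3) B(2) in \<open>auto simp: e_def intro!: fvec.span_scale\<close>)
      also have "\<dots> = (\<Sum>x\<in>S. ?r (P (e x)) b * T b x)"
        using P(3) B(2) by (intro sum.cong refl) (simp add: e_def fvec.representation_scale[OF B(1)] mult.commute)
      finally show "(\<Sum>x\<in>S. ?r (P (e x)) b * T b x) = ?r (T b) b" by simp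
    qed
    finally show ?thesis .
  qed
  show "trace_on W T = (\<Sum>x\<in>S. T (P (\<lambda>y. if y = x then 1 else 0)) x)"
    using main[OF T] unfolding trace_on_def B_def[symmetric] Let_def e_def by simp
  have "(\<Sum>x\<in>S. P (e x) x) = (\<Sum>b\<in>B. fvec.representation B b b)"
    by (rule main[of "\<lambda>f. f"]) auto
  also have "\<dots> = of_nat (card B)"
    by (simp add: fvec.representation_basis[OF B(1)])
  also have "card B = fvec.dim W" using fvec.dim_span_eq_card_independent[OF B(1)] B(2) by simp
  finally show "of_nat (fvec.dim W) = (\<Sum>x\<in>S. P (\<lambda>y. if y = x then 1 else 0) x)" by (simp add: e_def)
qed

text \<open>The module is the left ideal generated by the idempotent \<open>c\<close>, and right
  multiplication by \<open>c\<close> projects onto it. In the basis of permutations, the trace of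
  left multiplication by \<open>p\<close> after this projection is the sum of the values of
  \<open>c\<close> at the conjugates of \<open>inv p\<close>, that is, a class average.\<close>

lemma
  assumes \<nu>: "\<nu> \<in> partitions d"
  shows irr_character_eq: "p \<in> perms d \<Longrightarrow> irr_character \<nu> p = chi_elt \<nu> p"
    and dim_specht_eq: "of_nat (dim_specht \<nu>) = fact d / hook \<nu>"
proof -
  define c where "c = fscale (1 / hook \<nu>) (young_symmetrizer \<nu>)"
  note h = hook_nonzero[OF \<nu>]
  have cc: "conv d c c = c"
    unfolding c_def using young_symmetrizer_square[OF \<nu>] h by (simp add: conv_scale_left conv_scale_right)
  have specht: "specht \<nu> = (\<lambda>f. conv d f c) ` group_algebra d"
  proof -
    have y: "young_symmetrizer \<nu> = fscale (hook \<nu>) c" using h by (simp add: c_def)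
    have "specht \<nu> = (\<lambda>f. conv d f (young_symmetrizer \<nu>)) ` group_algebra d"
      by (simp add: specht_def sum_list_partition[OF \<nu>])
    also have "\<dots> = (\<lambda>f. conv d f c) ` group_algebra d"
    proof (intro equalityI subsetI; elim imageE)
      fix w f assume "w = conv d f (young_symmetrizer \<nu>)" "f \<in> group_algebra d"
      then have "w = conv d (fscale (hook \<nu>) f) c" "fscale (hook \<nu>) f \<in> group_algebra d"
        by (simp_all add: y conv_scale_left conv_scale_right)
      then show "w \<in> (\<lambda>f. conv d f c) ` group_algebra d" by blast
    next
      fix w f assume "w = conv d f c" "f \<in> group_algebra d"
      then have "w = conv d (fscale (1 / hook \<nu>) f) (young_symmetrizer \<nu>)" "fscale (1 / hook \<nu>) f \<in> group_algebra d"
        by (simp_all add: c_def conv_scale_left conv_scale_right)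
      then show "w \<in> (\<lambda>f. conv d f (young_symmetrizer \<nu>)) ` group_algebra d" by blast
    qed
    finally show ?thesis .
  qed
  have sub: "fvec.subspace (specht \<nu>)"
    unfolding fvec.subspace_def specht
  proof (intro conjI ballI allI; (elim imageE)?)
    show "0 \<in> (\<lambda>f. conv d f c) ` group_algebra d"
      by (rule image_eqI[of _ _ 0]) (simp_all add: group_algebra_def)
    fix x y f g assume "x = conv d f c" "y = conv d g c" "f \<in> group_algebra d" "g \<in> group_algebra d"
    then show "x + y \<in> (\<lambda>f. conv d f c) ` group_algebra d"
      by (intro image_eqI[of _ _ "f + g"]) (simp_all only: conv_add_left, simp add: group_algebra_def)
  next
    fix a x f assume "x = conv d f c" "f \<in> group_algebra d"
    then show "fscale a x \<in> (\<lambda>f. conv d f c) ` group_algebra d"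
      by (intro image_eqI[of _ _ "fscale a f"]) (simp_all add: conv_scale_left)
  qed
  have e: "(\<lambda>y. if y = x then 1 else 0) = basis_elt x" for x by (simp add: basis_elt_def)
  have proj: "conv d w c = w" if "w \<in> specht \<nu>" for w
    using that cc by (auto simp: specht conv_assoc)
  have val: "conv d (basis_elt s) c s = 1 / hook \<nu>" if "s \<in> perms d" for s
    using that by (simp add: conv_basis_left c_def young_symmetrizer_id[OF \<nu>] fscale_def)
  have into: "conv d f c \<in> specht \<nu>" if "f \<in> group_algebra d" for f
    unfolding specht using that by (rule imageI)
  have supp: "w x = 0" if "w \<in> specht \<nu>" "x \<notin> perms d" for w x
    using that by (auto simp: specht conv_outside)
  have left: "conv d g w \<in> specht \<nu>" if "w \<in> specht \<nu>" for g w
    using into[of "conv d g w"] proj[OF that] by (simp add: conv_assoc)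
  have "of_nat (fvec.dim (specht \<nu>)) = (\<Sum>s\<in>perms d. conv d (\<lambda>y. if y = s then 1 else 0) c s)"
    by (rule trace_on_projection(2)[where P = "\<lambda>f. conv d f c" and T = "\<lambda>f. f" and W = "specht \<nu>" and S = "perms d"])
       (erule (1) supp | simp only: finite_perms sub e conv_add_left conv_scale_left proj into basis_elt_in)+
  also have "\<dots> = fact d / hook \<nu>" by (simp add: e val card_perms)
  finally show "of_nat (dim_specht \<nu>) = fact d / hook \<nu>" by (simp add: dim_specht_def)
  assume p: "p \<in> perms d"
  have "irr_character \<nu> p = trace_on (specht \<nu>) (conv d (basis_elt p))"
    by (simp add: irr_character_def sum_list_partition[OF \<nu>])
  also have "\<dots> = (\<Sum>s\<in>perms d. conv d (basis_elt p) (conv d (\<lambda>y. if y = s then 1 else 0) c) s)"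
    by (rule trace_on_projection(1)[where P = "\<lambda>f. conv d f c" and W = "specht \<nu>" and S = "perms d"])
       (erule (1) supp | simp only: finite_perms sub e conv_add_left conv_scale_left conv_add_right conv_scale_right proj into left basis_elt_in)+
  also have "\<dots> = (\<Sum>s\<in>perms d. c (inv s \<circ> inv p \<circ> s))"
    using p by (intro sum.cong refl) (simp add: e conv_basis_left comp_assoc)
  also have "\<dots> = chi_elt \<nu> (inv p)"
    using p by (simp add: chi_elt_eq[OF \<nu>] class_avg_def c_def fscale_def sum_divide_distrib)
  also have "\<dots> = chi_elt \<nu> p" by (rule class_fun_inv[OF chi_elt_class_fun[OF \<nu>] p])
  finally show "irr_character \<nu> p = chi_elt \<nu> p" .
qed

lemma dim_specht_nonzero: "\<nu> \<in> partitions d \<Longrightarrow> of_nat (dim_specht \<nu>) \<noteq> (0::complex)"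
  using dim_specht_eq[of \<nu> d] hook_nonzero[of \<nu> d] by simp

lemma card_conj_class_chi:
  assumes "\<nu> \<in> partitions d" "\<alpha> \<in> partitions d"
  shows "of_nat (card (conj_class \<alpha>)) * chi \<alpha> \<nu> = (\<Sum>p\<in>conj_class \<alpha>. chi_elt \<nu> p)"
proof (cases "conj_class \<alpha> = {}")
  \<comment> \<open>In the remaining case of an empty class both sides are 0, whatever value the
    choice operator gives to \<open>chi\<close>.\<close>
  case False
  define q where "q = (SOME p. p \<in> conj_class \<alpha>)"
  have q: "q \<in> conj_class \<alpha>" unfolding q_def using False by (simp add: some_in_eq)
  have "chi_elt \<nu> p = chi \<alpha> \<nu>" if "p \<in> conj_class \<alpha>" for p
    using class_fun_conj_class[OF chi_elt_class_fun[OF assms(1)] assms(2) that q]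
      irr_character_eq[OF assms(1), of q] q assms(2)
    unfolding chi_def q_def[symmetric] by (simp add: conj_class_perms)
  then show ?thesis by simp
qed simp

section \<open>The Gram element and contents of cells\<close>

text \<open>Extensional functions, so that the set is finite with one element for each vector of the
  standard basis of the tensor power.\<close>

definition words :: "nat \<Rightarrow> (nat \<Rightarrow> 'n) set" where
  "words d = {1..d} \<rightarrow>\<^sub>E UNIV"

text \<open>The trace of the \<open>d\<close>-th tensor power of \<open>A\<close> composed with a
  place permutation. It is the product over the cycles of \<open>s\<close> of the traces of powers
  of \<open>A\<close>, see \<open>tensor_trace_orbits\<close>.\<close>

definition tensor_trace :: "complex^'n^'n \<Rightarrow> nat \<Rightarrow> (nat \<Rightarrow> nat) \<Rightarrow> complex" where
  "tensor_trace A d s = (\<Sum>x\<in>words d. \<Prod>k\<in>{1..d}. A $ x k $ x (s k))"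

lemma finite_words [simp]: "finite (words d :: (nat \<Rightarrow> 'n::finite) set)"
  by (simp add: words_def finite_PiE)

lemma words_ext: "x \<in> words d \<Longrightarrow> y \<in> words d \<Longrightarrow> (\<And>k. k \<in> {1..d} \<Longrightarrow> x k = y k) \<Longrightarrow> x = y"
  unfolding words_def by (rule PiE_ext)

lemma sum_words_Suc:
  "(\<Sum>x\<in>words (Suc d). f x) = (\<Sum>x\<in>words d. \<Sum>a\<in>(UNIV::'n::finite set). f (x(Suc d := a)))"
proof -
  have s: "{1..Suc d} = insert (Suc d) {1..d}" by auto
  have "words (Suc d) = (\<lambda>(a, x). x(Suc d := a)) ` (UNIV \<times> words d :: ('n \<times> _) set)"
    unfolding words_def s by (simp add: PiE_insert_eq)
  also have "sum f \<dots> = (\<Sum>(a, x)\<in>UNIV \<times> words d. f (x(Suc d := a)))"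
  proof -
    have "inj_on (\<lambda>(a, x). x(Suc d := a)) (UNIV \<times> words d :: ('n \<times> _) set)"
      using inj_combinator[of "Suc d" "{1..d}" "\<lambda>_. UNIV"] by (simp add: words_def)
    then show ?thesis by (simp add: sum.reindex case_prod_unfold o_def)
  qed
  also have "\<dots> = (\<Sum>a\<in>UNIV. \<Sum>x\<in>words d. f (x(Suc d := a)))" by (simp add: sum.cartesian_product)
  finally show ?thesis by (simp add: sum.swap[of _ UNIV])
qed

lemma sum_words_perm:
  fixes f :: "(nat \<Rightarrow> 'n::finite) \<Rightarrow> complex"
  assumes p: "p \<in> perms d"
  shows "(\<Sum>x\<in>words d. f (restrict (x \<circ> p) {1..d})) = (\<Sum>x\<in>words d. f x)"
proof (rule sum.reindex_bij_witness[where i = "\<lambda>x. restrict (x \<circ> inv p) {1..d}" and j = "\<lambda>x. restrict (x \<circ> p) {1..d}"])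
  fix x :: "nat \<Rightarrow> 'n" assume x: "x \<in> words d"
  show "restrict (restrict (x \<circ> p) {1..d} \<circ> inv p) {1..d} = x"
    by (rule words_ext[of _ d]) (use x perms_in_iff[OF inv_in_perms[OF p]] p in \<open>auto simp: words_def\<close>)
  show "restrict (restrict (x \<circ> inv p) {1..d} \<circ> p) {1..d} = x"
    by (rule words_ext[of _ d]) (use x perms_in_iff[OF p] p in \<open>auto simp: words_def\<close>)
qed (auto simp: words_def)

lemma prod_perms: "p \<in> perms d \<Longrightarrow> (\<Prod>k\<in>{1..d}. f (p k)) = (\<Prod>k\<in>{1..d}. f k)"
  using prod.permute[of p "{1..d}" f] by (simp add: perms_def o_def)

lemma tensor_trace_conj:
  fixes A :: "complex^'n^'n"
  assumes s: "s \<in> perms d" and p: "p \<in> perms d"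
  shows "tensor_trace A d (p \<circ> s \<circ> inv p) = tensor_trace A d s"
proof -
  have "tensor_trace A d s = (\<Sum>x\<in>words d. \<Prod>k\<in>{1..d}. A $ restrict (x \<circ> p) {1..d} k $ restrict (x \<circ> p) {1..d} (s k))"
    unfolding tensor_trace_def by (rule sum_words_perm[OF p, symmetric])
  also have "\<dots> = (\<Sum>x\<in>words d. \<Prod>k\<in>{1..d}. A $ x (p k) $ x ((p \<circ> s \<circ> inv p) (p k)))"
    by (intro sum.cong prod.cong refl) (use perms_in_iff[OF s] p in auto)
  also have "\<dots> = tensor_trace A d (p \<circ> s \<circ> inv p)"
    unfolding tensor_trace_def by (intro sum.cong refl prod_perms[OF p])
  finally show ?thesis by simp
qed

text \<open>For \<open>A = mat 1\<close> this is the Gram element; for general \<open>A\<close> it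
  carries the power sums of the eigenvalues.\<close>

definition tensor_trace_elt :: "complex^'n^'n \<Rightarrow> nat \<Rightarrow> (nat \<Rightarrow> nat) \<Rightarrow> complex" where
  "tensor_trace_elt A d = (\<lambda>s. if s \<in> perms d then tensor_trace A d s else 0)"

lemma class_fun_tensor_trace_elt: "class_fun d (tensor_trace_elt A d)"
  by (simp add: class_fun_def tensor_trace_elt_def group_algebra_def tensor_trace_conj)

lemma tensor_trace_commute: "s \<in> perms d \<Longrightarrow> t \<in> perms d \<Longrightarrow> tensor_trace A d (s \<circ> t) = tensor_trace A d (t \<circ> s)"
  using class_fun_commute[OF class_fun_tensor_trace_elt[of d A], of s t] by (simp add: tensor_trace_elt_def)

lemma tensor_trace_inv: "s \<in> perms d \<Longrightarrow> tensor_trace A d (inv s) = tensor_trace A d s"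
  using class_fun_inv[OF class_fun_tensor_trace_elt[of d A], of s] by (simp add: tensor_trace_elt_def)

lemma tensor_trace_1: "tensor_trace (mat 1 :: complex^'n^'n) d s = (\<Sum>x\<in>words d. if \<forall>k\<in>{1..d}. x k = (x (s k) :: 'n) then 1 else 0)"
  unfolding tensor_trace_def
proof (rule sum.cong[OF refl])
  fix x :: "nat \<Rightarrow> 'n"
  show "(\<Prod>k\<in>{1..d}. (mat 1 :: complex^'n^'n) $ x k $ x (s k)) = (if \<forall>k\<in>{1..d}. x k = x (s k) then 1 else 0)"
  proof (cases "\<forall>k\<in>{1..d}. x k = x (s k)")
    case False
    then obtain k where "k \<in> {1..d}" "x k \<noteq> x (s k)" by blast
    then have "(\<Prod>k\<in>{1..d}. (mat 1 :: complex^'n^'n) $ x k $ x (s k)) = 0"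
      by (intro prod_zero) (auto simp: mat_def)
    with False show ?thesis by (simp only: if_False)
  qed (simp add: mat_def)
qed

lemma perms_Suc: "s \<in> perms d \<Longrightarrow> s \<in> perms (Suc d)" "s \<in> perms d \<Longrightarrow> s (Suc d) = Suc d"
  unfolding perms_def by (auto intro: permutes_subset) (auto simp: permutes_def)

text \<open>For \<open>k = Suc d\<close> the new point is a cycle of its own and contributes a
  factor \<open>N\<close>. Otherwise it is inserted into the cycle of \<open>k\<close>, and the
  number of cycles does not change.\<close>

lemma tensor_trace_1_Suc:
  assumes s: "s \<in> perms d" and k: "k \<in> {1..Suc d}"
  shows "tensor_trace (mat 1 :: complex^'n^'n) (Suc d) (s \<circ> transp k (Suc d)) =
    (if k = Suc d then of_nat CARD('n) else 1) * tensor_trace (mat 1 :: complex^'n^'n) d s"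
proof -
  let ?D = "Suc d"
  have D: "s ?D = ?D" using perms_Suc s by blast
  have sj: "s j \<in> {1..d}" "s j \<noteq> ?D" if "j \<in> {1..d}" for j
    using perms_in_iff[OF s, of j] that by auto
  have iff: "(\<forall>j\<in>{1..?D}. (x(?D := a)) j = (x(?D := a)) ((s \<circ> transp k ?D) j)) \<longleftrightarrow>
      (\<forall>j\<in>{1..d}. x j = x (s j)) \<and> (k \<noteq> ?D \<longrightarrow> a = x k)" for x :: "nat \<Rightarrow> 'n" and a
  proof (cases "k = ?D")
    case True
    have "{1..?D} = insert ?D {1..d}" by auto
    then have "(\<forall>j\<in>{1..?D}. P j) \<longleftrightarrow> P ?D \<and> (\<forall>j\<in>{1..d}. P j)" for P by simp
    then show ?thesis using True D sj by simp
  next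
    case False
    then have kd: "k \<in> {1..d}" using k by auto
    have ins: "{1..?D} = insert ?D (insert k ({1..d} - {k}))" "{1..d} = insert k ({1..d} - {k})" using kd by auto
    have split: "(\<forall>j\<in>{1..?D}. P j) \<longleftrightarrow> P ?D \<and> P k \<and> (\<forall>j\<in>{1..d} - {k}. P j)" for P
      by (subst ins(1)) (simp only: ball_simps)
    have split': "(\<forall>j\<in>{1..d}. P j) \<longleftrightarrow> P k \<and> (\<forall>j\<in>{1..d} - {k}. P j)" for P
      by (subst ins(2)) (simp only: ball_simps)
    have r: "(\<forall>j\<in>{1..d} - {k}. (x(?D := a)) j = (x(?D := a)) ((s \<circ> transp k ?D) j)) \<longleftrightarrow> (\<forall>j\<in>{1..d} - {k}. x j = x (s j))"
      by (rule ball_cong[OF refl]) (use sj in \<open>auto simp: Transposition.transpose_def\<close>)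
    show ?thesis unfolding split split' r using False D sj[OF kd] by auto
  qed
  have "tensor_trace (mat 1 :: complex^'n^'n) ?D (s \<circ> transp k ?D) =
      (\<Sum>x\<in>words d. \<Sum>a\<in>(UNIV::'n set). if (\<forall>j\<in>{1..d}. x j = x (s j)) \<and> (k \<noteq> ?D \<longrightarrow> a = x k) then 1 else 0)"
    unfolding tensor_trace_1 sum_words_Suc iff ..
  also have "\<dots> = (\<Sum>x\<in>words d. (if k = ?D then of_nat CARD('n) else 1) * (if \<forall>j\<in>{1..d}. x j = (x (s j) :: 'n) then 1 else 0))"
  proof (rule sum.cong[OF refl])
    fix x :: "nat \<Rightarrow> 'n"
    show "(\<Sum>a\<in>UNIV. if (\<forall>j\<in>{1..d}. x j = x (s j)) \<and> (k \<noteq> ?D \<longrightarrow> a = x k) then 1 else 0) =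
      (if k = ?D then of_nat CARD('n) else 1) * (if \<forall>j\<in>{1..d}. x j = x (s j) then 1 else 0 :: complex)"
      by (cases "\<forall>j\<in>{1..d}. x j = x (s j)"; cases "k = ?D") (simp_all only: simp_thms if_True if_False, simp_all)
  qed
  finally show ?thesis by (simp only: tensor_trace_1 sum_distrib_left)
qed

section \<open>Traces of Young symmetrizers as products over cells\<close>

lemma sum_stab_inv: "(\<Sum>q\<in>stab d f. h (inv q)) = (\<Sum>q\<in>stab d f. h q)"
  by (rule sum.reindex_bij_witness[of _ inv inv])
    (auto intro: inv_in_stab simp: perms_inv(3)[OF stab_perms])

lemma sum_stab_left: "t \<in> stab d f \<Longrightarrow> (\<Sum>q\<in>stab d f. h (t \<circ> q)) = (\<Sum>q\<in>stab d f. h q)"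
  by (rule sum.reindex_bij_witness[of _ "\<lambda>q. inv t \<circ> q" "\<lambda>q. t \<circ> q"])
    (auto intro: inv_in_stab comp_in_stab simp: perms_inv[OF stab_perms])

lemma sum_stab_right: "t \<in> stab d f \<Longrightarrow> (\<Sum>q\<in>stab d f. h (q \<circ> t)) = (\<Sum>q\<in>stab d f. h q)"
  by (rule sum.reindex_bij_witness[of _ "\<lambda>q. q \<circ> inv t" "\<lambda>q. q \<circ> t"])
    (auto intro: inv_in_stab comp_in_stab simp: perms_inv[OF stab_perms] comp_assoc)

lemma stab_Suc:
  assumes "s \<in> stab d f" shows "s \<in> stab (Suc d) f"
proof -
  have s: "s \<in> perms d" using assms by (rule stab_perms)
  show ?thesis using perms_Suc[OF s] stabD[OF assms] by (auto simp: stab_def le_Suc_eq)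
qed

lemma stab_Suc_fix:
  assumes "s \<in> stab (Suc d) f" "s (Suc d) = Suc d" shows "s \<in> stab d f"
proof -
  have "s permutes {1..Suc d}" using stab_perms[OF assms(1)] by (simp add: perms_def)
  then have "s permutes {1..d}"
  proof (rule permutes_superset)
    fix x assume "x \<in> {1..Suc d} - {1..d}"
    then have "x = Suc d" by auto
    then show "s x = x" using assms(2) by simp
  qed
  then have "s \<in> perms d" by (simp add: perms_def)
  then show ?thesis using stabD[OF assms(1)] by (auto simp: stab_def)
qed

text \<open>Coset decomposition according to the preimage \<open>i\<close> of the last point, which
  ranges over the fibre of that point. Composing with the transposition of \<open>i\<close> and the
  last point yields a permutation fixing the latter.\<close>

lemma sum_stab_Suc:
  "(\<Sum>r\<in>stab (Suc d) f. h r) =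
   (\<Sum>i\<in>fibre (Suc d) f (f (Suc d)). \<Sum>r\<in>stab d f. h (r \<circ> transp i (Suc d)))"
proof -
  let ?D = "Suc d"
  have "(\<Sum>i\<in>fibre ?D f (f ?D). \<Sum>r\<in>stab d f. h (r \<circ> transp i ?D)) =
    (\<Sum>ir\<in>fibre ?D f (f ?D) \<times> stab d f. h (snd ir \<circ> transp (fst ir) ?D))"
    by (simp add: sum.cartesian_product case_prod_unfold)
  also have "\<dots> = (\<Sum>r\<in>stab ?D f. h r)"
  proof (rule sum.reindex_bij_witness[where j = "\<lambda>ir. snd ir \<circ> transp (fst ir) ?D"
        and i = "\<lambda>r. (inv r ?D, r \<circ> transp (inv r ?D) ?D)"])
    fix r assume r: "r \<in> stab ?D f"
    have rp: "r \<in> perms ?D" using r by (rule stab_perms)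
    let ?i = "inv r ?D"
    have i: "?i \<in> {1..?D}" using perms_in_iff[OF inv_in_perms[OF rp], of ?D] by simp
    have fi: "f ?i = f ?D" using stabD[OF inv_in_stab[OF r], of ?D] by simp
    have "transp ?i ?D \<in> stab ?D f" using transp_in_stab[OF i _ fi] by simp
    then have "r \<circ> transp ?i ?D \<in> stab ?D f" using r by (intro comp_in_stab)
    then have "r \<circ> transp ?i ?D \<in> stab d f" by (rule stab_Suc_fix) (simp add: perms_inv[OF rp])
    then show "(?i, r \<circ> transp ?i ?D) \<in> fibre ?D f (f ?D) \<times> stab d f"
      using i fi by (simp add: fibre_def)
    show "snd (?i, r \<circ> transp ?i ?D) \<circ> transp (fst (?i, r \<circ> transp ?i ?D)) ?D = r"
      by (simp add: comp_assoc)
  next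
    fix ir assume "ir \<in> fibre ?D f (f ?D) \<times> stab d f"
    then obtain i r where ir: "ir = (i, r)" "i \<in> {1..?D}" "f i = f ?D" "r \<in> stab d f" by (auto simp: fibre_def)
    have r: "r \<in> stab ?D f" "r ?D = ?D" using stab_Suc[OF ir(4)] perms_Suc[OF stab_perms[OF ir(4)]] by auto
    have t: "transp i ?D \<in> stab ?D f" using transp_in_stab[OF ir(2) _ ir(3)] by simp
    then have rt: "r \<circ> transp i ?D \<in> stab ?D f" using r by (intro comp_in_stab)
    then show "snd ir \<circ> transp (fst ir) ?D \<in> stab ?D f" using ir by simp
    have "inv (r \<circ> transp i ?D) ?D = i"
      using perms_inv(7)[OF stab_perms[OF rt], of i] r by simp
    then show "(inv (snd ir \<circ> transp (fst ir) ?D) ?D,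
         snd ir \<circ> transp (fst ir) ?D \<circ> transp (inv (snd ir \<circ> transp (fst ir) ?D) ?D) ?D) = ir"
      using ir by (simp add: comp_assoc)
  qed simp
  finally show ?thesis by simp
qed

lemma sum_stab_Suc':
  "(\<Sum>r\<in>stab (Suc d) f. h r) =
   (\<Sum>i\<in>fibre (Suc d) f (f (Suc d)). \<Sum>r\<in>stab d f. h (transp i (Suc d) \<circ> r))"
proof -
  have "(\<Sum>r\<in>stab (Suc d) f. h r) = (\<Sum>r\<in>stab (Suc d) f. h (inv r))" by (rule sum_stab_inv[symmetric])
  also have "\<dots> = (\<Sum>i\<in>fibre (Suc d) f (f (Suc d)). \<Sum>r\<in>stab d f. h (inv (r \<circ> transp i (Suc d))))"
    by (rule sum_stab_Suc)
  also have "\<dots> = (\<Sum>i\<in>fibre (Suc d) f (f (Suc d)). \<Sum>r\<in>stab d f. h (transp i (Suc d) \<circ> inv r))"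
  proof (intro sum.cong refl)
    fix i r assume "i \<in> fibre (Suc d) f (f (Suc d))" "r \<in> stab d f"
    then have "r \<in> perms (Suc d)" "transp i (Suc d) \<in> perms (Suc d)"
      using perms_Suc(1)[OF stab_perms] by (auto simp: fibre_def)
    then show "h (inv (r \<circ> transp i (Suc d))) = h (transp i (Suc d) \<circ> inv r)"
      by (simp add: inv_comp_perms)
  qed
  also have "\<dots> = (\<Sum>i\<in>fibre (Suc d) f (f (Suc d)). \<Sum>r\<in>stab d f. h (transp i (Suc d) \<circ> r))"
    by (intro sum.cong refl sum_stab_inv)
  finally show ?thesis .
qed

text \<open>The trace of the tensor power of \<open>A\<close> against a Young symmetrizer, see
  \<open>tensor_trace_elt_young\<close>. Here \<open>d\<close> may be smaller than the number of
  cells, which permits adding cells one at a time.\<close>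

definition young_trace :: "complex^'n^'n \<Rightarrow> (nat \<Rightarrow> nat) \<Rightarrow> (nat \<Rightarrow> nat) \<Rightarrow> nat \<Rightarrow> complex" where
  "young_trace A rw cl d = (\<Sum>r\<in>stab d rw. \<Sum>q\<in>stab d cl. of_int (sign q) * tensor_trace A d (r \<circ> q))"

text \<open>Write \<open>D\<close> for the last cell and split row and column permutations as \<open>r (i D)\<close> and \<open>(j D) q\<close>.
  If \<open>i\<close> and \<open>j\<close> both differ from \<open>D\<close>, then \<open>(i D) (j D) = (i j) (i D)\<close>, and the terms with \<open>r (i j) q\<close>
  cancel in pairs by means of the cell \<open>l\<close> in the row of \<open>j\<close> and the column of \<open>i\<close>.\<close>

lemma young_trace_step:
  assumes inj: "\<And>i. i \<in> {1..d} \<Longrightarrow> rw i = rw (Suc d) \<Longrightarrow> cl i \<noteq> cl (Suc d)"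
    and ex: "\<And>i j. i \<in> {1..d} \<Longrightarrow> j \<in> {1..d} \<Longrightarrow> rw i = rw (Suc d) \<Longrightarrow> cl j = cl (Suc d) \<Longrightarrow>
      \<exists>l\<in>{1..d}. rw l = rw j \<and> cl l = cl i"
  shows "young_trace (mat 1 :: complex^'n^'n) rw cl (Suc d) =
    (of_nat CARD('n) + of_nat (card (fibre d rw (rw (Suc d)))) - of_nat (card (fibre d cl (cl (Suc d)))))
    * young_trace (mat 1 :: complex^'n^'n) rw cl d"
proof -
  let ?D = "Suc d"
  let ?G = "tensor_trace (mat 1 :: complex^'n^'n)"
  let ?f = "young_trace (mat 1 :: complex^'n^'n) rw cl d"
  let ?N = "of_nat CARD('n) :: complex"
  define h where "h i j = (\<Sum>r\<in>stab d rw. \<Sum>q\<in>stab d cl.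
    of_int (sign (transp j ?D \<circ> q)) * ?G ?D (r \<circ> transp i ?D \<circ> (transp j ?D \<circ> q)))" for i j
  define I where "I = fibre d rw (rw ?D)"
  define J where "J = fibre d cl (cl ?D)"
  have fin: "finite I" "finite J" and nD: "?D \<notin> I" "?D \<notin> J" by (auto simp: I_def J_def fibre_def)
  have IJ: "fibre ?D rw (rw ?D) = insert ?D I" "fibre ?D cl (cl ?D) = insert ?D J"
    by (auto simp: I_def J_def fibre_def le_Suc_eq)
  have "young_trace (mat 1 :: complex^'n^'n) rw cl ?D = (\<Sum>i\<in>insert ?D I. \<Sum>j\<in>insert ?D J. h i j)"
    unfolding young_trace_def sum_stab_Suc[of _ d rw] sum_stab_Suc'[of _ d cl] h_def IJ
    by (intro sum.cong refl sum.swap)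
  also have "\<dots> = h ?D ?D + (\<Sum>j\<in>J. h ?D j) + ((\<Sum>i\<in>I. h i ?D) + (\<Sum>i\<in>I. \<Sum>j\<in>J. h i j))"
    using fin nD by (simp add: sum.distrib)
  also have "h ?D ?D = ?N * ?f"
  proof -
    have "?G ?D (r \<circ> q) = ?N * ?G d (r \<circ> q)" if "r \<in> stab d rw" "q \<in> stab d cl" for r q
      using tensor_trace_1_Suc[of "r \<circ> q" d ?D, where 'n = 'n] stab_perms[OF that(1)] stab_perms[OF that(2)] by simp
    then have "h ?D ?D = (\<Sum>r\<in>stab d rw. \<Sum>q\<in>stab d cl. ?N * (of_int (sign q) * ?G d (r \<circ> q)))"
      unfolding h_def by (intro sum.cong refl) (simp add: algebra_simps)
    then show ?thesis by (simp add: young_trace_def sum_distrib_left)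
  qed
  \<comment> \<open>The trace property moves \<open>q\<close> to the front, so that the
    transposition stands last and \<open>tensor_trace_1_Suc\<close> removes it with factor 1. Only
    its sign remains; the cells of the row below contribute in the same way without a sign.\<close>
  also have "(\<Sum>j\<in>J. h ?D j) = (\<Sum>j\<in>J. - ?f)"
  proof (rule sum.cong[OF refl])
    fix j assume "j \<in> J"
    then have j: "j \<in> {1..d}" "j \<in> {1..?D}" "j \<noteq> ?D" by (auto simp: J_def fibre_def)
    have "of_int (sign (transp j ?D \<circ> q)) * ?G ?D (r \<circ> transp ?D ?D \<circ> (transp j ?D \<circ> q)) = - (of_int (sign q) * ?G d (r \<circ> q))"
      if r: "r \<in> stab d rw" and q: "q \<in> stab d cl" for r q
    proof -
      have p: "r \<in> perms d" "q \<in> perms d" "r \<in> perms ?D" "q \<in> perms ?D" "transp j ?D \<in> perms ?D"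
        using stab_perms[OF r] stab_perms[OF q] perms_Suc(1) j by auto
      have "?G ?D (r \<circ> (transp j ?D \<circ> q)) = ?G ?D (q \<circ> (r \<circ> transp j ?D))"
        using tensor_trace_commute[of "r \<circ> transp j ?D" ?D q "mat 1 :: complex^'n^'n"] p by (simp add: comp_assoc)
      also have "\<dots> = ?G d (r \<circ> q)"
        using tensor_trace_1_Suc[of "q \<circ> r" d j, where 'n = 'n] p j tensor_trace_commute[of q d r "mat 1 :: complex^'n^'n"] by (simp add: comp_assoc)
      finally show ?thesis using p j by (simp add: sign_comp_perms[of _ ?D] sign_swap_id)
    qed
    then show "h ?D j = - ?f" unfolding h_def young_trace_def by (simp add: sum_negf)
  qed
  also have "(\<Sum>i\<in>I. h i ?D) = (\<Sum>i\<in>I. ?f)"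
  proof (rule sum.cong[OF refl])
    fix j assume "j \<in> I"
    then have j: "j \<in> {1..d}" "j \<in> {1..?D}" "j \<noteq> ?D" by (auto simp: I_def fibre_def)
    have "of_int (sign (transp ?D ?D \<circ> q)) * ?G ?D (r \<circ> transp j ?D \<circ> (transp ?D ?D \<circ> q)) = of_int (sign q) * ?G d (r \<circ> q)"
      if r: "r \<in> stab d rw" and q: "q \<in> stab d cl" for r q
    proof -
      have p: "r \<in> perms d" "q \<in> perms d" "r \<in> perms ?D" "q \<in> perms ?D" "transp j ?D \<in> perms ?D"
        using stab_perms[OF r] stab_perms[OF q] perms_Suc(1) j by auto
      have "?G ?D (r \<circ> (transp j ?D \<circ> q)) = ?G ?D (q \<circ> (r \<circ> transp j ?D))"
        using tensor_trace_commute[of "r \<circ> transp j ?D" ?D q "mat 1 :: complex^'n^'n"] p by (simp add: comp_assoc)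
      also have "\<dots> = ?G d (r \<circ> q)"
        using tensor_trace_1_Suc[of "q \<circ> r" d j, where 'n = 'n] p j tensor_trace_commute[of q d r "mat 1 :: complex^'n^'n"] by (simp add: comp_assoc)
      finally show ?thesis by (simp add: comp_assoc)
    qed
    then show "h j ?D = ?f" unfolding h_def young_trace_def by simp
  qed
  also have "(\<Sum>i\<in>I. \<Sum>j\<in>J. h i j) = 0"
  proof (intro sum.neutral ballI)
    fix i j assume "i \<in> I" "j \<in> J"
    then have i: "i \<in> {1..d}" "i \<in> {1..?D}" "i \<noteq> ?D" "rw i = rw ?D"
      and j: "j \<in> {1..d}" "j \<in> {1..?D}" "j \<noteq> ?D" "cl j = cl ?D" by (auto simp: I_def J_def fibre_def)
    obtain l where l: "l \<in> {1..d}" "rw l = rw j" "cl l = cl i" using ex[OF i(1) j(1) i(4) j(4)] by blast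
    have ij: "i \<noteq> j" using inj[OF i(1,4)] j by auto
    have li: "l \<noteq> i" using inj[OF j(1)] l i j by auto
    have lj: "l \<noteq> j" using inj[OF i(1,4)] l i j by auto
    define S where "S = (\<Sum>r\<in>stab d rw. \<Sum>q\<in>stab d cl. of_int (sign q) * ?G d (r \<circ> transp i j \<circ> q))"
    \<comment> \<open>The transposition \<open>(l j)\<close> belongs to the row group and may be
      inserted freely. Moved past \<open>(i j)\<close> it becomes \<open>(l i)\<close>, which
      belongs to the column group and costs a sign; hence \<open>S = - S\<close>.\<close>
    have "S = (\<Sum>r\<in>stab d rw. \<Sum>q\<in>stab d cl. of_int (sign q) * ?G d (r \<circ> transp l j \<circ> transp i j \<circ> q))"
      unfolding S_def by (rule sum_stab_right[OF transp_in_stab[OF l(1) j(1) l(2)], symmetric])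
    also have "\<dots> = (\<Sum>r\<in>stab d rw. \<Sum>q\<in>stab d cl. - (of_int (sign (transp l i \<circ> q)) * ?G d (r \<circ> transp i j \<circ> (transp l i \<circ> q))))"
    proof (intro sum.cong refl)
      fix r q :: "nat \<Rightarrow> nat" assume q: "q \<in> stab d cl"
      have "transp l j \<circ> transp i j = transp i j \<circ> transp l i"
        using ij li lj by (auto simp: fun_eq_iff Transposition.transpose_def)
      then have "r \<circ> transp l j \<circ> transp i j \<circ> q = r \<circ> transp i j \<circ> (transp l i \<circ> q)" by (metis comp_assoc)
      moreover have "sign (transp l i \<circ> q) = - sign q"
        using stab_perms[OF q] l i li by (simp add: sign_comp_perms[of _ d] sign_swap_id)
      ultimately show "of_int (sign q) * ?G d (r \<circ> transp l j \<circ> transp i j \<circ> q) =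
        - (of_int (sign (transp l i \<circ> q)) * ?G d (r \<circ> transp i j \<circ> (transp l i \<circ> q)))" by simp
    qed
    also have "\<dots> = - S"
      unfolding S_def sum_negf by (subst sum_stab_left[OF transp_in_stab[OF l(1) i(1) l(3)]]) simp
    finally have S0: "S = 0" by (simp add: eq_neg_iff_add_eq_0)
    have "of_int (sign (transp j ?D \<circ> q)) * ?G ?D (r \<circ> transp i ?D \<circ> (transp j ?D \<circ> q)) = - (of_int (sign q) * ?G d (r \<circ> transp i j \<circ> q))"
      if r: "r \<in> stab d rw" and q: "q \<in> stab d cl" for r q
    proof -
      have p: "r \<in> perms d" "q \<in> perms d" "r \<in> perms ?D" "q \<in> perms ?D" "transp j ?D \<in> perms ?D" "transp i ?D \<in> perms ?D"
          "transp i j \<in> perms d" "transp i j \<in> perms ?D"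
        using stab_perms[OF r] stab_perms[OF q] perms_Suc(1) i j by auto
      have t: "transp i ?D \<circ> transp j ?D = transp i j \<circ> transp i ?D"
        using ij i j by (auto simp: fun_eq_iff Transposition.transpose_def)
      have "r \<circ> transp i ?D \<circ> (transp j ?D \<circ> q) = r \<circ> (transp i ?D \<circ> transp j ?D) \<circ> q" by (simp add: comp_assoc)
      then have "?G ?D (r \<circ> transp i ?D \<circ> (transp j ?D \<circ> q)) = ?G ?D ((r \<circ> transp i j \<circ> transp i ?D) \<circ> q)"
        by (simp add: t comp_assoc)
      also have "\<dots> = ?G ?D (q \<circ> (r \<circ> transp i j \<circ> transp i ?D))"
        by (rule tensor_trace_commute) (use p in auto)
      also have "\<dots> = ?G ?D ((q \<circ> (r \<circ> transp i j)) \<circ> transp i ?D)" by (simp add: comp_assoc)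
      also have "\<dots> = ?G d (q \<circ> (r \<circ> transp i j))"
        using tensor_trace_1_Suc[of "q \<circ> (r \<circ> transp i j)" d i, where 'n = 'n] p i by simp
      also have "\<dots> = ?G d (r \<circ> transp i j \<circ> q)"
        by (rule tensor_trace_commute) (use p in auto)
      finally show ?thesis using p j by (simp add: sign_comp_perms[of _ ?D] sign_swap_id)
    qed
    then have "h i j = - S" unfolding h_def S_def by (simp add: sum_negf)
    then show "h i j = 0" using S0 by simp
  qed
  finally show ?thesis unfolding I_def[symmetric] J_def[symmetric] by (simp add: algebra_simps)
qed

lemma tableau_less:
  assumes "c \<in> cells \<nu>" "c' \<in> cells \<nu>" "fst c < fst c' \<or> fst c = fst c' \<and> snd c < snd c'"
  shows "tableau \<nu> c < tableau \<nu> c'"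
proof (cases "fst c < fst c'")
  case True
  obtain i j i' j' where c: "c = (i, j)" "c' = (i', j')" by (metis prod.exhaust)
  have ij: "i < length \<nu>" "j < \<nu> ! i" "i < i'" using assms True by (auto simp: c cells_def)
  have "take i' \<nu> = take (Suc i) \<nu> @ take (i' - Suc i) (drop (Suc i) \<nu>)"
    using ij take_add[of "Suc i" "i' - Suc i" \<nu>] by simp
  then have "sum_list (take (Suc i) \<nu>) \<le> sum_list (take i' \<nu>)" by simp
  then show ?thesis using ij by (simp add: c tableau_def take_Suc_conv_app_nth)
next
  case False
  then show ?thesis using assms(3) by (auto simp: tableau_def)
qed

context
  fixes \<nu> :: "nat list" and d m :: nat
  assumes \<nu>: "\<nu> \<in> partitions d" and m: "Suc m \<le> d"
begin

interpretation young d "row_of \<nu>" "col_of \<nu>" by (rule young_partition[OF \<nu>])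

lemma tab_less:
  assumes "k \<in> {1..d}" "l \<in> {1..d}"
    "row_of \<nu> k < row_of \<nu> l \<or> row_of \<nu> k = row_of \<nu> l \<and> col_of \<nu> k < col_of \<nu> l"
  shows "k < l"
  using tableau_less[of "cell_of \<nu> k" \<nu> "cell_of \<nu> l"] assms sum_list_partition[OF \<nu>]
    tableau_cell_of[of k \<nu>] tableau_cell_of[of l \<nu>] cell_of_in[of k \<nu>] cell_of_in[of l \<nu>]
  by (simp add: row_of_def col_of_def)

text \<open>The canonical tableau increases in reading order, so the smaller entries of the row of
  \<open>Suc m\<close> are exactly those in the cells to its left.\<close>

lemma card_row_before: "card (fibre m (row_of \<nu>) (row_of \<nu> (Suc m))) = col_of \<nu> (Suc m)"
proof -
  let ?F = "fibre m (row_of \<nu>) (row_of \<nu> (Suc m))"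
  have D: "Suc m \<in> {1..d}" using m by simp
  have "col_of \<nu> ` ?F = {..<col_of \<nu> (Suc m)}"
  proof (intro equalityI subsetI)
    fix j assume "j \<in> col_of \<nu> ` ?F"
    then obtain k where k: "j = col_of \<nu> k" "k \<in> {1..m}" "row_of \<nu> k = row_of \<nu> (Suc m)" by (auto simp: fibre_def)
    have kd: "k \<in> {1..d}" using k m by auto
    have "\<not> col_of \<nu> (Suc m) < col_of \<nu> k" using tab_less[OF D kd] k by auto
    moreover have "col_of \<nu> (Suc m) \<noteq> col_of \<nu> k" using eqI[OF D kd] k by auto
    ultimately show "j \<in> {..<col_of \<nu> (Suc m)}" using k by auto
  next
    fix j assume j: "j \<in> {..<col_of \<nu> (Suc m)}"
    obtain l where l: "l \<in> {1..d}" "row_of \<nu> l = row_of \<nu> (Suc m)" "col_of \<nu> l = j"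
      using down[OF D, of "row_of \<nu> (Suc m)" j] j by auto
    have "l < Suc m" by (rule tab_less[OF l(1) D]) (use l j in auto)
    then show "j \<in> col_of \<nu> ` ?F" using l by (auto simp: fibre_def)
  qed
  moreover have "inj_on (col_of \<nu>) ?F"
    by (rule inj_onI, rule eqI) (use m in \<open>auto simp: fibre_def\<close>)
  ultimately show ?thesis using card_image by fastforce
qed

lemma card_col_before: "card (fibre m (col_of \<nu>) (col_of \<nu> (Suc m))) = row_of \<nu> (Suc m)"
proof -
  let ?F = "fibre m (col_of \<nu>) (col_of \<nu> (Suc m))"
  have D: "Suc m \<in> {1..d}" using m by simp
  have "row_of \<nu> ` ?F = {..<row_of \<nu> (Suc m)}"
  proof (intro equalityI subsetI)
    fix j assume "j \<in> row_of \<nu> ` ?F"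
    then obtain k where k: "j = row_of \<nu> k" "k \<in> {1..m}" "col_of \<nu> k = col_of \<nu> (Suc m)" by (auto simp: fibre_def)
    have kd: "k \<in> {1..d}" using k m by auto
    have "\<not> row_of \<nu> (Suc m) < row_of \<nu> k" using tab_less[OF D kd] k by auto
    moreover have "row_of \<nu> (Suc m) \<noteq> row_of \<nu> k" using eqI[OF D kd] k by auto
    ultimately show "j \<in> {..<row_of \<nu> (Suc m)}" using k by auto
  next
    fix j assume j: "j \<in> {..<row_of \<nu> (Suc m)}"
    obtain l where l: "l \<in> {1..d}" "row_of \<nu> l = j" "col_of \<nu> l = col_of \<nu> (Suc m)"
      using down[OF D, of j "col_of \<nu> (Suc m)"] j by auto
    have "l < Suc m" by (rule tab_less[OF l(1) D]) (use l j in auto)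
    then show "j \<in> row_of \<nu> ` ?F" using l by (auto simp: fibre_def)
  qed
  moreover have "inj_on (row_of \<nu>) ?F"
    by (rule inj_onI, rule eqI) (use m in \<open>auto simp: fibre_def\<close>)
  ultimately show ?thesis using card_image by fastforce
qed

text \<open>Among the smaller entries, \<open>col_of\<close> many lie to the left of
  \<open>Suc m\<close> and \<open>row_of\<close> many above it; their difference is the content of
  its cell.\<close>

lemma young_trace_partition_step:
  "young_trace (mat 1 :: complex^'n^'n) (row_of \<nu>) (col_of \<nu>) (Suc m) =
    (of_nat CARD('n) + of_int (cell_content (cell_of \<nu> (Suc m)))) * young_trace (mat 1 :: complex^'n^'n) (row_of \<nu>) (col_of \<nu>) m"
proof -
  have D: "Suc m \<in> {1..d}" using m by simp
  have "young_trace (mat 1 :: complex^'n^'n) (row_of \<nu>) (col_of \<nu>) (Suc m) =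
    (of_nat CARD('n) + of_nat (card (fibre m (row_of \<nu>) (row_of \<nu> (Suc m)))) - of_nat (card (fibre m (col_of \<nu>) (col_of \<nu> (Suc m)))))
    * young_trace (mat 1 :: complex^'n^'n) (row_of \<nu>) (col_of \<nu>) m"
  proof (rule young_trace_step)
    fix i assume i: "i \<in> {1..m}" "row_of \<nu> i = row_of \<nu> (Suc m)"
    have id: "i \<in> {1..d}" using i m by simp
    show "col_of \<nu> i \<noteq> col_of \<nu> (Suc m)" using eqI[OF id D i(2)] i(1) by auto
  next
    fix i j assume ij: "i \<in> {1..m}" "j \<in> {1..m}" "row_of \<nu> i = row_of \<nu> (Suc m)" "col_of \<nu> j = col_of \<nu> (Suc m)"
    have id: "i \<in> {1..d}" and jd: "j \<in> {1..d}" using ij m by simp_all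
    have ci: "col_of \<nu> i < col_of \<nu> (Suc m)"
      using tab_less[OF D id] eqI[OF id D ij(3)] ij(1,3) by (metis atLeastAtMost_iff linorder_neqE_nat not_less_eq_eq order_less_imp_le Suc_n_not_le_n)
    have rj: "row_of \<nu> j < row_of \<nu> (Suc m)"
      using tab_less[OF D jd] eqI[OF jd D _ ij(4)] ij(2) by (metis atLeastAtMost_iff linorder_neqE_nat not_less_eq_eq order_less_imp_le Suc_n_not_le_n)
    obtain l where l: "l \<in> {1..d}" "row_of \<nu> l = row_of \<nu> j" "col_of \<nu> l = col_of \<nu> i"
      using down[OF jd, of "row_of \<nu> j" "col_of \<nu> i"] ci ij(4) by auto
    \<comment> \<open>The fourth corner of the rectangle spanned by \<open>i\<close>,
      \<open>j\<close> and \<open>Suc m\<close> lies in a row above that of \<open>Suc m\<close> and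
      is therefore filled earlier.\<close>
    have "l < Suc m" by (rule tab_less[OF l(1) D]) (use l rj in auto)
    then show "\<exists>l\<in>{1..m}. row_of \<nu> l = row_of \<nu> j \<and> col_of \<nu> l = col_of \<nu> i" using l by auto
  qed
  then show ?thesis
    unfolding card_row_before card_col_before
    by (simp add: cell_content_def row_of_def col_of_def algebra_simps)
qed

end

lemma tensor_trace_0: "tensor_trace A 0 s = 1"
  by (simp add: tensor_trace_def words_def)

lemma young_trace_partition:
  assumes \<nu>: "\<nu> \<in> partitions d"
  shows "m \<le> d \<Longrightarrow> young_trace (mat 1 :: complex^'n^'n) (row_of \<nu>) (col_of \<nu>) m =
    (\<Prod>k\<in>{1..m}. of_nat CARD('n) + of_int (cell_content (cell_of \<nu> k)))"
proof (induction m)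
  case 0
  have "stab 0 f = {id}" for f by (auto simp: stab_def perms_def)
  then show ?case by (simp add: young_trace_def tensor_trace_0)
next
  case (Suc m)
  then show ?case by (simp add: young_trace_partition_step[OF \<nu> Suc.prems] mult.commute)
qed

lemma young_trace_Omega:
  assumes \<nu>: "\<nu> \<in> partitions d"
  shows "young_trace (mat 1 :: complex^'n^'n) (row_of \<nu>) (col_of \<nu>) d = of_nat CARD('n) ^ d * Omega CARD('n) \<nu>"
proof -
  have d: "sum_list \<nu> = d" by (rule sum_list_partition[OF \<nu>])
  have "Omega CARD('n) \<nu> = (\<Prod>k\<in>{1..d}. 1 + of_int (cell_content (cell_of \<nu> k)) / of_nat CARD('n))"
    unfolding Omega_def using prod.reindex_bij_betw[OF cell_of_bij[of \<nu>], of "\<lambda>c. 1 + of_int (cell_content c) / (of_nat CARD('n) :: complex)"] d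
    by simp
  then have "of_nat CARD('n) ^ d * Omega CARD('n) \<nu> =
     (\<Prod>k\<in>{1..d}. of_nat CARD('n) * (1 + of_int (cell_content (cell_of \<nu> k)) / of_nat CARD('n)))"
    by (simp add: prod.distrib)
  also have "\<dots> = (\<Prod>k\<in>{1..d}. of_nat CARD('n) + of_int (cell_content (cell_of \<nu> k)))"
    by (intro prod.cong refl) (simp add: field_simps)
  finally show ?thesis using young_trace_partition[OF \<nu>, of d, where 'n = 'n] by simp
qed

text \<open>A content is at least minus the row index, and row indices are below \<open>N\<close>;
  hence every factor is a positive integer divided by \<open>N\<close>.\<close>

lemma Omega_nonzero:
  assumes "length \<nu> \<le> N" shows "Omega N \<nu> \<noteq> 0"
proof -
  have "1 + of_int (cell_content c) / of_nat N \<noteq> (0::complex)" if "c \<in> cells \<nu>" for c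
  proof -
    have c: "fst c < N" using that assms by (auto simp: cells_def)
    have "int N + cell_content c \<noteq> 0" using c by (simp add: cell_content_def)
    then have "of_int (int N + cell_content c) \<noteq> (0::complex)" by (simp only: of_int_eq_0_iff not_False_eq_True)
    moreover have "1 + of_int (cell_content c) / of_nat N = of_int (int N + cell_content c) / (of_nat N :: complex)"
      using c by (simp add: field_simps)
    ultimately show ?thesis using c by (simp del: of_int_add)
  qed
  then show ?thesis by (simp add: Omega_def)
qed

lemma tensor_trace_elt_young:
  assumes \<nu>: "\<nu> \<in> partitions d"
  shows "conv d (tensor_trace_elt A d) (young_symmetrizer \<nu>) id = young_trace A (row_of \<nu>) (col_of \<nu>) d"
proof -
  let ?R = "stab d (row_of \<nu>)" and ?C = "stab d (col_of \<nu>)"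
  have d: "sum_list \<nu> = d" by (rule sum_list_partition[OF \<nu>])
  have "conv d (tensor_trace_elt A d) (young_symmetrizer \<nu>) id = conv d (conv d (tensor_trace_elt A d) (row_sum d (row_of \<nu>))) (col_sum d (col_of \<nu>)) id"
    by (simp add: young_symmetrizer_ysym ysym_def d conv_assoc)
  also have "\<dots> = (\<Sum>q\<in>perms d. (\<Sum>r\<in>perms d. tensor_trace_elt A d (inv q \<circ> inv r) * row_sum d (row_of \<nu>) r) * col_sum d (col_of \<nu>) q)"
    by (simp add: conv_apply_right)
  also have "\<dots> = (\<Sum>q\<in>?C. \<Sum>r\<in>?R. of_int (sign q) * tensor_trace A d (r \<circ> q))"
  proof -
    have "(\<Sum>r\<in>perms d. tensor_trace_elt A d (inv q \<circ> inv r) * row_sum d (row_of \<nu>) r) = (\<Sum>r\<in>?R. tensor_trace A d (r \<circ> q))" if q: "q \<in> perms d" for q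
      unfolding sum_perms_inter[symmetric]
    proof (rule sum.cong[OF refl])
      fix r assume r: "r \<in> perms d"
      have "tensor_trace_elt A d (inv q \<circ> inv r) = tensor_trace A d (r \<circ> q)"
        using tensor_trace_inv[of "r \<circ> q" d A] inv_comp_perms[OF r q] r q by (simp add: tensor_trace_elt_def)
      then show "tensor_trace_elt A d (inv q \<circ> inv r) * row_sum d (row_of \<nu>) r = (if r \<in> ?R then tensor_trace A d (r \<circ> q) else 0)"
        by (simp add: row_sum_def)
    qed
    then show ?thesis
      unfolding sum_perms_inter[symmetric, where d = d and f = "col_of \<nu>"]
      by (intro sum.cong refl) (simp add: col_sum_def sum_distrib_left mult.commute)
  qed
  also have "\<dots> = young_trace A (row_of \<nu>) (col_of \<nu>) d" unfolding young_trace_def by (rule sum.swap)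
  finally show ?thesis .
qed

lemma gram_chi_elt:
  assumes \<nu>: "\<nu> \<in> partitions d"
  shows "conv d (tensor_trace_elt (mat 1 :: complex^'n^'n) d) (chi_elt \<nu>) = fscale (of_nat CARD('n) ^ d * Omega CARD('n) \<nu>) (chi_elt \<nu>)"
  using conv_chi_elt[OF \<nu> class_fun_tensor_trace_elt[of d "mat 1 :: complex^'n^'n"]] tensor_trace_elt_young[OF \<nu>, of "mat 1 :: complex^'n^'n"]
    young_trace_Omega[OF \<nu>, where 'n = 'n] by simp

section \<open>The action on the tensor power and the Weingarten function\<close>

definition perm_act :: "nat \<Rightarrow> ((nat \<Rightarrow> nat) \<Rightarrow> complex) \<Rightarrow> ((nat \<Rightarrow> 'a) \<Rightarrow> complex) \<Rightarrow> (nat \<Rightarrow> 'a) \<Rightarrow> complex" where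
  "perm_act d f F = (\<lambda>x. \<Sum>s\<in>perms d. f s * F (x \<circ> s))"

lemma perm_act_conv: "perm_act d (conv d f g) F = perm_act d f (perm_act d g F)"
proof
  fix x
  have "perm_act d (conv d f g) F x = (\<Sum>s\<in>perms d. \<Sum>q\<in>perms d. f q * (g (inv q \<circ> s) * F (x \<circ> s)))"
    unfolding perm_act_def by (intro sum.cong refl) (simp add: conv_apply sum_distrib_right mult.assoc)
  also have "\<dots> = (\<Sum>q\<in>perms d. \<Sum>s\<in>perms d. f q * (g (inv q \<circ> s) * F (x \<circ> s)))" by (rule sum.swap)
  also have "\<dots> = (\<Sum>q\<in>perms d. \<Sum>s\<in>perms d. f q * (g (inv q \<circ> (q \<circ> s)) * F (x \<circ> (q \<circ> s))))"
    by (rule sum.cong[OF refl], rule sum_perms_left[symmetric])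
  also have "\<dots> = perm_act d f (perm_act d g F) x"
    by (simp add: perm_act_def sum_distrib_left comp_assoc)
  finally show "perm_act d (conv d f g) F x = perm_act d f (perm_act d g F) x" .
qed

lemma perm_act_sum: "perm_act d (\<Sum>i\<in>I. f i) F x = (\<Sum>i\<in>I. perm_act d (f i) F x)"
  unfolding perm_act_def sum_fun_apply sum_distrib_right by (rule sum.swap)

lemma perm_act_scale: "perm_act d (fscale a f) F x = a * perm_act d f F x"
  by (simp add: perm_act_def fscale_def sum_distrib_left mult.assoc)

lemma perm_act_basis_id: "perm_act d (basis_elt id) F = F"
  by (simp add: perm_act_def basis_elt_def mult_delta_left)

text \<open>The transposition of two places of a column that carry equal letters fixes the word but
  changes the sign of every term.\<close>

lemma col_sum_perm_act_zero:
  assumes "k \<in> {1..d}" "l \<in> {1..d}" "k \<noteq> l" "cl k = cl l" "x k = x l"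
  shows "perm_act d (col_sum d cl) F x = 0"
proof -
  let ?t = "transp k l"
  have t: "?t \<in> stab d cl" using assms by (intro transp_in_stab)
  have xt: "x \<circ> ?t = x" using assms by (auto simp: Transposition.transpose_def fun_eq_iff)
  have "perm_act d (col_sum d cl) F x = (\<Sum>q\<in>perms d. col_sum d cl (?t \<circ> q) * F (x \<circ> (?t \<circ> q)))"
    unfolding perm_act_def by (rule sum_perms_left[OF stab_perms[OF t], symmetric])
  also have "\<dots> = (\<Sum>q\<in>perms d. - (col_sum d cl q * F (x \<circ> q)))"
  proof (rule sum.cong[OF refl])
    fix q assume q: "q \<in> perms d"
    have "x \<circ> (?t \<circ> q) = x \<circ> q" using xt by (metis comp_assoc)
    then show "col_sum d cl (?t \<circ> q) * F (x \<circ> (?t \<circ> q)) = - (col_sum d cl q * F (x \<circ> q))"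
      using q comp_stab_iff(1)[OF t q] sign_comp_perms[OF stab_perms[OF t] q] assms(3)
      by (simp add: col_sum_def sign_swap_id)
  qed
  also have "\<dots> = - perm_act d (col_sum d cl) F x" by (simp add: perm_act_def sum_negf)
  finally show ?thesis by (simp add: eq_neg_iff_add_eq_0)
qed

text \<open>The first column has more than \<open>N\<close> cells, so some letter repeats in it and
  the column antisymmetrizer kills every word. The class average only conjugates this
  symmetrizer.\<close>

lemma perm_act_chi_elt_zero:
  fixes F :: "(nat \<Rightarrow> 'n::finite) \<Rightarrow> complex"
  assumes \<nu>: "\<nu> \<in> partitions d" and len: "CARD('n) < length \<nu>"
  shows "perm_act d (chi_elt \<nu>) F x = 0"
proof -
  have d: "sum_list \<nu> = d" by (rule sum_list_partition[OF \<nu>])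
  have col: "perm_act d (col_sum d (col_of \<nu>)) F x = 0" for F and x :: "nat \<Rightarrow> 'n"
  proof -
    have 0: "(i, 0) \<in> cells \<nu>" if "i < length \<nu>" for i
      using that \<nu> by (auto simp: cells_def partitions_def) (metis nth_mem gr0I)
    have "\<not> inj_on (\<lambda>i. x (tableau \<nu> (i, 0))) {..<length \<nu>}"
    proof
      assume "inj_on (\<lambda>i. x (tableau \<nu> (i, 0))) {..<length \<nu>}"
      then have "card {..<length \<nu>} \<le> CARD('n)" by (rule card_inj_on_le) auto
      then show False using len by simp
    qed
    then obtain i i' where i: "i < length \<nu>" "i' < length \<nu>" "i \<noteq> i'" "x (tableau \<nu> (i, 0)) = x (tableau \<nu> (i', 0))"
      unfolding inj_on_def by auto
    have ne: "tableau \<nu> (i, 0) \<noteq> tableau \<nu> (i', 0)"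
      using cell_of_tableau[OF 0[OF i(1)]] cell_of_tableau[OF 0[OF i(2)]] i(3) by (metis prod.inject)
    have "tableau \<nu> (i, 0) \<in> {1..d}" "tableau \<nu> (i', 0) \<in> {1..d}"
      using tableau_in[OF 0[OF i(1)]] tableau_in[OF 0[OF i(2)]] d by simp_all
    moreover have "col_of \<nu> (tableau \<nu> (i, 0)) = col_of \<nu> (tableau \<nu> (i', 0))"
      using cell_of_tableau[OF 0[OF i(1)]] cell_of_tableau[OF 0[OF i(2)]] by (simp add: col_of_def)
    ultimately show ?thesis using ne i(4) by (intro col_sum_perm_act_zero)
  qed
  have ys: "perm_act d (young_symmetrizer \<nu>) F x = 0" for F and x :: "nat \<Rightarrow> 'n"
  proof -
    have "perm_act d (col_sum d (col_of \<nu>)) F = (\<lambda>x. 0)" for F :: "(nat \<Rightarrow> 'n) \<Rightarrow> complex" using col by auto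
    then show ?thesis unfolding young_symmetrizer_ysym ysym_def d perm_act_conv by (simp add: perm_act_def)
  qed
  have "perm_act d (class_avg d (young_symmetrizer \<nu>)) F x = 0"
  proof -
    have "perm_act d (young_symmetrizer \<nu>) G = (\<lambda>x. 0)" for G :: "(nat \<Rightarrow> 'n) \<Rightarrow> complex" using ys by auto
    then have "perm_act d (conv d (basis_elt s) (conv d (young_symmetrizer \<nu>) (basis_elt (inv s)))) F x = 0" for s
      by (simp only: perm_act_conv) (simp add: perm_act_def)
    then show ?thesis unfolding class_avg_alt perm_act_sum by simp
  qed
  then show ?thesis unfolding chi_elt_eq[OF \<nu>] perm_act_scale by simp
qed

text \<open>The Weingarten function of the unitary group. For \<open>d\<close> at most
  \<open>N\<close> all shapes occur and it inverts the Gram element in the group algebra; in general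
  it does so only on the tensor power.\<close>

definition weingarten :: "nat \<Rightarrow> nat \<Rightarrow> (nat \<Rightarrow> nat) \<Rightarrow> complex" where
  "weingarten N d = (\<Sum>\<nu> | \<nu> \<in> partitions d \<and> length \<nu> \<le> N. fscale (1 / (of_nat N ^ d * Omega N \<nu> * hook \<nu>)) (chi_elt \<nu>))"

lemma perm_act_gram_weingarten:
  fixes F :: "(nat \<Rightarrow> 'n::finite) \<Rightarrow> complex"
  shows "perm_act d (conv d (tensor_trace_elt (mat 1 :: complex^'n^'n) d) (weingarten CARD('n) d)) F = F"
proof
  fix x
  let ?P = "{\<nu>. \<nu> \<in> partitions d \<and> length \<nu> \<le> CARD('n)}"
  have "conv d (tensor_trace_elt (mat 1 :: complex^'n^'n) d) (weingarten CARD('n) d) = (\<Sum>\<nu>\<in>?P. fscale (1 / hook \<nu>) (chi_elt \<nu>))"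
    unfolding weingarten_def conv_sum_right
    by (rule sum.cong[OF refl]) (auto simp: conv_scale_right gram_chi_elt Omega_nonzero)
  then have "perm_act d (conv d (tensor_trace_elt (mat 1 :: complex^'n^'n) d) (weingarten CARD('n) d)) F x =
     (\<Sum>\<nu>\<in>?P. 1 / hook \<nu> * perm_act d (chi_elt \<nu>) F x)"
    by (simp add: perm_act_sum perm_act_scale)
  \<comment> \<open>Shapes with more than \<open>N\<close> rows act by zero, so they may be added to
    complete the sum to the identity.\<close>
  also have "\<dots> = (\<Sum>\<nu>\<in>partitions d. 1 / hook \<nu> * perm_act d (chi_elt \<nu>) F x)"
  proof (rule sum.mono_neutral_left)
    show "\<forall>\<nu>\<in>partitions d - ?P. 1 / hook \<nu> * perm_act d (chi_elt \<nu>) F x = 0"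
      using perm_act_chi_elt_zero[of _ d F x] by (simp add: not_le)
  qed auto
  also have "\<dots> = perm_act d (\<Sum>\<nu>\<in>partitions d. fscale (1 / hook \<nu>) (chi_elt \<nu>)) F x"
    by (simp add: perm_act_sum perm_act_scale)
  also have "\<dots> = F x" by (simp only: basis_id_decomposition[symmetric] perm_act_basis_id)
  finally show "perm_act d (conv d (tensor_trace_elt (mat 1 :: complex^'n^'n) d) (weingarten CARD('n) d)) F x = F x" .
qed

section \<open>Kernels invariant under the general linear group\<close>

text \<open>Evaluated at \<open>x\<close> and \<open>y \<circ> \<tau>\<close>, this is the matrix
  entry at \<open>x\<close>, \<open>y\<close> of the place permutation given by \<tau>.\<close>

definition agree :: "nat \<Rightarrow> (nat \<Rightarrow> 'a) \<Rightarrow> (nat \<Rightarrow> 'a) \<Rightarrow> complex" where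
  "agree d x y = (if \<forall>k\<in>{1..d}. x k = y k then 1 else 0)"

text \<open>Kernels take arbitrary functions on the natural numbers as words, so dependence on the
  first \<open>d\<close> letters alone has to be required.\<close>

definition local_kernel :: "nat \<Rightarrow> ((nat \<Rightarrow> 'a) \<Rightarrow> (nat \<Rightarrow> 'a) \<Rightarrow> complex) \<Rightarrow> bool" where
  "local_kernel d M \<longleftrightarrow> (\<forall>x x' y y'. (\<forall>k\<in>{1..d}. x k = x' k \<and> y k = y' k) \<longrightarrow> M x y = M x' y')"

text \<open>The kernel \<open>M\<close> commutes with the action of the elementary matrices of \<open>gl\<close> on tensors.\<close>

definition gl_invariant :: "nat \<Rightarrow> ((nat \<Rightarrow> 'a) \<Rightarrow> (nat \<Rightarrow> 'a) \<Rightarrow> complex) \<Rightarrow> bool" where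
  "gl_invariant d M \<longleftrightarrow> (\<forall>a b x y. (\<Sum>k\<in>{1..d}. if x k = a then M (x(k := b)) y else 0) =
     (\<Sum>k\<in>{1..d}. if y k = b then M x (y(k := a)) else 0))"

definition perm_span :: "nat \<Rightarrow> ((nat \<Rightarrow> 'a) \<Rightarrow> (nat \<Rightarrow> 'a) \<Rightarrow> complex) \<Rightarrow> bool" where
  "perm_span d H \<longleftrightarrow> (\<exists>m. \<forall>x y. H x y = (\<Sum>\<tau>\<in>perms d. m \<tau> * agree d x (y \<circ> \<tau>)))"

lemma perm_span_agree:
  assumes "\<sigma> \<in> perms d" shows "perm_span d (\<lambda>x y. agree d x (y \<circ> \<sigma>))"
  unfolding perm_span_def using assms by (intro exI[of _ "\<lambda>\<tau>. if \<tau> = \<sigma> then 1 else 0"]) (simp add: mult_delta_left)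

lemma perm_span_scale: "perm_span d H \<Longrightarrow> perm_span d (\<lambda>x y. c * H x y)"
  unfolding perm_span_def by (elim exE, rule_tac x = "\<lambda>\<tau>. c * m \<tau>" in exI) (simp add: sum_distrib_left mult.assoc)

lemma perm_span_add: "perm_span d H \<Longrightarrow> perm_span d K \<Longrightarrow> perm_span d (\<lambda>x y. H x y + K x y)"
  unfolding perm_span_def by (elim exE, rule_tac x = "\<lambda>\<tau>. m \<tau> + ma \<tau>" in exI) (simp add: sum.distrib algebra_simps)

lemma perm_span_zero: "perm_span d (\<lambda>x y. 0)"
  unfolding perm_span_def by (rule exI[of _ "\<lambda>_. 0"]) simp

lemma perm_span_sum:
  "finite I \<Longrightarrow> (\<And>i. i \<in> I \<Longrightarrow> perm_span d (H i)) \<Longrightarrow> perm_span d (\<lambda>x y. \<Sum>i\<in>I. H i x y)"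
  by (induction I rule: finite_induct) (simp_all add: perm_span_zero perm_span_add)

lemma agree_comp:
  assumes p: "p \<in> perms d" shows "agree d (x \<circ> p) y = agree d x (y \<circ> inv p)"
proof -
  have "(\<forall>k\<in>{1..d}. x (p k) = y k) \<longleftrightarrow> (\<forall>k\<in>{1..d}. x k = y (inv p k))"
  proof
    assume *: "\<forall>k\<in>{1..d}. x (p k) = y k"
    show "\<forall>k\<in>{1..d}. x k = y (inv p k)"
    proof
      fix k assume "k \<in> {1..d}"
      then have "inv p k \<in> {1..d}" using perms_in_iff[OF inv_in_perms[OF p]] by blast
      then have "x (p (inv p k)) = y (inv p k)" using * by blast
      then show "x k = y (inv p k)" using p by simp
    qed
  next
    assume *: "\<forall>k\<in>{1..d}. x k = y (inv p k)"
    show "\<forall>k\<in>{1..d}. x (p k) = y k"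
    proof
      fix k assume "k \<in> {1..d}"
      then have "p k \<in> {1..d}" using perms_in_iff[OF p] by blast
      then have "x (p k) = y (inv p (p k))" using * by blast
      then show "x (p k) = y k" using p by simp
    qed
  qed
  then show ?thesis by (simp add: agree_def)
qed

lemma perm_span_comp:
  assumes "perm_span d H" "p \<in> perms d" shows "perm_span d (\<lambda>x y. H (x \<circ> p) y)"
proof -
  obtain m where m: "\<And>x y. H x y = (\<Sum>\<tau>\<in>perms d. m \<tau> * agree d x (y \<circ> \<tau>))"
    using assms(1) by (auto simp: perm_span_def)
  have "(\<lambda>x y. H (x \<circ> p) y) = (\<lambda>x y. \<Sum>\<tau>\<in>perms d. m \<tau> * agree d x (y \<circ> (\<tau> \<circ> inv p)))"
    by (simp add: m agree_comp[OF assms(2)] comp_assoc)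
  moreover have "perm_span d (\<lambda>x y. \<Sum>\<tau>\<in>perms d. m \<tau> * agree d x (y \<circ> (\<tau> \<circ> inv p)))"
    using assms(2) by (intro perm_span_sum perm_span_scale perm_span_agree) simp_all
  ultimately show ?thesis by (simp only:)
qed

text \<open>Place permutations commute with the diagonal action. This serves to move a letter of the
  second word to the last place before contracting.\<close>

lemma gl_invariant_perm:
  assumes "gl_invariant d M" "t \<in> perms d" shows "gl_invariant d (\<lambda>x y. M x (y \<circ> t))"
  unfolding gl_invariant_def
proof (intro allI)
  fix a b and x y :: "nat \<Rightarrow> 'a"
  have "(\<Sum>k\<in>{1..d}. if x k = a then M (x(k := b)) (y \<circ> t) else 0) = (\<Sum>k\<in>{1..d}. if (y \<circ> t) k = b then M x ((y \<circ> t)(k := a)) else 0)"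
    using assms(1) unfolding gl_invariant_def by blast
  also have "\<dots> = (\<Sum>k\<in>{1..d}. if y (t k) = b then M x ((y(t k := a)) \<circ> t) else 0)"
  proof (rule sum.cong[OF refl])
    fix k
    have "inj t" using assms(2) by (simp add: perms_def permutes_inj)
    then have "(y \<circ> t)(k := a) = (y(t k := a)) \<circ> t" by (auto simp: fun_eq_iff dest: injD)
    then show "(if (y \<circ> t) k = b then M x ((y \<circ> t)(k := a)) else 0) = (if y (t k) = b then M x ((y(t k := a)) \<circ> t) else 0)"
      by simp
  qed
  also have "\<dots> = (\<Sum>k\<in>{1..d}. if y k = b then M x ((y(k := a)) \<circ> t) else 0)"
    using sum.permute[of t "{1..d}" "\<lambda>k. if y k = b then M x ((y(k := a)) \<circ> t) else 0"] assms(2)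
    by (simp add: perms_def o_def)
  finally show "(\<Sum>k\<in>{1..d}. if x k = a then M (x(k := b)) (y \<circ> t) else 0) = (\<Sum>k\<in>{1..d}. if y k = b then M x ((y(k := a)) \<circ> t) else 0)" .
qed

lemma local_kernel_perm:
  assumes "local_kernel d M" "t \<in> perms d" shows "local_kernel d (\<lambda>x y. M x (y \<circ> t))"
  unfolding local_kernel_def
proof (intro allI impI)
  fix x x' y y' :: "nat \<Rightarrow> 'a" assume *: "\<forall>k\<in>{1..d}. x k = x' k \<and> y k = y' k"
  have "(y \<circ> t) k = (y' \<circ> t) k" if "k \<in> {1..d}" for k
  proof -
    have "t k \<in> {1..d}" using that perms_in_iff[OF assms(2)] by blast
    then show ?thesis using * by simp
  qed
  then show "M x (y \<circ> t) = M x' (y' \<circ> t)" using assms(1) * unfolding local_kernel_def by blast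
qed

section \<open>Partial traces and the Jucys-Murphy element\<close>

definition contraction :: "nat \<Rightarrow> ((nat \<Rightarrow> 'a::finite) \<Rightarrow> (nat \<Rightarrow> 'a) \<Rightarrow> complex) \<Rightarrow> (nat \<Rightarrow> 'a) \<Rightarrow> (nat \<Rightarrow> 'a) \<Rightarrow> complex" where
  "contraction k M x y = (\<Sum>a\<in>UNIV. M (x(k := a)) (y(k := a)))"

lemma local_kernel_contraction:
  assumes "local_kernel (Suc d) M" shows "local_kernel d (contraction (Suc d) M)"
  unfolding local_kernel_def contraction_def
proof (intro allI impI sum.cong refl)
  fix x x' y y' :: "nat \<Rightarrow> 'a" and a assume "\<forall>k\<in>{1..d}. x k = x' k \<and> y k = y' k"
  then have "\<forall>k\<in>{1..Suc d}. (x(Suc d := a)) k = (x'(Suc d := a)) k \<and> (y(Suc d := a)) k = (y'(Suc d := a)) k"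
    by (auto simp: le_Suc_eq)
  then show "M (x(Suc d := a)) (y(Suc d := a)) = M (x'(Suc d := a)) (y'(Suc d := a))"
    using assms unfolding local_kernel_def by blast
qed

text \<open>In the relation of degree \<open>Suc d\<close> each side has one extra term, from the
  last place. Summed over the contracted letter, both extra terms become the same value of
  \<open>M\<close>, and they cancel.\<close>

lemma gl_invariant_contraction:
  fixes M :: "(nat \<Rightarrow> 'a::finite) \<Rightarrow> _"
  assumes "gl_invariant (Suc d) M" shows "gl_invariant d (contraction (Suc d) M)"
  unfolding gl_invariant_def
proof (intro allI)
  fix a b and x y :: "nat \<Rightarrow> 'a"
  let ?D = "Suc d"
  have D: "{1..?D} = insert ?D {1..d}" by auto
  have tw: "(u(?D := c))(k := e) = (u(k := e))(?D := c)" if "k \<in> {1..d}" for u :: "nat \<Rightarrow> 'a" and c k e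
    using that by (intro fun_upd_twist) auto
  have c: "(\<Sum>k\<in>{1..d}. if x k = a then M (x(k := b, ?D := c)) (y(?D := c)) else 0) + (if c = a then M (x(?D := b)) (y(?D := c)) else 0) =
    (\<Sum>k\<in>{1..d}. if y k = b then M (x(?D := c)) (y(k := a, ?D := c)) else 0) + (if c = b then M (x(?D := c)) (y(?D := a)) else 0)" for c
  proof -
    have "(\<Sum>k\<in>{1..?D}. if (x(?D := c)) k = a then M ((x(?D := c))(k := b)) (y(?D := c)) else 0) =
     (\<Sum>k\<in>{1..?D}. if (y(?D := c)) k = b then M (x(?D := c)) ((y(?D := c))(k := a)) else 0)"
      using assms unfolding gl_invariant_def by blast
    moreover have "(\<Sum>k\<in>{1..?D}. if (x(?D := c)) k = a then M ((x(?D := c))(k := b)) (y(?D := c)) else 0) =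
      (\<Sum>k\<in>{1..d}. if x k = a then M (x(k := b, ?D := c)) (y(?D := c)) else 0) + (if c = a then M (x(?D := b)) (y(?D := c)) else 0)"
      unfolding D by (simp add: add.commute) (auto intro!: sum.cong simp: tw)
    moreover have "(\<Sum>k\<in>{1..?D}. if (y(?D := c)) k = b then M (x(?D := c)) ((y(?D := c))(k := a)) else 0) =
      (\<Sum>k\<in>{1..d}. if y k = b then M (x(?D := c)) (y(k := a, ?D := c)) else 0) + (if c = b then M (x(?D := c)) (y(?D := a)) else 0)"
      unfolding D by (simp add: add.commute) (auto intro!: sum.cong simp: tw)
    ultimately show ?thesis by simp
  qed
  have s: "(\<Sum>c\<in>UNIV. (\<Sum>k\<in>{1..d}. if P k then f k c else 0)) = (\<Sum>k\<in>{1..d}. if P k then \<Sum>c\<in>UNIV. f k c else 0)"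
    for P and f :: "nat \<Rightarrow> 'a \<Rightarrow> complex"
    by (subst sum.swap) (auto intro!: sum.cong)
  have "(\<Sum>c\<in>UNIV. (\<Sum>k\<in>{1..d}. if x k = a then M (x(k := b, ?D := c)) (y(?D := c)) else 0) + (if c = a then M (x(?D := b)) (y(?D := c)) else 0)) =
    (\<Sum>c\<in>UNIV. (\<Sum>k\<in>{1..d}. if y k = b then M (x(?D := c)) (y(k := a, ?D := c)) else 0) + (if c = b then M (x(?D := c)) (y(?D := a)) else 0))"
    by (simp only: c)
  then show "(\<Sum>k\<in>{1..d}. if x k = a then contraction ?D M (x(k := b)) y else 0) = (\<Sum>k\<in>{1..d}. if y k = b then contraction ?D M x (y(k := a)) else 0)"
    unfolding sum.distrib s contraction_def by simp
qed

text \<open>Summing the invariance relation over elementary matrices inserted in the last tensor factor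
  expresses the Jucys-Murphy element \<open>N + \<Sum>\<^sub>k (k d)\<close> applied to \<open>M\<close> by contractions of \<open>M\<close>.\<close>

lemma gl_invariant_jucys_murphy:
  fixes M :: "(nat \<Rightarrow> 'a::finite) \<Rightarrow> _"
  assumes "gl_invariant (Suc d) M"
  shows "of_nat CARD('a) * M x y + (\<Sum>k\<in>{1..d}. M (x \<circ> transp k (Suc d)) y) =
    (\<Sum>k\<in>{1..Suc d}. if y k = x (Suc d) then \<Sum>a\<in>UNIV. M (x(Suc d := a)) (y(k := a)) else 0)"
proof -
  let ?D = "Suc d"
  have D: "{1..?D} = insert ?D {1..d}" by auto
  \<comment> \<open>Invariance for \<open>b = x (Suc d)\<close>, at the word \<open>x\<close> with
    last letter replaced by \<open>a\<close>. The last place then restores \<open>x\<close>, and a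
    place \<open>k\<close> with letter \<open>a\<close> produces \<open>x\<close> with places
    \<open>k\<close> and \<open>Suc d\<close> exchanged.\<close>
  have "(\<Sum>k\<in>{1..?D}. if (x(?D := a)) k = a then M ((x(?D := a))(k := x ?D)) y else 0) =
     (\<Sum>k\<in>{1..?D}. if y k = x ?D then M (x(?D := a)) (y(k := a)) else 0)" for a
    using assms unfolding gl_invariant_def by blast
  moreover have "(\<Sum>k\<in>{1..?D}. if (x(?D := a)) k = a then M ((x(?D := a))(k := x ?D)) y else 0) =
     M x y + (\<Sum>k\<in>{1..d}. if a = x k then M (x \<circ> transp k ?D) y else 0)" for a
  proof -
    have "(if (x(?D := a)) k = a then M ((x(?D := a))(k := x ?D)) y else 0) = (if a = x k then M (x \<circ> transp k ?D) y else 0)"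
      if "k \<in> {1..d}" for k
    proof -
      have "(x(?D := x k))(k := x ?D) = x \<circ> transp k ?D"
        by (auto simp: fun_eq_iff Transposition.transpose_def)
      then show ?thesis using that by auto
    qed
    then show ?thesis unfolding D by simp
  qed
  ultimately have "(\<Sum>a\<in>UNIV. M x y + (\<Sum>k\<in>{1..d}. if a = x k then M (x \<circ> transp k ?D) y else 0)) =
     (\<Sum>a\<in>UNIV. \<Sum>k\<in>{1..?D}. if y k = x ?D then M (x(?D := a)) (y(k := a)) else 0)" by simp
  moreover have "(\<Sum>a\<in>UNIV. \<Sum>k\<in>{1..d}. if a = x k then M (x \<circ> transp k ?D) y else 0) = (\<Sum>k\<in>{1..d}. M (x \<circ> transp k ?D) y)"
    by (subst sum.swap) simp
  moreover have "(\<Sum>a\<in>UNIV. \<Sum>k\<in>{1..?D}. if y k = x ?D then M (x(?D := a)) (y(k := a)) else 0) =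
     (\<Sum>k\<in>{1..?D}. if y k = x ?D then \<Sum>a\<in>UNIV. M (x(?D := a)) (y(k := a)) else 0)"
    by (subst sum.swap) (auto intro!: sum.cong)
  ultimately show ?thesis by (simp add: sum.distrib)
qed

text \<open>By the coset decomposition and \<open>tensor_trace_1_Suc\<close>, the Gram element of
  degree \<open>Suc d\<close> is the one of degree \<open>d\<close> times the Jucys-Murphy
  element.\<close>

lemma perm_act_gram_Suc:
  fixes F :: "(nat \<Rightarrow> 'n::finite) \<Rightarrow> complex"
  shows "perm_act (Suc d) (tensor_trace_elt (mat 1 :: complex^'n^'n) (Suc d)) F x =
    (\<Sum>s\<in>perms d. tensor_trace (mat 1 :: complex^'n^'n) d s *
      (of_nat CARD('n) * F (x \<circ> s) + (\<Sum>k\<in>{1..d}. F (x \<circ> s \<circ> transp k (Suc d)))))"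
proof -
  let ?D = "Suc d" and ?G = "tensor_trace (mat 1 :: complex^'n^'n)"
  \<comment> \<open>With a constant function as index the stabilizer is the whole symmetric group,
    so \<open>sum_stab_Suc\<close> becomes its decomposition into cosets.\<close>
  have st: "stab m (\<lambda>_. 0) = perms m" for m by (simp add: stab_def)
  have fib: "fibre ?D (\<lambda>_. 0) 0 = insert ?D {1..d}" by (auto simp: fibre_def)
  have "perm_act ?D (tensor_trace_elt (mat 1 :: complex^'n^'n) ?D) F x = (\<Sum>s\<in>perms ?D. ?G ?D s * F (x \<circ> s))"
    by (simp add: perm_act_def tensor_trace_elt_def)
  also have "\<dots> = (\<Sum>k\<in>insert ?D {1..d}. \<Sum>s\<in>perms d. ?G ?D (s \<circ> transp k ?D) * F (x \<circ> (s \<circ> transp k ?D)))"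
    using sum_stab_Suc[of "\<lambda>s. ?G ?D s * F (x \<circ> s)" d "\<lambda>_. 0"] by (simp only: st fib)
  also have "\<dots> = (\<Sum>k\<in>insert ?D {1..d}. \<Sum>s\<in>perms d. (if k = ?D then of_nat CARD('n) else 1) * ?G d s * F (x \<circ> s \<circ> transp k ?D))"
  proof (intro sum.cong refl)
    fix k s assume k: "k \<in> insert ?D {1..d}" and s: "s \<in> perms d"
    have "k \<in> {1..?D}" using k by auto
    from tensor_trace_1_Suc[OF s this, where 'n = 'n]
    show "?G ?D (s \<circ> transp k ?D) * F (x \<circ> (s \<circ> transp k ?D)) =
      (if k = ?D then of_nat CARD('n) else 1) * ?G d s * F (x \<circ> s \<circ> transp k ?D)"
      by (simp only: comp_assoc)
  qed
  also have "\<dots> = (\<Sum>s\<in>perms d. \<Sum>k\<in>insert ?D {1..d}. (if k = ?D then of_nat CARD('n) else 1) * ?G d s * F (x \<circ> s \<circ> transp k ?D))"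
    by (rule sum.swap)
  also have "\<dots> = (\<Sum>s\<in>perms d. ?G d s * (of_nat CARD('n) * F (x \<circ> s) + (\<Sum>k\<in>{1..d}. F (x \<circ> s \<circ> transp k ?D))))"
  proof (rule sum.cong[OF refl])
    fix s
    have "(\<Sum>k\<in>{1..d}. (if k = ?D then of_nat CARD('n) else 1) * ?G d s * F (x \<circ> s \<circ> transp k ?D)) = (\<Sum>k\<in>{1..d}. ?G d s * F (x \<circ> s \<circ> transp k ?D))"
      by (rule sum.cong) auto
    then show "(\<Sum>k\<in>insert ?D {1..d}. (if k = ?D then of_nat CARD('n) else 1) * ?G d s * F (x \<circ> s \<circ> transp k ?D)) =
       ?G d s * (of_nat CARD('n) * F (x \<circ> s) + (\<Sum>k\<in>{1..d}. F (x \<circ> s \<circ> transp k ?D)))"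
      by (simp add: algebra_simps sum_distrib_left)
  qed
  finally show ?thesis .
qed

lemma gl_invariant_perm_span:
  fixes M :: "(nat \<Rightarrow> 'n::finite) \<Rightarrow> (nat \<Rightarrow> 'n) \<Rightarrow> complex"
  assumes "gl_invariant d M" "local_kernel d M"
  shows "perm_span d M"
  using assms
proof (induction d arbitrary: M)
  case 0
  have "M x y = M x' y'" for x x' y y' using 0(2) by (simp add: local_kernel_def)
  moreover have "perms 0 = {id}" by (auto simp: perms_def)
  ultimately show ?case unfolding perm_span_def
    by (intro exI[of _ "\<lambda>_. M undefined undefined"]) (simp add: agree_def)
next
  case (Suc d)
  let ?D = "Suc d"
  let ?G = "tensor_trace_elt (mat 1 :: complex^'n^'n) ?D" and ?W = "weingarten CARD('n) ?D"
  define H where "H x y = (\<Sum>k\<in>{1..?D}. if y k = x ?D then \<Sum>a\<in>UNIV. M (x(?D := a)) (y(k := a)) else 0)" for x y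
  \<comment> \<open>Exchanging the places \<open>k\<close> and \<open>Suc d\<close> in the second
    word turns the inner sum into a contraction in the last place, to which the induction hypothesis
    applies.\<close>
  have span_term: "perm_span ?D (\<lambda>x y. if y k = x ?D then \<Sum>a\<in>UNIV. M (x(?D := a)) (y(k := a)) else 0)" if k: "k \<in> {1..?D}" for k
  proof -
    let ?t = "transp k ?D"
    have t: "?t \<in> perms ?D" using k by simp
    have "perm_span d (contraction ?D (\<lambda>x y. M x (y \<circ> ?t)))"
      by (intro Suc.IH gl_invariant_contraction local_kernel_contraction gl_invariant_perm local_kernel_perm Suc.prems t)
    then obtain m where m: "\<And>x y. contraction ?D (\<lambda>x y. M x (y \<circ> ?t)) x y = (\<Sum>\<tau>\<in>perms d. m \<tau> * agree d x (y \<circ> \<tau>))"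
      by (auto simp: perm_span_def)
    have "(if y k = x ?D then \<Sum>a\<in>UNIV. M (x(?D := a)) (y(k := a)) else 0) =
        (\<Sum>\<tau>\<in>perms d. m \<tau> * agree ?D x (y \<circ> (?t \<circ> \<tau>)))" for x y
    proof -
      have "y(k := a) = ((y \<circ> ?t)(?D := a)) \<circ> ?t" for a
        by (auto simp: fun_eq_iff Transposition.transpose_def)
      then have "(\<Sum>a\<in>UNIV. M (x(?D := a)) (y(k := a))) = contraction ?D (\<lambda>x y. M x (y \<circ> ?t)) x (y \<circ> ?t)"
        by (simp add: contraction_def)
      also have "\<dots> = (\<Sum>\<tau>\<in>perms d. m \<tau> * agree d x (y \<circ> ?t \<circ> \<tau>))" by (rule m)
      finally have 1: "(\<Sum>a\<in>UNIV. M (x(?D := a)) (y(k := a))) = (\<Sum>\<tau>\<in>perms d. m \<tau> * agree d x (y \<circ> (?t \<circ> \<tau>)))"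
        by (simp add: comp_assoc)
      \<comment> \<open>As \<tau> fixes \<open>Suc d\<close>, the condition
        \<open>y k = x (Suc d)\<close> is precisely the agreement in the last place that is missing
        from degree \<open>d\<close>.\<close>
      have "{1..?D} = insert ?D {1..d}" by auto
      then have "agree ?D x (y \<circ> (?t \<circ> \<tau>)) = (if y k = x ?D then agree d x (y \<circ> (?t \<circ> \<tau>)) else 0)" if "\<tau> \<in> perms d" for \<tau>
        using perms_Suc(2)[OF that] by (auto simp: agree_def)
      then show ?thesis using 1 by simp
    qed
    moreover have "perm_span ?D (\<lambda>x y. \<Sum>\<tau>\<in>perms d. m \<tau> * agree ?D x (y \<circ> (?t \<circ> \<tau>)))"
      using t perms_Suc(1) by (intro perm_span_sum perm_span_scale perm_span_agree) simp_all
    ultimately show ?thesis by simp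
  qed
  have H: "perm_span ?D H" unfolding H_def by (intro perm_span_sum span_term) simp_all
  have jm: "of_nat CARD('n) * M x y + (\<Sum>k\<in>{1..d}. M (x \<circ> transp k ?D) y) = H x y" for x y
    unfolding H_def by (rule gl_invariant_jucys_murphy[OF Suc.prems(1)])
  \<comment> \<open>\<open>M\<close> is recovered from its Jucys-Murphy image \<open>H\<close>: the
    Gram element of lower degree and then \<open>weingarten\<close> are applied to \<open>H\<close>,
    and their product with the Jucys-Murphy element acts as the identity.\<close>
  have "M x y = (\<Sum>w\<in>perms ?D. ?W w * (\<Sum>s\<in>perms d. tensor_trace (mat 1 :: complex^'n^'n) d s * H (x \<circ> (w \<circ> s)) y))" for x y
  proof -
    have "M x y = perm_act ?D (conv ?D ?G ?W) (\<lambda>x. M x y) x" by (simp only: perm_act_gram_weingarten)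
    also have "\<dots> = perm_act ?D ?W (perm_act ?D ?G (\<lambda>x. M x y)) x"
      by (simp only: class_fun_central[OF class_fun_tensor_trace_elt] perm_act_conv)
    also have "perm_act ?D ?G (\<lambda>x. M x y) = (\<lambda>x. \<Sum>s\<in>perms d. tensor_trace (mat 1 :: complex^'n^'n) d s * H (x \<circ> s) y)"
      by (rule ext) (simp only: perm_act_gram_Suc jm)
    finally show ?thesis by (simp add: perm_act_def comp_assoc)
  qed
  moreover have "perm_span ?D (\<lambda>x y. \<Sum>w\<in>perms ?D. ?W w * (\<Sum>s\<in>perms d. tensor_trace (mat 1 :: complex^'n^'n) d s * H (x \<circ> (w \<circ> s)) y))"
    using perms_Suc(1) by (intro perm_span_sum perm_span_scale perm_span_comp[OF H]) simp_all
  ultimately show ?case by simp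
qed

text \<open>Pairing \<open>M\<close> with place permutations shows that \<open>h\<close> is the
  product of any coefficient function \<open>m\<close> with the Gram element. Hence \<open>h\<close>
  times \<open>weingarten\<close> acts on words as \<open>m\<close> does, although it may differ
  from \<open>m\<close> itself.\<close>

lemma weingarten_formula:
  fixes M :: "(nat \<Rightarrow> 'n::finite) \<Rightarrow> (nat \<Rightarrow> 'n) \<Rightarrow> complex"
  assumes "gl_invariant d M" "local_kernel d M"
    and h: "\<And>\<pi>. \<pi> \<in> perms d \<Longrightarrow> (\<Sum>y\<in>words d. M (y \<circ> \<pi>) y) = h \<pi>"
  shows "M x y = (\<Sum>\<tau>\<in>perms d. (\<Sum>\<sigma>\<in>perms d. h \<sigma> * weingarten CARD('n) d (inv \<sigma> \<circ> \<tau>)) * agree d x (y \<circ> \<tau>))"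
proof -
  let ?G = "tensor_trace_elt (mat 1 :: complex^'n^'n) d" and ?W = "weingarten CARD('n) d"
  obtain m where m: "\<And>x y. M x y = (\<Sum>\<tau>\<in>perms d. m \<tau> * agree d x (y \<circ> \<tau>))"
    using gl_invariant_perm_span[OF assms(1,2)] by (auto simp: perm_span_def)
  have hm: "h \<pi> = conv d m ?G \<pi>" if p: "\<pi> \<in> perms d" for \<pi>
  proof -
    have "h \<pi> = (\<Sum>\<tau>\<in>perms d. m \<tau> * (\<Sum>y\<in>(words d :: (nat \<Rightarrow> 'n) set). agree d (y \<circ> \<pi>) (y \<circ> \<tau>)))"
      unfolding h[OF p, symmetric] m by (subst sum.swap) (simp add: sum_distrib_left)
    also have "\<dots> = (\<Sum>\<tau>\<in>perms d. m \<tau> * ?G (inv \<tau> \<circ> \<pi>))"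
    proof (rule sum.cong[OF refl])
      fix \<tau> assume t: "\<tau> \<in> perms d"
      have "(\<Sum>y\<in>(words d :: (nat \<Rightarrow> 'n) set). agree d (y \<circ> \<pi>) (y \<circ> \<tau>)) = tensor_trace (mat 1 :: complex^'n^'n) d (\<tau> \<circ> inv \<pi>)"
        unfolding agree_comp[OF p] tensor_trace_1 by (simp add: agree_def)
      also have "\<dots> = tensor_trace (mat 1 :: complex^'n^'n) d (inv \<tau> \<circ> \<pi>)"
        using tensor_trace_inv[of "\<pi> \<circ> inv \<tau>" d "mat 1 :: complex^'n^'n"] tensor_trace_commute[of \<pi> d "inv \<tau>" "mat 1 :: complex^'n^'n"] p t
        by (simp add: inv_comp_perms[of _ d])
      finally show "m \<tau> * (\<Sum>y\<in>(words d :: (nat \<Rightarrow> 'n) set). agree d (y \<circ> \<pi>) (y \<circ> \<tau>)) = m \<tau> * ?G (inv \<tau> \<circ> \<pi>)"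
        using p t by (simp add: tensor_trace_elt_def)
    qed
    finally show ?thesis using p by (simp add: conv_apply)
  qed
  have "(\<Sum>\<tau>\<in>perms d. (\<Sum>\<sigma>\<in>perms d. h \<sigma> * ?W (inv \<sigma> \<circ> \<tau>)) * agree d x (y \<circ> \<tau>)) =
     perm_act d (conv d (conv d m ?G) ?W) (agree d x) y"
    unfolding perm_act_def by (intro sum.cong refl) (simp add: conv_apply[of _ d "conv d m ?G"] hm)
  also have "\<dots> = perm_act d m (agree d x) y"
    by (simp only: conv_assoc perm_act_conv[of d m] perm_act_gram_weingarten)
  also have "\<dots> = M x y" by (simp add: m perm_act_def)
  finally show ?thesis by simp
qed

section \<open>Moments of Haar measure\<close>

lemma unitary_rows:
  fixes U :: "complex^'n^'n"
  assumes "U \<in> unitary_group" shows "(\<Sum>k\<in>UNIV. U $ i $ k * cnj (U $ j $ k)) = (if i = j then 1 else 0)"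
proof -
  have "(U ** adjoint_mat U) $ i $ j = (mat 1 :: complex^'n^'n) $ i $ j" using assms by (simp add: unitary_group_def)
  then show ?thesis by (simp add: matrix_matrix_mult_def adjoint_mat_def mat_def)
qed

lemma unitary_cols:
  fixes U :: "complex^'n^'n"
  assumes "U \<in> unitary_group" shows "(\<Sum>k\<in>UNIV. U $ k $ i * cnj (U $ k $ j)) = (if i = j then 1 else 0)"
proof -
  have "(adjoint_mat U ** U) $ j $ i = (mat 1 :: complex^'n^'n) $ j $ i" using assms by (simp add: unitary_group_def)
  then show ?thesis by (simp add: matrix_matrix_mult_def adjoint_mat_def mat_def mult.commute eq_commute)
qed

lemma unitary_entry_le:
  assumes "U \<in> unitary_group" shows "norm (U $ i $ j) \<le> 1"
proof -
  have "complex_of_real (\<Sum>k\<in>UNIV. (norm (U $ i $ k))\<^sup>2) = 1"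
    using unitary_rows[OF assms, of i i] by (simp add: complex_norm_square del: of_real_power)
  then have s: "(\<Sum>k\<in>UNIV. (norm (U $ i $ k))\<^sup>2) = 1" by (simp only: of_real_eq_1_iff)
  have "(norm (U $ i $ j))\<^sup>2 \<le> (\<Sum>k\<in>UNIV. (norm (U $ i $ k))\<^sup>2)"
    by (rule member_le_sum) auto
  then show ?thesis using s by (simp add: abs_square_le_1)
qed

lemma matrix_inv_unitary:
  assumes "U \<in> unitary_group" shows "matrix_inv U = adjoint_mat U"
proof -
  have U: "U ** adjoint_mat U = mat 1" "adjoint_mat U ** U = mat 1" using assms by (auto simp: unitary_group_def)
  then have "\<exists>A'. U ** A' = mat 1 \<and> A' ** U = mat 1" by blast
  from someI_ex[OF this] have i: "U ** matrix_inv U = mat 1" unfolding matrix_inv_def by (rule conjunct1)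
  have "matrix_inv U = (adjoint_mat U ** U) ** matrix_inv U" by (simp only: U matrix_mul_lid)
  also have "\<dots> = adjoint_mat U ** (U ** matrix_inv U)" by (simp only: matrix_mul_assoc)
  also have "\<dots> = adjoint_mat U" by (simp only: i matrix_mul_rid)
  finally show ?thesis .
qed

lemma compact_unitary_group: "compact (unitary_group :: (complex^'n^'n) set)"
  unfolding compact_eq_bounded_closed
proof
  have "norm U \<le> real (CARD('n) * CARD('n))" if "U \<in> unitary_group" for U :: "complex^'n^'n"
  proof -
    have "norm (U $ i) \<le> real CARD('n)" for i
    proof -
      have "norm (U $ i) \<le> (\<Sum>j\<in>UNIV. norm (U $ i $ j))" unfolding norm_vec_def by (rule L2_set_le_sum) simp
      also have "\<dots> \<le> (\<Sum>j\<in>(UNIV::'n set). 1)" by (intro sum_mono unitary_entry_le that)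
      finally show ?thesis by simp
    qed
    then have "(\<Sum>i\<in>UNIV. norm (U $ i)) \<le> (\<Sum>i\<in>(UNIV::'n set). real CARD('n))" by (intro sum_mono)
    moreover have "norm U \<le> (\<Sum>i\<in>UNIV. norm (U $ i))" unfolding norm_vec_def[of U] by (rule L2_set_le_sum) simp
    ultimately show ?thesis by simp
  qed
  then show "bounded (unitary_group :: (complex^'n^'n) set)" unfolding bounded_iff by blast
  have "unitary_group = {U. U ** adjoint_mat U = (mat 1 :: complex^'n^'n)} \<inter> {U. adjoint_mat U ** U = (mat 1 :: complex^'n^'n)}"
    by (auto simp: unitary_group_def)
  also have "closed \<dots>"
    unfolding matrix_matrix_mult_def adjoint_mat_def
    by (intro closed_Int closed_Collect_eq continuous_intros continuous_on_vec_lambda)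
  finally show "closed (unitary_group :: (complex^'n^'n) set)" .
qed

text \<open>A kernel in the row indices \<open>x\<close> and \<open>y\<close>; the column indices
  \<open>u\<close> and \<open>v\<close> are parameters. Left translation, under which
  \<open>haar_prob_measure\<close> is invariant, acts on row indices only.\<close>

definition haar_kernel :: "(complex^'n^'n) measure \<Rightarrow> nat \<Rightarrow> (nat \<Rightarrow> 'n) \<Rightarrow> (nat \<Rightarrow> 'n) \<Rightarrow> (nat \<Rightarrow> 'n) \<Rightarrow> (nat \<Rightarrow> 'n) \<Rightarrow> complex" where
  "haar_kernel \<mu> d u v x y = (\<integral>U. (\<Prod>k\<in>{1..d}. U $ x k $ u k * cnj (U $ y k $ v k)) \<partial>\<mu>)"

context
  fixes \<mu> :: "(complex^'n^'n) measure"
  assumes haar: "haar_prob_measure \<mu>"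
begin

interpretation prob_space \<mu> using haar by (simp add: haar_prob_measure_def)

lemma haar_sets: "sets \<mu> = sets (restrict_space borel unitary_group)"
  using haar by (simp add: haar_prob_measure_def)

lemma haar_space: "space \<mu> = unitary_group"
  using sets_eq_imp_space_eq[OF haar_sets] by (simp add: space_restrict_space)

lemma haar_measurable:
  fixes f :: "complex^'n^'n \<Rightarrow> 'b::topological_space"
  assumes "continuous_on UNIV f" shows "f \<in> borel_measurable \<mu>"
  using assms unfolding measurable_cong_sets[OF haar_sets refl]
  by (intro measurable_restrict_space1 borel_measurable_continuous_onI)

lemma haar_integrable:
  fixes f :: "complex^'n^'n \<Rightarrow> complex"
  assumes "continuous_on UNIV f" shows "integrable \<mu> f"
proof -
  have "compact (f ` unitary_group)"
    using assms compact_unitary_group by (intro compact_continuous_image) (auto intro: continuous_on_subset)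
  then have "bounded (f ` unitary_group)" by (rule compact_imp_bounded)
  then obtain B where B: "\<And>U. U \<in> unitary_group \<Longrightarrow> norm (f U) \<le> B"
    by (auto simp: bounded_iff)
  show ?thesis
    by (rule integrable_const_bound[of _ B, OF AE_I2 haar_measurable[OF assms]]) (simp add: haar_space B)
qed

lemma continuous_matrix_mult_left: "continuous_on UNIV (\<lambda>U::complex^'n^'n. V ** U)"
  unfolding matrix_matrix_mult_def by (intro continuous_intros continuous_on_vec_lambda)

lemma unitary_mult: "V \<in> unitary_group \<Longrightarrow> U \<in> unitary_group \<Longrightarrow> V ** U \<in> unitary_group"
proof -
  assume "V \<in> unitary_group" "U \<in> unitary_group"
  then have h: "V ** adjoint_mat V = mat 1" "adjoint_mat V ** V = mat 1" "U ** adjoint_mat U = mat 1" "adjoint_mat U ** U = mat 1"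
    by (auto simp: unitary_group_def)
  have a: "adjoint_mat (V ** U) = adjoint_mat U ** adjoint_mat V"
    by (simp add: adjoint_mat_def matrix_matrix_mult_def vec_eq_iff mult.commute)
  have "V ** U ** (adjoint_mat U ** adjoint_mat V) = V ** (U ** adjoint_mat U) ** adjoint_mat V"
    "adjoint_mat U ** adjoint_mat V ** (V ** U) = adjoint_mat U ** (adjoint_mat V ** V) ** U"
    by (simp_all add: matrix_mul_assoc)
  then show ?thesis by (simp add: unitary_group_def a h matrix_mul_rid)
qed

lemma haar_invariant:
  fixes f :: "complex^'n^'n \<Rightarrow> complex"
  assumes f: "continuous_on UNIV f" and V: "V \<in> unitary_group"
  shows "(\<integral>U. f (V ** U) \<partial>\<mu>) = (\<integral>U. f U \<partial>\<mu>)"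
proof -
  have "(\<lambda>U. V ** U) \<in> measurable (restrict_space borel unitary_group) (restrict_space borel unitary_group)"
    using V by (intro measurable_restrict_space3 borel_measurable_continuous_onI continuous_matrix_mult_left)
      (auto intro: unitary_mult)
  then have m: "(\<lambda>U. V ** U) \<in> measurable \<mu> \<mu>" unfolding measurable_cong_sets[OF haar_sets haar_sets] .
  have "(\<integral>U. f U \<partial>\<mu>) = (\<integral>U. f U \<partial>(distr \<mu> \<mu> (\<lambda>U. V ** U)))"
    using haar V by (simp add: haar_prob_measure_def)
  also have "\<dots> = (\<integral>U. f (V ** U) \<partial>\<mu>)"
    by (rule integral_distr[OF m haar_measurable[OF f]])
  finally show ?thesis by simp
qed

lemma continuous_entries: "continuous_on UNIV (\<lambda>U::complex^'n^'n. \<Prod>k\<in>{1..d}. U $ x k $ u k * cnj (U $ y k $ v k))"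
  by (intro continuous_intros)

lemma local_kernel_haar_kernel: "local_kernel d (haar_kernel \<mu> d u v)"
  by (auto simp: local_kernel_def haar_kernel_def)

text \<open>Summing over the row indices leaves inner products of columns of \<open>U\<close>, so
  the integrand is constant on the unitary group.\<close>

lemma haar_kernel_trace:
  assumes p: "\<pi> \<in> perms d"
  shows "(\<Sum>y\<in>words d. haar_kernel \<mu> d u v (y \<circ> \<pi>) y) = agree d u (v \<circ> \<pi>)"
proof -
  have pt: "(\<Sum>y\<in>words d. \<Prod>k\<in>{1..d}. U $ y (\<pi> k) $ u k * cnj (U $ y k $ v k)) = agree d u (v \<circ> \<pi>)"
    if U: "U \<in> unitary_group" for U :: "complex^'n^'n"
  proof -
    have "(\<Sum>y\<in>words d. \<Prod>k\<in>{1..d}. U $ y (\<pi> k) $ u k * cnj (U $ y k $ v k)) =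
      (\<Sum>y\<in>words d. \<Prod>k\<in>{1..d}. U $ y (\<pi> k) $ u k * cnj (U $ y (\<pi> k) $ v (\<pi> k)))"
      using prod_perms[OF p, of "\<lambda>k. cnj (U $ y k $ v k)" for y] by (simp add: prod.distrib)
    also have "\<dots> = (\<Sum>y\<in>words d. \<Prod>k\<in>{1..d}. U $ (restrict (y \<circ> \<pi>) {1..d}) k $ u k * cnj (U $ (restrict (y \<circ> \<pi>) {1..d}) k $ v (\<pi> k)))"
      by simp
    also have "\<dots> = (\<Sum>y\<in>words d. \<Prod>k\<in>{1..d}. U $ y k $ u k * cnj (U $ y k $ v (\<pi> k)))"
      by (rule sum_words_perm[OF p])
    also have "\<dots> = (\<Prod>k\<in>{1..d}. \<Sum>a\<in>UNIV. U $ a $ u k * cnj (U $ a $ v (\<pi> k)))"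
      unfolding words_def by (subst prod_sum_PiE) auto
    also have "\<dots> = (\<Prod>k\<in>{1..d}. if u k = v (\<pi> k) then 1 else 0)"
      by (simp add: unitary_cols[OF U])
    also have "\<dots> = agree d u (v \<circ> \<pi>)"
    proof (cases "\<forall>k\<in>{1..d}. u k = v (\<pi> k)")
      case False
      then obtain k where "k \<in> {1..d}" "u k \<noteq> v (\<pi> k)" by blast
      then have "(\<Prod>k\<in>{1..d}. if u k = v (\<pi> k) then 1 else 0) = (0::complex)" by (intro prod_zero) auto
      then show ?thesis using False by (simp add: agree_def)
    qed (simp add: agree_def)
    finally show ?thesis .
  qed
  have "(\<Sum>y\<in>words d. haar_kernel \<mu> d u v (y \<circ> \<pi>) y) =
      (\<integral>U. (\<Sum>y\<in>words d. \<Prod>k\<in>{1..d}. U $ y (\<pi> k) $ u k * cnj (U $ y k $ v k)) \<partial>\<mu>)"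
    unfolding haar_kernel_def by (subst Bochner_Integration.integral_sum) (auto intro!: haar_integrable continuous_intros)
  also have "\<dots> = (\<integral>U. agree d u (v \<circ> \<pi>) \<partial>\<mu>)"
    by (rule Bochner_Integration.integral_cong[OF refl], rule pt) (simp only: haar_space)
  finally show ?thesis by (simp add: prob_space)
qed

text \<open>Left invariance in coordinates, obtained by replacing \<open>U\<close> with
  \<open>V ** U\<close> and multiplying out the entries.\<close>

lemma haar_kernel_expand:
  assumes V: "V \<in> unitary_group"
  shows "haar_kernel \<mu> d u v x y = (\<Sum>x'\<in>words d. \<Sum>y'\<in>words d.
    (\<Prod>k\<in>{1..d}. V $ x k $ x' k) * (\<Prod>k\<in>{1..d}. cnj (V $ y k $ y' k)) * haar_kernel \<mu> d u v x' y')"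
proof -
  have "haar_kernel \<mu> d u v x y = (\<integral>U. (\<Prod>k\<in>{1..d}. (V ** U) $ x k $ u k * cnj ((V ** U) $ y k $ v k)) \<partial>\<mu>)"
    unfolding haar_kernel_def by (rule haar_invariant[OF continuous_entries V, symmetric])
  also have "\<dots> = (\<integral>U. (\<Sum>x'\<in>words d. \<Sum>y'\<in>words d.
    (\<Prod>k\<in>{1..d}. V $ x k $ x' k) * (\<Prod>k\<in>{1..d}. cnj (V $ y k $ y' k)) *
       (\<Prod>k\<in>{1..d}. U $ x' k $ u k * cnj (U $ y' k $ v k))) \<partial>\<mu>)"
  proof (rule Bochner_Integration.integral_cong[OF refl])
    fix U :: "complex^'n^'n"
    have 1: "(\<Prod>k\<in>{1..d}. (V ** U) $ x k $ u k) = (\<Sum>x'\<in>words d. \<Prod>k\<in>{1..d}. V $ x k $ x' k * U $ x' k $ u k)"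
      unfolding words_def matrix_matrix_mult_def by (subst prod_sum_PiE[symmetric]) auto
    have 2: "(\<Prod>k\<in>{1..d}. cnj ((V ** U) $ y k $ v k)) = (\<Sum>x'\<in>words d. \<Prod>k\<in>{1..d}. cnj (V $ y k $ x' k) * cnj (U $ x' k $ v k))"
      unfolding words_def matrix_matrix_mult_def by (subst prod_sum_PiE[symmetric]) auto
    show "(\<Prod>k\<in>{1..d}. (V ** U) $ x k $ u k * cnj ((V ** U) $ y k $ v k)) = (\<Sum>x'\<in>words d. \<Sum>y'\<in>words d.
      (\<Prod>k\<in>{1..d}. V $ x k $ x' k) * (\<Prod>k\<in>{1..d}. cnj (V $ y k $ y' k)) *
       (\<Prod>k\<in>{1..d}. U $ x' k $ u k * cnj (U $ y' k $ v k)))"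
      unfolding prod.distrib 1 2 sum_product by (simp add: mult_ac)
  qed
  also have "\<dots> = (\<Sum>x'\<in>words d. \<Sum>y'\<in>words d.
    (\<Prod>k\<in>{1..d}. V $ x k $ x' k) * (\<Prod>k\<in>{1..d}. cnj (V $ y k $ y' k)) * haar_kernel \<mu> d u v x' y')"
    unfolding haar_kernel_def
    by (subst Bochner_Integration.integral_sum, (rule haar_integrable, intro continuous_intros), rule sum.cong[OF refl],
        subst Bochner_Integration.integral_sum, (rule haar_integrable, intro continuous_intros), rule sum.cong[OF refl]) simp
  finally show ?thesis .
qed

end

text \<open>One-parameter groups of unitary matrices with generators \<open>\<i> v v\<^sup>*\<close> (up to a factor); the
  complex span of these generators is all of \<open>gl\<close>.\<close>

definition reflection :: "complex^'n \<Rightarrow> real \<Rightarrow> complex^'n^'n" where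
  "reflection v t = (\<chi> a b. (if a = b then 1 else 0) + (exp (t *\<^sub>R \<i>) - 1) / (\<Sum>j\<in>UNIV. v $ j * cnj (v $ j)) * (v $ a * cnj (v $ b)))"

text \<open>For a matrix \<open>1 + w P\<close>, with \<open>P\<close> the rank one matrix of
  entries \<open>v $ a * cnj (v $ b)\<close> and \<open>s\<close> the squared norm of
  \<open>v\<close>, unitarity means \<open>w + cnj w + w * cnj w * s = 0\<close>. As
  \<open>1 + w * s = exp (i t)\<close>, this says that \<open>exp (i t)\<close> has modulus
  1.\<close>

lemma reflection_unitary:
  assumes "v \<noteq> 0" shows "reflection v t \<in> unitary_group"
proof -
  define s where "s = (\<Sum>j\<in>UNIV. v $ j * cnj (v $ j))"
  have sr: "s = of_real (\<Sum>j\<in>UNIV. (norm (v $ j))\<^sup>2)"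
    by (simp add: s_def complex_norm_square del: of_real_power)
  obtain j where "v $ j \<noteq> 0" using assms by (auto simp: vec_eq_iff)
  then have "(\<Sum>j\<in>UNIV. (norm (v $ j))\<^sup>2) > 0" by (intro sum_pos2[of _ j]) auto
  then have s0: "s \<noteq> 0" unfolding sr of_real_eq_0_iff by linarith
  have cs: "cnj s = s" by (simp add: s_def mult.commute)
  define w where "w = (exp (t *\<^sub>R \<i>) - 1) / s"
  have ew: "exp (t *\<^sub>R \<i>) * cnj (exp (t *\<^sub>R \<i>)) = 1" by (simp add: exp_cnj flip: exp_add)
  have ww: "w + cnj w + w * cnj w * s = 0"
  proof -
    have "s * (w + cnj w + w * cnj w * s) = (exp (t *\<^sub>R \<i>) - 1) + (cnj (exp (t *\<^sub>R \<i>)) - 1) + (exp (t *\<^sub>R \<i>) - 1) * (cnj (exp (t *\<^sub>R \<i>)) - 1)"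
      using s0 by (simp add: w_def cs field_simps)
    also have "\<dots> = 0" using ew by (simp add: algebra_simps)
    finally show ?thesis using s0 by simp
  qed
  have e: "reflection v t $ a $ b = (if a = b then 1 else 0) + w * (v $ a * cnj (v $ b))" for a b
    by (simp add: reflection_def w_def s_def)
  have prod: "(\<Sum>k\<in>UNIV. ((if a = k then 1 else 0) + p * (v $ a * cnj (v $ k))) * ((if k = b then 1 else 0) + q * (v $ k * cnj (v $ b)))) =
     (if a = b then 1 else 0) + (p + q + p * q * s) * (v $ a * cnj (v $ b))" for a b p q
  proof -
    have "(\<Sum>k\<in>UNIV. ((if a = k then 1 else 0) + p * (v $ a * cnj (v $ k))) * ((if k = b then 1 else 0) + q * (v $ k * cnj (v $ b)))) =
      (\<Sum>k\<in>UNIV. (if a = k then (if k = b then 1 else 0) + q * (v $ k * cnj (v $ b)) else 0) +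
         (if k = b then p * (v $ a * cnj (v $ k)) else 0) + p * q * (v $ a * cnj (v $ b)) * (v $ k * cnj (v $ k)))"
      by (rule sum.cong[OF refl]) (auto simp: algebra_simps)
    also have "\<dots> = (if a = b then 1 else 0) + q * (v $ a * cnj (v $ b)) + p * (v $ a * cnj (v $ b)) + p * q * (v $ a * cnj (v $ b)) * s"
      by (simp add: sum.distrib s_def sum_distrib_left)
    finally show ?thesis by (simp add: algebra_simps)
  qed
  have adj: "adjoint_mat (reflection v t) $ a $ b = (if a = b then 1 else 0) + cnj w * (v $ a * cnj (v $ b))" for a b
    by (auto simp: adjoint_mat_def e)
  have "(\<Sum>k\<in>UNIV. reflection v t $ a $ k * adjoint_mat (reflection v t) $ k $ b) = (if a = b then 1 else 0)"
    "(\<Sum>k\<in>UNIV. adjoint_mat (reflection v t) $ a $ k * reflection v t $ k $ b) = (if a = b then 1 else 0)" for a b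
    unfolding e adj prod using ww by (simp_all add: algebra_simps)
  then show ?thesis by (simp add: unitary_group_def vec_eq_iff matrix_matrix_mult_def mat_def)
qed

section \<open>Differentiating left invariance at the identity\<close>

lemma has_vector_derivative_prod:
  fixes f :: "'i \<Rightarrow> real \<Rightarrow> 'b::real_normed_field"
  assumes "\<And>k. k \<in> I \<Longrightarrow> (f k has_vector_derivative f' k) (at t)"
  shows "((\<lambda>t. \<Prod>k\<in>I. f k t) has_vector_derivative (\<Sum>k\<in>I. f' k * (\<Prod>j\<in>I - {k}. f j t))) (at t)"
proof -
  have "((\<lambda>t. \<Prod>k\<in>I. f k t) has_derivative (\<lambda>h. \<Sum>k\<in>I. (h *\<^sub>R f' k) * (\<Prod>j\<in>I - {k}. f j t))) (at t)"
    using assms unfolding has_vector_derivative_def by (rule has_derivative_prod)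
  moreover have "(\<lambda>h. \<Sum>k\<in>I. (h *\<^sub>R f' k) * (\<Prod>j\<in>I - {k}. f j t)) = (\<lambda>h. h *\<^sub>R (\<Sum>k\<in>I. f' k * (\<Prod>j\<in>I - {k}. f j t)))"
    by (simp add: scaleR_sum_right)
  ultimately show ?thesis unfolding has_vector_derivative_def by simp
qed

lemma sum_words_agree:
  fixes g :: "(nat \<Rightarrow> 'n::finite) \<Rightarrow> complex"
  assumes "\<And>q. (\<forall>k\<in>{1..d}. q k = z k) \<Longrightarrow> g q = g z"
  shows "(\<Sum>q\<in>words d. agree d q z * g q) = g z"
proof -
  let ?z = "restrict z {1..d}"
  have z: "?z \<in> words d" by (simp add: words_def)
  have "(\<Sum>q\<in>words d. agree d q z * g q) = (\<Sum>q\<in>words d. if q = ?z then g z else 0)"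
  proof (rule sum.cong[OF refl])
    fix q :: "nat \<Rightarrow> 'n" assume q: "q \<in> words d"
    show "agree d q z * g q = (if q = ?z then g z else 0)"
    proof (cases "\<forall>k\<in>{1..d}. q k = z k")
      case True
      then have e1: "q = ?z" by (intro words_ext[OF q z]) simp
      have e2: "agree d q z = 1" unfolding agree_def by (rule if_P[OF True])
      show ?thesis unfolding e2 assms[OF True] mult_1_left if_P[OF e1] ..
    next
      case False
      then have "q \<noteq> ?z" by auto
      then show ?thesis using False by (simp only: agree_def if_False mult_zero_left)
    qed
  qed
  then show ?thesis using z by simp
qed

lemma prod_delta_agree:
  "finite S \<Longrightarrow> (\<Prod>j\<in>S. if x j = y j then 1 else 0) = (if \<forall>j\<in>S. x j = y j then 1 else (0::complex))"
  by (induction S rule: finite_induct) auto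

text \<open>Sums of this form come from the product rule at \<open>t = 0\<close>: all factors except
  the differentiated one are Kronecker deltas, so only the letter at place \<open>k\<close> remains
  free.\<close>

lemma sum_words_agree_except:
  fixes g :: "(nat \<Rightarrow> 'n::finite) \<Rightarrow> complex"
  assumes g: "\<And>q q'. (\<forall>k\<in>{1..d}. q k = q' k) \<Longrightarrow> g q = g q'" and k: "k \<in> {1..d}"
  shows "(\<Sum>q\<in>words d. X (q k) * (\<Prod>j\<in>{1..d} - {k}. if x j = q j then 1 else 0) * g q) = (\<Sum>a\<in>UNIV. X a * g (x(k := a)))"
proof -
  have "X (q k) * (\<Prod>j\<in>{1..d} - {k}. if x j = q j then 1 else 0) * g q = (\<Sum>a\<in>UNIV. agree d q (x(k := a)) * (X (q k) * g q))" for q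
  proof -
    have ag: "agree d q (x(k := a)) = (if a = q k then (\<Prod>j\<in>{1..d} - {k}. if x j = q j then 1 else 0) else 0)" for a
    proof -
      have "(\<forall>j\<in>{1..d}. q j = (x(k := a)) j) \<longleftrightarrow> a = q k \<and> (\<forall>j\<in>{1..d} - {k}. x j = q j)"
        using k by auto
      then show ?thesis unfolding agree_def by (subst prod_delta_agree) simp_all
    qed
    show ?thesis
      by (simp only: ag mult_delta_left sum.delta[OF finite_class.finite_UNIV] UNIV_I if_True) (simp only: mult_ac)
  qed
  then have "(\<Sum>q\<in>words d. X (q k) * (\<Prod>j\<in>{1..d} - {k}. if x j = q j then 1 else 0) * g q) =
      (\<Sum>a\<in>UNIV. \<Sum>q\<in>words d. agree d q (x(k := a)) * (X (q k) * g q))"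
    by (simp only: sum.swap[of _ UNIV])
  also have "\<dots> = (\<Sum>a\<in>UNIV. X a * g (x(k := a)))"
  proof (rule sum.cong[OF refl])
    fix a
    have "(\<Sum>q\<in>words d. agree d q (x(k := a)) * (X (q k) * g q)) = X ((x(k := a)) k) * g (x(k := a))"
    proof (rule sum_words_agree)
      fix q assume q: "\<forall>j\<in>{1..d}. q j = (x(k := a)) j"
      have "q k = a" using bspec[OF q k] by simp
      then show "X (q k) * g q = X ((x(k := a)) k) * g (x(k := a))" by (simp only: g[OF q] fun_upd_same)
    qed
    then show "(\<Sum>q\<in>words d. agree d q (x(k := a)) * (X (q k) * g q)) = X a * g (x(k := a))" by simp
  qed
  finally show ?thesis .
qed

lemma reflection_0: "reflection v 0 $ a $ b = (if a = b then 1 else 0)"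
  by (simp add: reflection_def)

lemma reflection_deriv:
  "((\<lambda>t. reflection v t $ a $ b) has_vector_derivative \<i> / (\<Sum>j\<in>UNIV. v $ j * cnj (v $ j)) * (v $ a * cnj (v $ b))) (at 0)"
proof -
  have "((\<lambda>t. exp (t *\<^sub>R \<i>)) has_vector_derivative \<i>) (at 0)"
    using exp_scaleR_has_vector_derivative_right[of \<i> 0] by simp
  then have "((\<lambda>t. (if a = b then 1 else 0) + (exp (t *\<^sub>R \<i>) - 1) * (v $ a * cnj (v $ b) / (\<Sum>j\<in>UNIV. v $ j * cnj (v $ j)))) has_vector_derivative
      0 + (\<i> - 0) * (v $ a * cnj (v $ b) / (\<Sum>j\<in>UNIV. v $ j * cnj (v $ j)))) (at 0)"
    by (intro has_vector_derivative_add has_vector_derivative_diff has_vector_derivative_const has_vector_derivative_mult_left)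
  then show ?thesis by (simp add: reflection_def)
qed

text \<open>Polarisation: the vectors \<open>e_p + w e_q\<close> with \<open>w\<close> equal to 0, 1
  and the imaginary unit suffice.\<close>

lemma hermitian_form_zero:
  fixes c :: "'n::finite \<Rightarrow> 'n \<Rightarrow> complex"
  assumes "\<And>v :: complex^'n. (\<Sum>a\<in>UNIV. \<Sum>b\<in>UNIV. v $ a * cnj (v $ b) * c a b) = 0"
  shows "c p q = 0"
proof -
  have main: "c p p + cnj w * c p q + w * c q p + w * cnj w * c q q = 0" for p q w
  proof -
    have b: "(\<Sum>b\<in>UNIV. cnj ((if b = p then 1 else 0) + w * (if b = q then 1 else 0)) * c a b) = c a p + cnj w * c a q" for a
    proof -
      have "(\<Sum>b\<in>UNIV. cnj ((if b = p then 1 else 0) + w * (if b = q then 1 else 0)) * c a b) =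
        (\<Sum>b\<in>UNIV. (if b = p then c a b else 0) + (if b = q then cnj w * c a b else 0))"
        by (rule sum.cong[OF refl]) (auto simp: algebra_simps)
      then show ?thesis by (simp add: sum.distrib)
    qed
    have "(\<Sum>a\<in>UNIV. ((if a = p then 1 else 0) + w * (if a = q then 1 else 0)) * (c a p + cnj w * c a q)) =
       (\<Sum>a\<in>UNIV. (if a = p then c a p + cnj w * c a q else 0) + (if a = q then w * (c a p + cnj w * c a q) else 0))"
      by (rule sum.cong[OF refl]) (auto simp: algebra_simps)
    also have "\<dots> = c p p + cnj w * c p q + w * c q p + w * cnj w * c q q"
      by (simp add: sum.distrib algebra_simps)
    finally have "c p p + cnj w * c p q + w * c q p + w * cnj w * c q q =
      (\<Sum>a\<in>UNIV. ((if a = p then 1 else 0) + w * (if a = q then 1 else 0)) * (\<Sum>b\<in>UNIV. cnj ((if b = p then 1 else 0) + w * (if b = q then 1 else 0)) * c a b))"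
      unfolding b by simp
    also have "\<dots> = 0"
      using assms[of "\<chi> i. (if i = p then 1 else 0) + w * (if i = q then 1 else 0)"]
      by (simp add: sum_distrib_left mult.assoc)
    finally show ?thesis .
  qed
  have diag: "c p p = 0" for p using main[of p 0 p] by simp
  have 1: "c p q + c q p = 0" using main[of p 1 q] diag by simp
  have "cnj \<i> * c p q + \<i> * c q p = 0" using main[of p \<i> q] diag by simp
  then have "\<i> * (c q p - c p q) = 0" by (simp add: algebra_simps)
  then have "c q p = c p q" by simp
  with 1 show ?thesis by simp
qed

context
  fixes \<mu> :: "(complex^'n^'n) measure"
  assumes haar: "haar_prob_measure \<mu>"
begin

interpretation prob_space \<mu> using haar by (simp add: haar_prob_measure_def)

text \<open>Along the one-parameter group \<open>reflection w\<close> the right side of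
  \<open>haar_kernel_expand\<close> is constant in \<open>t\<close>, so its derivative at 0
  vanishes. The product rule splits it into a part acting on \<open>x\<close> and a part acting on
  \<open>y\<close>.\<close>

lemma haar_kernel_derivative:
  fixes w :: "complex^'n"
  assumes "w \<noteq> 0"
  shows "(\<Sum>k\<in>{1..d}. \<Sum>a\<in>UNIV. w $ x k * cnj (w $ a) * haar_kernel \<mu> d u v (x(k := a)) y) =
    (\<Sum>k\<in>{1..d}. \<Sum>a\<in>UNIV. w $ a * cnj (w $ y k) * haar_kernel \<mu> d u v x (y(k := a)))"
proof -
  define M where "M = haar_kernel \<mu> d u v"
  have loc: "M x y = M x' y'" if "\<forall>k\<in>{1..d}. x k = x' k" "\<forall>k\<in>{1..d}. y k = y' k" for x x' y y'
    using that local_kernel_haar_kernel[OF haar, of d u v] unfolding M_def local_kernel_def by blast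
  define s where "s = (\<Sum>j\<in>UNIV. w $ j * cnj (w $ j))"
  have sr: "s = of_real (\<Sum>j\<in>UNIV. (norm (w $ j))\<^sup>2)"
    by (simp add: s_def complex_norm_square del: of_real_power)
  obtain j where "w $ j \<noteq> 0" using assms by (auto simp: vec_eq_iff)
  then have "(\<Sum>j\<in>UNIV. (norm (w $ j))\<^sup>2) > 0" by (intro sum_pos2[of _ j]) auto
  then have s0: "s \<noteq> 0" unfolding sr of_real_eq_0_iff by linarith
  have cs: "cnj s = s" by (simp add: s_def mult.commute)
  define X where "X a b = \<i> / s * (w $ a * cnj (w $ b))" for a b
  let ?\<delta> = "\<lambda>a b :: 'n. if a = b then 1 else 0 :: complex"
  define P where "P x' = (\<Sum>k\<in>{1..d}. X (x k) (x' k) * (\<Prod>j\<in>{1..d} - {k}. ?\<delta> (x j) (x' j)))" for x'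
  define Q where "Q y' = (\<Sum>k\<in>{1..d}. cnj (X (y k) (y' k)) * (\<Prod>j\<in>{1..d} - {k}. ?\<delta> (y j) (y' j)))" for y'
  have dP: "((\<lambda>t. \<Prod>k\<in>{1..d}. reflection w t $ x k $ x' k) has_vector_derivative P x') (at 0)" for x'
    using has_vector_derivative_prod[of "{1..d}" "\<lambda>k t. reflection w t $ x k $ x' k" "\<lambda>k. X (x k) (x' k)" 0] reflection_deriv[of w]
    by (simp add: X_def s_def P_def reflection_0)
  have dQ: "((\<lambda>t. \<Prod>k\<in>{1..d}. cnj (reflection w t $ y k $ y' k)) has_vector_derivative Q y') (at 0)" for y'
  proof -
    have c: "((\<lambda>t. cnj (reflection w t $ y k $ y' k)) has_vector_derivative cnj (X (y k) (y' k))) (at 0)" for k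
      using has_vector_derivative_cnj[OF reflection_deriv[of w "y k" "y' k"]] by (simp only: X_def s_def)
    have "cnj (?\<delta> a b) = ?\<delta> a b" for a b by simp
    then show ?thesis
      using has_vector_derivative_prod[of "{1..d}" "\<lambda>k t. cnj (reflection w t $ y k $ y' k)" "\<lambda>k. cnj (X (y k) (y' k))" 0, OF c]
      by (simp only: Q_def reflection_0)
  qed
  have "((\<lambda>t. \<Sum>x'\<in>words d. \<Sum>y'\<in>words d. (\<Prod>k\<in>{1..d}. reflection w t $ x k $ x' k) *
      (\<Prod>k\<in>{1..d}. cnj (reflection w t $ y k $ y' k)) * M x' y') has_vector_derivative
    (\<Sum>x'\<in>words d. \<Sum>y'\<in>words d. ((\<Prod>k\<in>{1..d}. reflection w 0 $ x k $ x' k) * Q y' +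
      P x' * (\<Prod>k\<in>{1..d}. cnj (reflection w 0 $ y k $ y' k))) * M x' y')) (at 0)"
    by (intro has_vector_derivative_sum has_vector_derivative_mult_left has_vector_derivative_mult dP dQ)
  moreover have "(\<lambda>t. \<Sum>x'\<in>words d. \<Sum>y'\<in>words d. (\<Prod>k\<in>{1..d}. reflection w t $ x k $ x' k) *
      (\<Prod>k\<in>{1..d}. cnj (reflection w t $ y k $ y' k)) * M x' y') = (\<lambda>t. M x y)"
    unfolding M_def using haar_kernel_expand[OF haar reflection_unitary[OF assms]] by metis
  ultimately have "((\<lambda>t. M x y) has_vector_derivative (\<Sum>x'\<in>words d. \<Sum>y'\<in>words d. ((\<Prod>k\<in>{1..d}. reflection w 0 $ x k $ x' k) * Q y' +
      P x' * (\<Prod>k\<in>{1..d}. cnj (reflection w 0 $ y k $ y' k))) * M x' y')) (at 0)"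
    by (simp only:)
  from vector_derivative_unique_at[OF this has_vector_derivative_const]
  have "(\<Sum>x'\<in>words d. \<Sum>y'\<in>words d. ((\<Prod>k\<in>{1..d}. reflection w 0 $ x k $ x' k) * Q y' +
      P x' * (\<Prod>k\<in>{1..d}. cnj (reflection w 0 $ y k $ y' k))) * M x' y') = 0" .
  moreover have "(\<Prod>k\<in>{1..d}. reflection w 0 $ x k $ x' k) = agree d x' x" for x'
    unfolding reflection_0 by (subst prod_delta_agree) (auto simp: agree_def)
  moreover have "(\<Prod>k\<in>{1..d}. cnj (reflection w 0 $ y k $ y' k)) = agree d y' y" for y'
    unfolding cnj_prod[symmetric] reflection_0 by (subst prod_delta_agree) (auto simp: agree_def)
  ultimately have "0 = (\<Sum>x'\<in>words d. \<Sum>y'\<in>words d. (agree d x' x * Q y' + P x' * agree d y' y) * M x' y')"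
    by simp
  also have "\<dots> = (\<Sum>x'\<in>words d. agree d x' x * (\<Sum>y'\<in>words d. Q y' * M x' y')) + (\<Sum>x'\<in>words d. P x' * (\<Sum>y'\<in>words d. agree d y' y * M x' y'))"
    by (simp add: algebra_simps sum.distrib sum_distrib_left)
  finally have sum0: "(\<Sum>x'\<in>words d. agree d x' x * (\<Sum>y'\<in>words d. Q y' * M x' y')) + (\<Sum>x'\<in>words d. P x' * (\<Sum>y'\<in>words d. agree d y' y * M x' y')) = 0"
    by (rule sym)
  have e1: "(\<Sum>x'\<in>words d. agree d x' x * (\<Sum>y'\<in>words d. Q y' * M x' y')) = (\<Sum>y'\<in>words d. Q y' * M x y')"
  proof (rule sum_words_agree, rule sum.cong[OF refl])
    fix q y' assume "\<forall>k\<in>{1..d}. q k = x k"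
    then have "M q y' = M x y'" using loc by blast
    then show "Q y' * M q y' = Q y' * M x y'" by simp
  qed
  have e2: "(\<Sum>y'\<in>words d. agree d y' y * M x' y') = M x' y" for x'
    by (rule sum_words_agree) (use loc in blast)
  have "(\<Sum>x'\<in>words d. P x' * M x' y) = (\<Sum>k\<in>{1..d}. \<Sum>x'\<in>words d. X (x k) (x' k) * (\<Prod>j\<in>{1..d} - {k}. ?\<delta> (x j) (x' j)) * M x' y)"
    unfolding P_def sum_distrib_right by (rule sum.swap)
  also have "\<dots> = (\<Sum>k\<in>{1..d}. \<Sum>a\<in>UNIV. X (x k) a * M (x(k := a)) y)"
    by (rule sum.cong[OF refl], rule sum_words_agree_except) (use loc in blast)+
  also have "\<dots> = (\<i> / s) * (\<Sum>k\<in>{1..d}. \<Sum>a\<in>UNIV. w $ x k * cnj (w $ a) * M (x(k := a)) y)"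
    by (simp add: X_def sum_distrib_left mult_ac)
  finally have e3: "(\<Sum>x'\<in>words d. P x' * M x' y) = (\<i> / s) * (\<Sum>k\<in>{1..d}. \<Sum>a\<in>UNIV. w $ x k * cnj (w $ a) * M (x(k := a)) y)" .
  have "(\<Sum>y'\<in>words d. Q y' * M x y') = (\<Sum>k\<in>{1..d}. \<Sum>x'\<in>words d. cnj (X (y k) (x' k)) * (\<Prod>j\<in>{1..d} - {k}. ?\<delta> (y j) (x' j)) * M x x')"
    unfolding Q_def sum_distrib_right by (rule sum.swap)
  also have "\<dots> = (\<Sum>k\<in>{1..d}. \<Sum>a\<in>UNIV. cnj (X (y k) a) * M x (y(k := a)))"
    by (rule sum.cong[OF refl], rule sum_words_agree_except) (use loc in blast)+
  \<comment> \<open>As \<open>s\<close> is real, conjugating the factor \<open>\<i> / s\<close>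
    changes its sign; this puts the two parts on opposite sides of the final equation.\<close>
  also have "\<dots> = - (\<i> / s) * (\<Sum>k\<in>{1..d}. \<Sum>a\<in>UNIV. w $ a * cnj (w $ y k) * M x (y(k := a)))"
    by (simp add: X_def cs sum_distrib_left mult_ac sum_negf)
  finally have e4: "(\<Sum>y'\<in>words d. Q y' * M x y') = - (\<i> / s) * (\<Sum>k\<in>{1..d}. \<Sum>a\<in>UNIV. w $ a * cnj (w $ y k) * M x (y(k := a)))" .
  have "(\<i> / s) * ((\<Sum>k\<in>{1..d}. \<Sum>a\<in>UNIV. w $ x k * cnj (w $ a) * M (x(k := a)) y) -
     (\<Sum>k\<in>{1..d}. \<Sum>a\<in>UNIV. w $ a * cnj (w $ y k) * M x (y(k := a)))) = 0"
    using sum0 unfolding e1 e2 e3 e4 by (simp add: right_diff_distrib)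
  then show ?thesis using s0 unfolding M_def by simp
qed

text \<open>The derivative identity says that the sesquilinear form of the defect \<open>c\<close>
  vanishes at every vector; by polarisation \<open>c\<close> is zero, which is invariance under each
  elementary matrix.\<close>

lemma gl_invariant_haar_kernel: "gl_invariant d (haar_kernel \<mu> d u v)"
  unfolding gl_invariant_def
proof (intro allI)
  fix p q :: 'n and x y
  let ?M = "haar_kernel \<mu> d u v"
  define c where "c a b = (\<Sum>k\<in>{1..d}. if x k = a then ?M (x(k := b)) y else 0) -
     (\<Sum>k\<in>{1..d}. if y k = b then ?M x (y(k := a)) else 0)" for a b
  have "(\<Sum>a\<in>UNIV. \<Sum>b\<in>UNIV. w $ a * cnj (w $ b) * c a b) = 0" for w :: "complex^'n"
  proof (cases "w = 0")
    case False
    have "(\<Sum>a\<in>UNIV. \<Sum>b\<in>UNIV. w $ a * cnj (w $ b) * (\<Sum>k\<in>{1..d}. if x k = a then ?M (x(k := b)) y else 0)) =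
      (\<Sum>k\<in>{1..d}. \<Sum>b\<in>UNIV. \<Sum>a\<in>UNIV. w $ a * cnj (w $ b) * (if x k = a then ?M (x(k := b)) y else 0))"
    proof -
      have "(\<Sum>a\<in>UNIV. \<Sum>b\<in>UNIV. \<Sum>k\<in>{1..d}. h a b k) = (\<Sum>k\<in>{1..d}. \<Sum>b\<in>UNIV. \<Sum>a\<in>UNIV. h a b k)"
        for h :: "'n \<Rightarrow> 'n \<Rightarrow> nat \<Rightarrow> complex"
      proof -
        have "(\<Sum>a\<in>UNIV. \<Sum>b\<in>UNIV. \<Sum>k\<in>{1..d}. h a b k) = (\<Sum>b\<in>UNIV. \<Sum>a\<in>UNIV. \<Sum>k\<in>{1..d}. h a b k)"
          by (rule sum.swap)
        also have "\<dots> = (\<Sum>b\<in>UNIV. \<Sum>k\<in>{1..d}. \<Sum>a\<in>UNIV. h a b k)"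
          by (rule sum.cong[OF refl], rule sum.swap)
        also have "\<dots> = (\<Sum>k\<in>{1..d}. \<Sum>b\<in>UNIV. \<Sum>a\<in>UNIV. h a b k)" by (rule sum.swap)
        finally show ?thesis .
      qed
      then show ?thesis unfolding sum_distrib_left .
    qed
    also have "\<dots> = (\<Sum>k\<in>{1..d}. \<Sum>b\<in>UNIV. w $ x k * cnj (w $ b) * ?M (x(k := b)) y)"
      by (simp add: mult_delta_right)
    finally have 1: "(\<Sum>a\<in>UNIV. \<Sum>b\<in>UNIV. w $ a * cnj (w $ b) * (\<Sum>k\<in>{1..d}. if x k = a then ?M (x(k := b)) y else 0)) =
        (\<Sum>k\<in>{1..d}. \<Sum>b\<in>UNIV. w $ x k * cnj (w $ b) * ?M (x(k := b)) y)" .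
    have "(\<Sum>a\<in>UNIV. \<Sum>b\<in>UNIV. w $ a * cnj (w $ b) * (\<Sum>k\<in>{1..d}. if y k = b then ?M x (y(k := a)) else 0)) =
      (\<Sum>a\<in>UNIV. \<Sum>k\<in>{1..d}. \<Sum>b\<in>UNIV. w $ a * cnj (w $ b) * (if y k = b then ?M x (y(k := a)) else 0))"
      unfolding sum_distrib_left by (rule sum.cong[OF refl], rule sum.swap)
    also have "\<dots> = (\<Sum>a\<in>UNIV. \<Sum>k\<in>{1..d}. w $ a * cnj (w $ y k) * ?M x (y(k := a)))"
      by (simp add: mult_delta_right)
    also have "\<dots> = (\<Sum>k\<in>{1..d}. \<Sum>a\<in>UNIV. w $ a * cnj (w $ y k) * ?M x (y(k := a)))" by (rule sum.swap)
    finally show ?thesis using haar_kernel_derivative[OF False, where d = d and x = x and u = u and v = v and y = y] 1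
      by (simp add: c_def right_diff_distrib sum_subtractf)
  qed simp
  then have "c p q = 0" by (rule hermitian_form_zero)
  then show "(\<Sum>k\<in>{1..d}. if x k = p then ?M (x(k := q)) y else 0) = (\<Sum>k\<in>{1..d}. if y k = q then ?M x (y(k := p)) else 0)"
    by (simp add: c_def)
qed

lemma haar_kernel_weingarten:
  "haar_kernel \<mu> d u v x y = (\<Sum>\<tau>\<in>perms d. \<Sum>\<sigma>\<in>perms d. weingarten CARD('n) d (inv \<sigma> \<circ> \<tau>) * agree d u (v \<circ> \<sigma>) * agree d x (y \<circ> \<tau>))"
  using weingarten_formula[OF gl_invariant_haar_kernel local_kernel_haar_kernel[OF haar] haar_kernel_trace[OF haar], of d u v x y]
  by (simp add: sum_distrib_left sum_distrib_right mult_ac)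

end

section \<open>Power sums as traces on tensor powers\<close>

fun mat_pow :: "complex^'n^'n \<Rightarrow> nat \<Rightarrow> complex^'n^'n" where
  "mat_pow A 0 = mat 1"
| "mat_pow A (Suc m) = mat_pow A m ** A"

lemma mat_pow_commute: "A ** mat_pow A m = mat_pow A m ** A"
proof (induction m)
  case (Suc m)
  have "A ** (mat_pow A m ** A) = (A ** mat_pow A m) ** A" by (rule matrix_mul_assoc)
  then show ?case by (simp add: Suc)
qed (simp add: matrix_mul_lid matrix_mul_rid)

lemma mat_mult_left: "(mat r ** M) $ i $ j = r * M $ i $ j" for M :: "complex^'n^'n"
  by (simp add: matrix_matrix_mult_def mat_def mult_delta_left)

lemma mat_comm: "mat r ** M = M ** mat r" for M :: "complex^'n^'n"
  by (simp add: vec_eq_iff mat_mult_left) (simp add: matrix_matrix_mult_def mat_def mult_delta_right mult.commute)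

lemma mat_mult_mat: "mat r ** mat s = (mat (r * s) :: complex^'n^'n)"
  by (simp add: vec_eq_iff mat_mult_left) (simp add: mat_def)

lemma det_mat_scalar: "det (mat r :: complex^'n^'n) = r ^ CARD('n)"
  by (subst det_diagonal) (simp_all add: mat_def)

text \<open>Horner evaluation of a polynomial at a matrix. It serves a spectral mapping theorem with
  multiplicities, stated for determinants.\<close>

definition poly_mat :: "complex^'n^'n \<Rightarrow> complex poly \<Rightarrow> complex^'n^'n" where
  "poly_mat A p = fold_coeffs (\<lambda>c M. mat c + A ** M) p 0"

lemma matrix_mul_zero_right: "A ** 0 = (0 :: complex^'n^'n)"
  by (simp add: vec_eq_iff matrix_matrix_mult_def)

lemma poly_mat_0 [simp]: "poly_mat A 0 = 0"
  by (simp add: poly_mat_def)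

lemma mat_0: "mat 0 = (0 :: complex^'n^'n)"
  by (simp add: vec_eq_iff mat_def)

lemma mat_add: "mat (a + b) = mat a + (mat b :: complex^'n^'n)"
  by (simp add: vec_eq_iff mat_def)

lemma poly_mat_pCons: "poly_mat A (pCons c p) = mat c + A ** poly_mat A p"
  by (cases "c = 0 \<and> p = 0") (auto simp: poly_mat_def mat_0 matrix_mul_zero_right)

lemma poly_mat_add: "poly_mat A (p + q) = poly_mat A p + poly_mat A q"
  by (induction p q rule: poly_induct2) (simp_all add: poly_mat_pCons mat_add matrix_add_ldistrib)

lemma poly_mat_smult: "poly_mat A (smult r p) = mat r ** poly_mat A p"
proof (induction p)
  case (pCons a p)
  have "A ** (mat r ** poly_mat A p) = mat r ** (A ** poly_mat A p)"
    by (metis matrix_mul_assoc mat_comm)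
  then show ?case by (simp add: poly_mat_pCons pCons mat_mult_mat matrix_add_ldistrib)
qed (simp add: matrix_mul_zero_right)

lemma poly_mat_mult_linear:
  fixes A :: "complex^'n^'n"
  shows "poly_mat A ([:r, -1:] * q) = (mat r - A) ** poly_mat A q"
proof -
  have "poly_mat A (smult (-1) q) = - poly_mat A q"
    by (simp only: poly_mat_smult vec_eq_iff mat_mult_left) simp
  moreover have "A ** (- M) = - (A ** M)" for M :: "complex^'n^'n"
    by (simp add: vec_eq_iff matrix_matrix_mult_def sum_negf)
  moreover have "(mat r - A) ** M = mat r ** M - A ** M" for M :: "complex^'n^'n"
    by (simp add: vec_eq_iff matrix_matrix_mult_def algebra_simps sum_subtractf)
  moreover have "[:r, -1:] * q = smult r q + pCons 0 (smult (-1) q)" by simp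
  ultimately show ?thesis by (simp only: poly_mat_add poly_mat_smult[of A r] poly_mat_pCons mat_0) simp
qed

lemma poly_mat_monom: "poly_mat A (monom c m) = mat c ** mat_pow A m"
proof (induction m)
  case (Suc m)
  have "A ** (mat c ** mat_pow A m) = mat c ** (mat_pow A m ** A)"
    by (metis matrix_mul_assoc mat_comm mat_pow_commute)
  then show ?case by (simp add: monom_Suc poly_mat_pCons mat_0 Suc)
qed (simp add: monom_0 poly_mat_pCons matrix_mul_zero_right matrix_mul_rid)

text \<open>Over the complex numbers a polynomial splits into linear factors, and the determinant of
  each linear factor at \<open>A\<close> is a value of the characteristic polynomial.\<close>

lemma det_poly_mat:
  fixes A :: "complex^'n^'n"
  assumes "has_eigenvalues A a"
  shows "det (poly_mat A p) = (\<Prod>i\<in>UNIV. poly p (a $ i))"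
proof (induction "degree p" arbitrary: p)
  case 0
  then obtain c where "p = [:c:]" using degree_eq_zeroE by metis
  then show ?case by (simp add: poly_mat_pCons matrix_mul_zero_right det_mat_scalar)
next
  case (Suc n)
  then have "\<not> constant (poly p)" by (simp add: constant_degree)
  then obtain r where "poly p r = 0" using fundamental_theorem_of_algebra by blast
  then obtain q where q: "p = [:- r, 1:] * q" unfolding poly_eq_0_iff_dvd by (auto elim: dvdE)
  \<comment> \<open>The sign is moved into the cofactor, so that the linear factor at
    \<open>A\<close> is \<open>mat r - A\<close>, as in \<open>has_eigenvalues\<close>.\<close>
  then have p: "p = [:r, -1:] * (- q)" by simp
  have q0: "q \<noteq> 0" using q Suc(2) by auto
  have "degree p = Suc (degree q)" unfolding q using q0 by (subst degree_mult_eq) auto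
  then have "n = degree (- q)" using Suc(2) by simp
  from Suc(1)[OF this] have "det (poly_mat A (- q)) = (\<Prod>i\<in>UNIV. poly (- q) (a $ i))" .
  moreover have "det (mat r - A) = (\<Prod>i\<in>UNIV. r - a $ i)" using assms by (simp add: has_eigenvalues_def)
  ultimately show ?case unfolding p by (simp only: poly_mat_mult_linear det_mul) (simp add: prod.distrib[symmetric] algebra_simps)
qed

lemma has_eigenvalues_mat_pow:
  fixes A :: "complex^'n^'n"
  assumes "has_eigenvalues A a"
  shows "has_eigenvalues (mat_pow A m) (\<chi> i. (a $ i) ^ m)"
  unfolding has_eigenvalues_def
proof
  fix x
  have "poly_mat A ([:x:] + monom (-1) m) = mat x - mat_pow A m"
    by (simp add: poly_mat_add poly_mat_pCons matrix_mul_zero_right poly_mat_monom vec_eq_iff mat_mult_left)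
  then show "det (mat x - mat_pow A m) = (\<Prod>i\<in>UNIV. x - (\<chi> i. (a $ i) ^ m) $ i)"
    using det_poly_mat[OF assms, of "[:x:] + monom (-1) m"] by (simp add: poly_monom)
qed

text \<open>Both sides are minus the derivative at \<open>t = 0\<close> of
  \<open>det (1 - t C)\<close>, which is the product of the factors
  \<open>1 - t c_i\<close>.\<close>

lemma trace_eigenvalues:
  fixes C :: "complex^'n^'n"
  assumes "has_eigenvalues C c"
  shows "trace C = (\<Sum>i\<in>UNIV. c $ i)"
proof -
  have det: "det (\<chi> i j. (if i = j then 1 else 0) - complex_of_real t * C $ i $ j) = (\<Prod>i\<in>UNIV. 1 - complex_of_real t * c $ i)" for t
  proof (cases "t = 0")
    case True
    have "(\<chi> i j. if i = j then 1 else 0) = (mat 1 :: complex^'n^'n)" by (simp add: mat_def)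
    then show ?thesis using True by (simp add: det_mat_scalar)
  next
    case False
    have "(\<chi> i j. (if i = j then 1 else 0) - complex_of_real t * C $ i $ j) = mat (of_real t) ** (mat (1 / of_real t) - C)"
      using False by (simp add: vec_eq_iff mat_mult_left algebra_simps) (simp add: mat_def)
    then have "det (\<chi> i j. (if i = j then 1 else 0) - complex_of_real t * C $ i $ j) = of_real t ^ CARD('n) * (\<Prod>i\<in>UNIV. 1 / of_real t - c $ i)"
      using assms by (simp add: det_mul det_mat_scalar has_eigenvalues_def)
    also have "\<dots> = (\<Prod>i\<in>UNIV. of_real t * (1 / of_real t - c $ i))" by (simp add: prod.distrib)
    also have "\<dots> = (\<Prod>i\<in>UNIV. 1 - of_real t * c $ i)"
      using False by (intro prod.cong refl) (simp add: right_diff_distrib)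
    finally show ?thesis .
  qed
  have d1: "((\<lambda>t. b - complex_of_real t * e) has_vector_derivative - e) (at t)" for b e t
  proof -
    have "((\<lambda>t. b - t *\<^sub>R e) has_vector_derivative 0 - 1 *\<^sub>R e) (at t)"
      by (intro has_vector_derivative_diff has_vector_derivative_const has_vector_derivative_scaleR[THEN has_vector_derivative_eq_rhs])
        (auto intro!: derivative_eq_intros)
    then show ?thesis by (simp add: scaleR_conv_of_real)
  qed
  have L: "((\<lambda>t. det (\<chi> i j. (if i = j then 1 else 0) - complex_of_real t * C $ i $ j)) has_vector_derivative
      (\<Sum>p | p permutes (UNIV::'n set). of_int (sign p) * (\<Sum>i\<in>UNIV. - (C $ i $ p i) * (\<Prod>j\<in>UNIV - {i}. (if j = p j then 1 else 0) - complex_of_real 0 * C $ j $ p j)))) (at 0)"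
    unfolding det_def by (simp only: vec_lambda_beta)
      (intro has_vector_derivative_sum has_vector_derivative_mult_right has_vector_derivative_prod d1)
  have R: "((\<lambda>t. \<Prod>i\<in>UNIV. 1 - complex_of_real t * c $ i) has_vector_derivative
      (\<Sum>i\<in>UNIV. - (c $ i) * (\<Prod>j\<in>UNIV - {i}. 1 - complex_of_real 0 * c $ j))) (at 0)"
    by (intro has_vector_derivative_prod d1)
  have "(\<Sum>p | p permutes (UNIV::'n set). of_int (sign p) * (\<Sum>i\<in>UNIV. - (C $ i $ p i) * (\<Prod>j\<in>UNIV - {i}. (if j = p j then 1 else 0) - complex_of_real 0 * C $ j $ p j)))
     = (\<Sum>p | p permutes (UNIV::'n set). if p = id then - trace C else 0)"
  proof (rule sum.cong[OF refl])
    fix p assume "p \<in> {p. p permutes (UNIV::'n set)}"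
    then have bij: "inj p" by (simp add: permutes_inj)
    show "of_int (sign p) * (\<Sum>i\<in>UNIV. - (C $ i $ p i) * (\<Prod>j\<in>UNIV - {i}. (if j = p j then 1 else 0) - complex_of_real 0 * C $ j $ p j)) = (if p = id then - trace C else 0)"
    proof (cases "p = id")
      case False
      \<comment> \<open>A permutation other than the identity moves both \<open>k\<close> and
        \<open>p k\<close>. The product rule omits one factor, so at least one vanishing factor
        remains.\<close>
      then obtain k where k: "p k \<noteq> k" by (auto simp: fun_eq_iff)
      then have k': "p (p k) \<noteq> p k" using injD[OF bij, of "p k" k] by auto
      have "(\<Prod>j\<in>UNIV - {i}. (if j = p j then 1 else 0) - complex_of_real 0 * C $ j $ p j) = 0" for i
      proof (rule prod_zero)
        show "\<exists>j\<in>UNIV - {i}. (if j = p j then 1 else 0) - complex_of_real 0 * C $ j $ p j = 0"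
        proof (cases "k = i")
          case True
          then show ?thesis using k k' by (intro bexI[of _ "p k"]) auto
        next
          case False
          then show ?thesis using k by (intro bexI[of _ k]) auto
        qed
      qed simp
      then show ?thesis using False by (simp only: mult_zero_right sum.neutral_const if_False)
    qed (simp add: trace_def sum_negf)
  qed
  also have "\<dots> = - trace C" by (simp add: permutes_id)
  finally have "(\<Sum>i\<in>UNIV. - (c $ i) * (\<Prod>j\<in>UNIV - {i}. 1 - complex_of_real 0 * c $ j)) = - trace C"
    using vector_derivative_unique_at[OF L[unfolded det] R] by (simp only:)
  then show ?thesis by (simp add: sum_negf)
qed

section \<open>Traces on tensor powers as products over cycles\<close>

lemma prod_sum_words: "(\<Prod>k\<in>{1..d}. \<Sum>a\<in>(UNIV::'n::finite set). f k a) = (\<Sum>x\<in>words d. \<Prod>k\<in>{1..d}. f k (x k) :: complex)"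
  unfolding words_def by (subst prod_sum_PiE) auto

text \<open>An entry of a power is a sum over paths. The inner vertices occupy the places 1 to
  \<open>m\<close> of a word, so the fixed end points are stored at the places 0 and
  \<open>Suc m\<close>.\<close>

lemma mat_pow_paths:
  fixes A :: "complex^'n^'n"
  shows "mat_pow A (Suc m) $ a $ c = (\<Sum>y\<in>words m. \<Prod>i<Suc m. A $ ((y(0 := a, Suc m := c)) i) $ ((y(0 := a, Suc m := c)) (Suc i)))"
proof (induction m arbitrary: c)
  case 0
  have "words 0 = {\<lambda>_. undefined :: 'n}" by (simp add: words_def)
  then show ?case by (simp add: matrix_mul_lid)
next
  case (Suc m)
  have "mat_pow A (Suc (Suc m)) $ a $ c = (\<Sum>e\<in>UNIV. mat_pow A (Suc m) $ a $ e * A $ e $ c)"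
    unfolding mat_pow.simps(2)[of A "Suc m"] by (simp only: matrix_matrix_mult_def vec_lambda_beta)
  also have "\<dots> = (\<Sum>e\<in>UNIV. \<Sum>y\<in>words m. (\<Prod>i<Suc m. A $ ((y(0 := a, Suc m := e)) i) $ ((y(0 := a, Suc m := e)) (Suc i))) * A $ e $ c)"
    by (simp only: Suc sum_distrib_right)
  also have "\<dots> = (\<Sum>y\<in>words m. \<Sum>e\<in>UNIV. (\<Prod>i<Suc m. A $ ((y(0 := a, Suc m := e)) i) $ ((y(0 := a, Suc m := e)) (Suc i))) * A $ e $ c)"
    by (rule sum.swap)
  also have "\<dots> = (\<Sum>y\<in>words (Suc m). \<Prod>i<Suc (Suc m). A $ ((y(0 := a, Suc (Suc m) := c)) i) $ ((y(0 := a, Suc (Suc m) := c)) (Suc i)))"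
    unfolding sum_words_Suc
  proof (intro sum.cong refl)
    fix y :: "nat \<Rightarrow> 'n" and e
    have "(\<Prod>i<Suc m. A $ ((y(0 := a, Suc m := e)) i) $ ((y(0 := a, Suc m := e)) (Suc i))) =
      (\<Prod>i<Suc m. A $ ((y(Suc m := e, 0 := a, Suc (Suc m) := c)) i) $ ((y(Suc m := e, 0 := a, Suc (Suc m) := c)) (Suc i)))"
      by (rule prod.cong) auto
    then show "(\<Prod>i<Suc m. A $ ((y(0 := a, Suc m := e)) i) $ ((y(0 := a, Suc m := e)) (Suc i))) * A $ e $ c =
      (\<Prod>i<Suc (Suc m). A $ ((y(Suc m := e, 0 := a, Suc (Suc m) := c)) i) $ ((y(Suc m := e, 0 := a, Suc (Suc m) := c)) (Suc i)))"
      by (subst prod.lessThan_Suc) simp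
  qed
  finally show ?case .
qed

text \<open>Walking along the orbit from \<open>b\<close> turns a labelling of its points into a
  closed path: the label of \<open>b\<close> is the common end point, the labels of the later points
  are the inner vertices.\<close>

lemma trace_mat_pow_orbit:
  fixes A :: "complex^'n^'n"
  assumes p: "permutation p"
  shows "(\<Sum>x\<in>orbit p b \<rightarrow>\<^sub>E UNIV. \<Prod>k\<in>orbit p b. A $ x k $ x (p k)) = trace (mat_pow A (card (orbit p b)))"
proof -
  define Z where "Z = orbit p b"
  obtain m where m: "card Z = Suc m" using card_orbit_pos[OF p, of b] unfolding Z_def by (metis gr0_implies_Suc)
  define \<beta> where "\<beta> i = (p ^^ i) b" for i
  have bij: "bij_betw \<beta> {..<Suc m} Z" using bij_betw_orbit[OF p, of b] unfolding \<beta>_def Z_def[symmetric] m .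
  have \<beta>Z: "\<beta> i \<in> Z" for i unfolding \<beta>_def Z_def by (rule funpow_in_orbit[OF permutation_self_in_orbit[OF p]])
  have \<beta>0: "\<beta> 0 = b" by (simp add: \<beta>_def)
  have \<beta>m: "\<beta> (Suc m) = b" using funpow_card_orbit[OF p, of b] unfolding Z_def[symmetric] m \<beta>_def .
  have p\<beta>: "p (\<beta> i) = \<beta> (Suc i)" for i by (simp add: \<beta>_def)
  define g where "g = inv_into {..<Suc m} \<beta>"
  have g1: "g (\<beta> i) = i" if "i < Suc m" for i using bij_betw_inv_into_left[OF bij, of i] that by (simp add: g_def)
  have g2: "\<beta> (g k) = k" "g k < Suc m" if "k \<in> Z" for k
    using bij_betw_inv_into_right[OF bij that] bij_betwE[OF bij_betw_inv_into[OF bij]] that by (auto simp: g_def)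
  let ?j = "\<lambda>x :: _ \<Rightarrow> 'n. (x b, \<lambda>i\<in>{1..m}. x (\<beta> i))"
  let ?v = "\<lambda>ay :: 'n \<times> (nat \<Rightarrow> 'n). (snd ay)(0 := fst ay, Suc m := fst ay)"
  let ?w = "\<lambda>x. ?v (?j x)"
  have "(\<Sum>x\<in>Z \<rightarrow>\<^sub>E UNIV. \<Prod>k\<in>Z. A $ x k $ x (p k)) = (\<Sum>x\<in>Z \<rightarrow>\<^sub>E UNIV. \<Prod>i<Suc m. A $ x (\<beta> i) $ x (\<beta> (Suc i)))"
    by (simp only: prod.reindex_bij_betw[OF bij, symmetric] p\<beta>)
  also have "\<dots> = (\<Sum>ay\<in>UNIV \<times> words m. \<Prod>i<Suc m. A $ (?v ay i) $ (?v ay (Suc i)))"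
  proof (rule sum.reindex_bij_witness[where j = ?j
        and i = "\<lambda>ay. \<lambda>k\<in>Z. ((snd ay)(0 := fst ay)) (g k)"])
    fix x :: "_ \<Rightarrow> 'n" assume x: "x \<in> Z \<rightarrow>\<^sub>E UNIV"
    have e: "((\<lambda>i\<in>{1..m}. x (\<beta> i))(0 := x b)) i = x (\<beta> i)" if "i < Suc m" for i
      using that \<beta>0 by auto
    show "(\<lambda>k\<in>Z. ((snd (?j x))(0 := fst (?j x))) (g k)) = x"
    proof
      fix k show "(\<lambda>k\<in>Z. ((snd (?j x))(0 := fst (?j x))) (g k)) k = x k"
        using x e[of "g k"] g2[of k] by (cases "k \<in> Z") (auto simp del: fun_upd_apply)
    qed
    show "?j x \<in> UNIV \<times> words m" by (simp add: words_def)
    show "(\<Prod>i<Suc m. A $ (?w x i) $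
       (?w x (Suc i))) =
       (\<Prod>i<Suc m. A $ x (\<beta> i) $ x (\<beta> (Suc i)))"
    proof (rule prod.cong[OF refl])
      fix i assume "i \<in> {..<Suc m}"
      then have i: "i < Suc m" by simp
      have "((\<lambda>i\<in>{1..m}. x (\<beta> i))(0 := x b, Suc m := x b)) j = x (\<beta> j)" if "j \<le> Suc m" for j
        using that \<beta>0 \<beta>m by (cases "j = Suc m") (auto simp: le_Suc_eq)
      then show "A $ (?w x i) $
       (?w x (Suc i)) = A $ x (\<beta> i) $ x (\<beta> (Suc i))"
        using i by (simp only: fst_conv snd_conv less_imp_le Suc_leI)
    qed
  next
    fix ay :: "'n \<times> (nat \<Rightarrow> 'n)" assume ay: "ay \<in> UNIV \<times> words m"
    obtain a y where [simp]: "ay = (a, y)" by (cases ay)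
    have y: "y \<in> words m" using ay by simp
    have bZ: "b \<in> Z" using \<beta>Z[of 0] \<beta>0 by simp
    have gb: "g b = 0" using g1[of 0] \<beta>0 by simp
    have "(\<lambda>i\<in>{1..m}. (\<lambda>k\<in>Z. (y(0 := a)) (g k)) (\<beta> i)) = y"
      by (rule words_ext[OF _ y]) (auto simp: words_def \<beta>Z g1)
    then show "((\<lambda>k\<in>Z. ((snd ay)(0 := fst ay)) (g k)) b, \<lambda>i\<in>{1..m}. (\<lambda>k\<in>Z. ((snd ay)(0 := fst ay)) (g k)) (\<beta> i)) = ay"
      using bZ gb by simp
    show "(\<lambda>k\<in>Z. ((snd ay)(0 := fst ay)) (g k)) \<in> Z \<rightarrow>\<^sub>E UNIV" by simp
  qed
  also have "\<dots> = (\<Sum>a\<in>UNIV. mat_pow A (Suc m) $ a $ a)"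
    unfolding mat_pow_paths by (simp only: sum.cartesian_product case_prod_unfold)
  finally show ?thesis unfolding Z_def[symmetric] m by (simp only: trace_def)
qed

text \<open>A word is the same as a family of labellings of the orbits, and no factor of the product
  links two different orbits; hence the sum over words factorises.\<close>

lemma tensor_trace_orbits:
  fixes A :: "complex^'n^'n"
  assumes p: "p \<in> perms d"
  shows "tensor_trace A d p = (\<Prod>Z\<in>orbit p ` {1..d}. trace (mat_pow A (card Z)))"
proof -
  note pp = perms_permutation[OF p]
  define C where "C = orbit p ` {1..d}"
  have fC: "finite C" by (simp add: C_def)
  have U: "\<Union>C = {1..d}" and disj: "disjoint C" using orbits_partition[OF p] by (simp_all add: C_def)
  have orb: "orbit p k \<in> C" "k \<in> orbit p k" if "k \<in> {1..d}" for k
    using that permutation_self_in_orbit[OF pp] by (simp_all add: C_def)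
  have orbZ: "orbit p k = Z" if "Z \<in> C" "k \<in> Z" for k Z using that orbit_eq[OF pp] by (auto simp: C_def)
  have fZ: "finite Z" if "Z \<in> C" for Z using that U fC by (metis Union_upper finite_atLeastAtMost finite_subset)
  have pZ: "p k \<in> Z" if "Z \<in> C" "k \<in> Z" for k Z using that by (auto simp: C_def intro: orbit.step)
  have "(\<Prod>Z\<in>C. trace (mat_pow A (card Z))) = (\<Prod>Z\<in>C. \<Sum>x\<in>Z \<rightarrow>\<^sub>E UNIV. \<Prod>k\<in>Z. A $ x k $ x (p k))"
    by (rule prod.cong[OF refl]) (auto simp: C_def trace_mat_pow_orbit[OF pp])
  also have "\<dots> = (\<Sum>g\<in>(\<Pi>\<^sub>E Z\<in>C. Z \<rightarrow>\<^sub>E UNIV). \<Prod>Z\<in>C. \<Prod>k\<in>Z. A $ g Z k $ g Z (p k))"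
    by (rule prod_sum_PiE[OF fC]) (simp add: fZ finite_PiE)
  also have "\<dots> = (\<Sum>x\<in>words d. \<Prod>k\<in>{1..d}. A $ x k $ x (p k))"
  proof (rule sum.reindex_bij_witness[where j = "\<lambda>g. \<lambda>k\<in>{1..d}. g (orbit p k) k" and i = "\<lambda>x. \<lambda>Z\<in>C. restrict x Z"])
    fix g :: "nat set \<Rightarrow> nat \<Rightarrow> 'n" assume g: "g \<in> (\<Pi>\<^sub>E Z\<in>C. Z \<rightarrow>\<^sub>E UNIV)"
    have val: "(\<lambda>k\<in>{1..d}. g (orbit p k) k) k = g Z k" if "Z \<in> C" "k \<in> Z" for Z k
      using that U orbZ[OF that] by auto
    show "(\<lambda>Z\<in>C. restrict (\<lambda>k\<in>{1..d}. g (orbit p k) k) Z) = g"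
    proof (rule PiE_ext[OF _ g])
      show "(\<lambda>Z\<in>C. restrict (\<lambda>k\<in>{1..d}. g (orbit p k) k) Z) \<in> (\<Pi>\<^sub>E Z\<in>C. Z \<rightarrow>\<^sub>E UNIV)" by auto
      fix Z assume Z: "Z \<in> C"
      have gZ: "g Z \<in> Z \<rightarrow>\<^sub>E UNIV" using g Z by (rule PiE_mem)
      have "restrict (\<lambda>k\<in>{1..d}. g (orbit p k) k) Z = g Z"
        by (rule PiE_ext[OF _ gZ]) (simp_all only: restrict_PiE_iff UNIV_I ball_simps restrict_apply' val[OF Z] simp_thms, simp)
      then show "(\<lambda>Z\<in>C. restrict (\<lambda>k\<in>{1..d}. g (orbit p k) k) Z) Z = g Z" using Z by simp
    qed
    show "(\<lambda>k\<in>{1..d}. g (orbit p k) k) \<in> words d" by (simp add: words_def)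
    have "(\<Prod>k\<in>{1..d}. A $ (\<lambda>k\<in>{1..d}. g (orbit p k) k) k $ (\<lambda>k\<in>{1..d}. g (orbit p k) k) (p k)) =
       (\<Prod>Z\<in>C. \<Prod>k\<in>Z. A $ (\<lambda>k\<in>{1..d}. g (orbit p k) k) k $ (\<lambda>k\<in>{1..d}. g (orbit p k) k) (p k))"
      unfolding U[symmetric] by (rule prod.Union_disjoint[unfolded o_def]) (use disj fZ in \<open>auto simp: disjoint_def\<close>)
    also have "\<dots> = (\<Prod>Z\<in>C. \<Prod>k\<in>Z. A $ g Z k $ g Z (p k))"
      by (intro prod.cong refl) (simp only: val pZ)
    finally show "(\<Prod>k\<in>{1..d}. A $ (\<lambda>k\<in>{1..d}. g (orbit p k) k) k $ (\<lambda>k\<in>{1..d}. g (orbit p k) k) (p k)) =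
       (\<Prod>Z\<in>C. \<Prod>k\<in>Z. A $ g Z k $ g Z (p k))" .
  next
    fix x :: "nat \<Rightarrow> 'n" assume x: "x \<in> words d"
    show "(\<lambda>k\<in>{1..d}. (\<lambda>Z\<in>C. restrict x Z) (orbit p k) k) = x"
      by (rule words_ext[OF _ x]) (use orb in \<open>auto simp: words_def simp del: atLeastAtMost_iff\<close>)
    show "(\<lambda>Z\<in>C. restrict x Z) \<in> (\<Pi>\<^sub>E Z\<in>C. Z \<rightarrow>\<^sub>E UNIV)" by auto
  qed
  finally show ?thesis unfolding tensor_trace_def C_def by simp
qed

lemma tensor_trace_power_sum:
  fixes A :: "complex^'n^'n"
  assumes A: "has_eigenvalues A a" and \<alpha>: "\<alpha> \<in> partitions d" and p: "p \<in> conj_class \<alpha>"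
  shows "tensor_trace A d p = power_sum \<alpha> a"
proof -
  define g where "g m = (\<Sum>j\<in>UNIV. (a $ j) ^ m)" for m
  have pp: "p \<in> perms d" "cycle_type d p = mset \<alpha>" using p \<alpha> by (auto simp: conj_class_perms)
  have tr: "trace (mat_pow A m) = g m" for m
    using trace_eigenvalues[OF has_eigenvalues_mat_pow[OF A]] by (simp add: g_def)
  have "tensor_trace A d p = (\<Prod>Z\<in>orbit p ` {1..d}. g (card Z))" by (simp only: tensor_trace_orbits[OF pp(1)] tr)
  also have "\<dots> = prod_mset (image_mset g (cycle_type d p))"
    by (simp add: cycle_type_def prod_unfold_prod_mset multiset.map_comp o_def)
  also have "\<dots> = prod_list (map g \<alpha>)" by (simp add: pp(2) prod_mset_prod_list flip: mset_map)
  also have "\<dots> = power_sum \<alpha> a" by (simp add: power_sum_def g_def prod.list_conv_set_nth atLeast0LessThan)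
  finally show ?thesis .
qed

section \<open>The two integrals\<close>

lemma sum_power_words:
  "(\<Sum>p\<in>UNIV. \<Sum>q\<in>UNIV. f p q) ^ d =
    (\<Sum>p\<in>words d. \<Sum>q\<in>words d. \<Prod>k\<in>{1..d}. f (p k) (q k))"
  for f :: "'n::finite \<Rightarrow> 'm::finite \<Rightarrow> complex"
proof -
  have "(\<Sum>p\<in>UNIV. \<Sum>q\<in>UNIV. f p q) ^ d = (\<Prod>k\<in>{1..d}. \<Sum>p\<in>UNIV. \<Sum>q\<in>UNIV. f p q)" by simp
  then show ?thesis by (simp only: prod_sum_words)
qed

lemma sum_power_words4:
  "(\<Sum>p\<in>UNIV. \<Sum>s\<in>UNIV. \<Sum>r\<in>UNIV. \<Sum>q\<in>UNIV. f p s r q) ^ d =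
    (\<Sum>p\<in>words d. \<Sum>s\<in>words d. \<Sum>r\<in>words d. \<Sum>q\<in>words d. \<Prod>k\<in>{1..d}. f (p k) (s k) (r k) (q k))"
  for f :: "'n::finite \<Rightarrow> 'n \<Rightarrow> 'n \<Rightarrow> 'n \<Rightarrow> complex"
proof -
  have "(\<Sum>p\<in>UNIV. \<Sum>s\<in>UNIV. \<Sum>r\<in>UNIV. \<Sum>q\<in>UNIV. f p s r q) ^ d =
    (\<Prod>k\<in>{1..d}. \<Sum>p\<in>UNIV. \<Sum>s\<in>UNIV. \<Sum>r\<in>UNIV. \<Sum>q\<in>UNIV. f p s r q)" by simp
  then show ?thesis by (simp only: prod_sum_words)
qed

lemma sum_swap3: "(\<Sum>a\<in>A. \<Sum>b\<in>B. \<Sum>c\<in>C. f a b c) = (\<Sum>c\<in>C. \<Sum>a\<in>A. \<Sum>b\<in>B. f a b c)"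
  for f :: "_ \<Rightarrow> _ \<Rightarrow> _ \<Rightarrow> complex"
proof -
  have "(\<Sum>a\<in>A. \<Sum>b\<in>B. \<Sum>c\<in>C. f a b c) = (\<Sum>a\<in>A. \<Sum>c\<in>C. \<Sum>b\<in>B. f a b c)"
    by (rule sum.cong[OF refl], rule sum.swap)
  also have "\<dots> = (\<Sum>c\<in>C. \<Sum>a\<in>A. \<Sum>b\<in>B. f a b c)" by (rule sum.swap)
  finally show ?thesis .
qed

lemma sum_swap5: "(\<Sum>a\<in>A. \<Sum>b\<in>B. \<Sum>c\<in>C. \<Sum>d\<in>D. \<Sum>e\<in>E. f a b c d e) =
   (\<Sum>e\<in>E. \<Sum>a\<in>A. \<Sum>b\<in>B. \<Sum>c\<in>C. \<Sum>d\<in>D. f a b c d e)"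
  for f :: "_ \<Rightarrow> _ \<Rightarrow> _ \<Rightarrow> _ \<Rightarrow> _ \<Rightarrow> complex"
proof -
  have "(\<Sum>a\<in>A. \<Sum>b\<in>B. \<Sum>c\<in>C. \<Sum>d\<in>D. \<Sum>e\<in>E. f a b c d e) = (\<Sum>a\<in>A. \<Sum>b\<in>B. \<Sum>e\<in>E. \<Sum>c\<in>C. \<Sum>d\<in>D. f a b c d e)"
    by (intro sum.cong refl sum_swap3)
  also have "\<dots> = (\<Sum>e\<in>E. \<Sum>a\<in>A. \<Sum>b\<in>B. \<Sum>c\<in>C. \<Sum>d\<in>D. f a b c d e)" by (rule sum_swap3)
  finally show ?thesis .
qed

lemma prod_agree_collapse:
  fixes M :: "'n::finite \<Rightarrow> 'n \<Rightarrow> complex"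
  shows "(\<Sum>q\<in>words d. agree d q z * (\<Prod>k\<in>{1..d}. M (q k) (w k))) = (\<Prod>k\<in>{1..d}. M (z k) (w k))"
  by (rule sum_words_agree, rule prod.cong[OF refl]) simp

lemma tensor_trace_right:
  fixes A :: "complex^'n^'n"
  assumes "s \<in> perms d"
  shows "(\<Sum>x\<in>words d. \<Prod>k\<in>{1..d}. A $ x (s k) $ x k) = tensor_trace A d s"
proof -
  have "(\<Prod>k\<in>{1..d}. A $ x (s k) $ x k) = (\<Prod>k\<in>{1..d}. A $ x k $ x (inv s k))" for x :: "nat \<Rightarrow> 'n"
    using prod_perms[OF assms, of "\<lambda>k. A $ x k $ x (inv s k)"] assms by simp
  then have "(\<Sum>x\<in>words d. \<Prod>k\<in>{1..d}. A $ x (s k) $ x k) = tensor_trace A d (inv s)" by (simp add: tensor_trace_def)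
  then show ?thesis using tensor_trace_inv[OF assms, of A] by simp
qed

lemma trace_conj_expand:
  fixes A B U :: "complex^'n^'n"
  shows "trace (A ** U ** B ** adjoint_mat U) = (\<Sum>p\<in>UNIV. \<Sum>s\<in>UNIV. \<Sum>r\<in>UNIV. \<Sum>q\<in>UNIV. A $ p $ q * U $ q $ r * B $ r $ s * cnj (U $ p $ s))"
  by (simp add: trace_def matrix_matrix_mult_def adjoint_mat_def sum_distrib_right)

lemma trace_mult_expand:
  fixes A U :: "complex^'n^'n"
  shows "trace (A ** U) = (\<Sum>p\<in>UNIV. \<Sum>q\<in>UNIV. A $ p $ q * U $ q $ p)"
  by (simp add: trace_def matrix_matrix_mult_def)

lemma trace_mult_adjoint_expand:
  fixes B U :: "complex^'n^'n"
  shows "trace (B ** adjoint_mat U) = (\<Sum>r\<in>UNIV. \<Sum>s\<in>UNIV. B $ r $ s * cnj (U $ r $ s))"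
  by (simp add: trace_def matrix_matrix_mult_def adjoint_mat_def)

text \<open>By Frobenius' formula this is \<open>d!\<close> times the Schur polynomial of shape
  \<nu> at the eigenvalues of \<open>A\<close>.\<close>

definition char_sum :: "complex^'n^'n \<Rightarrow> nat list \<Rightarrow> complex" where
  "char_sum A \<nu> = (\<Sum>s\<in>perms (sum_list \<nu>). chi_elt \<nu> s * tensor_trace A (sum_list \<nu>) s)"

text \<open>The traces of \<open>B\<close> form a central element, which multiplies the character by
  a scalar. Comparing values at \<open>id\<close> identifies this scalar as a multiple of
  \<open>char_sum B \<nu>\<close>.\<close>

lemma char_sum_conv:
  fixes B :: "complex^'n^'n"
  assumes \<nu>: "\<nu> \<in> partitions d"
  shows "(\<Sum>\<sigma>\<in>perms d. \<Sum>\<tau>\<in>perms d. chi_elt \<nu> (inv \<sigma> \<circ> \<tau>) * tensor_trace B d \<sigma> * tensor_trace A d \<tau>) =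
    hook \<nu> / fact d * char_sum B \<nu> * char_sum A \<nu>"
proof -
  let ?z = "tensor_trace_elt B d"
  have d: "sum_list \<nu> = d" by (rule sum_list_partition[OF \<nu>])
  obtain w where w: "conv d ?z (chi_elt \<nu>) = fscale w (chi_elt \<nu>)" using conv_chi_elt[OF \<nu> class_fun_tensor_trace_elt] by blast
  have "conv d ?z (chi_elt \<nu>) id = char_sum B \<nu>"
    unfolding char_sum_def d by (simp add: conv_apply tensor_trace_elt_def class_fun_inv[OF chi_elt_class_fun[OF \<nu>]] mult.commute)
  then have "w * (fact d / hook \<nu>) = char_sum B \<nu>" by (simp add: w fscale_def chi_elt_id[OF \<nu>])
  then have w': "w = hook \<nu> / fact d * char_sum B \<nu>" using hook_nonzero[OF \<nu>] by (auto simp: field_simps)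
  have "(\<Sum>\<sigma>\<in>perms d. \<Sum>\<tau>\<in>perms d. chi_elt \<nu> (inv \<sigma> \<circ> \<tau>) * tensor_trace B d \<sigma> * tensor_trace A d \<tau>) =
     (\<Sum>\<tau>\<in>perms d. conv d ?z (chi_elt \<nu>) \<tau> * tensor_trace A d \<tau>)"
    by (subst sum.swap) (simp add: conv_apply tensor_trace_elt_def sum_distrib_right sum_distrib_left mult_ac)
  also have "\<dots> = w * char_sum A \<nu>"
    unfolding w char_sum_def d by (simp add: fscale_def sum_distrib_left mult_ac)
  finally show ?thesis by (simp add: w')
qed

lemma char_sum_power_sum:
  fixes A :: "complex^'n^'n"
  assumes \<nu>: "\<nu> \<in> partitions d" and A: "has_eigenvalues A a"
  shows "char_sum A \<nu> = (\<Sum>\<alpha>\<in>partitions d. power_sum \<alpha> a * (of_nat (card (conj_class \<alpha>)) * chi \<alpha> \<nu>))"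
proof -
  have "char_sum A \<nu> = (\<Sum>\<alpha>\<in>partitions d. \<Sum>p\<in>conj_class \<alpha>. chi_elt \<nu> p * tensor_trace A d p)"
    unfolding char_sum_def sum_list_partition[OF \<nu>] by (rule sum_conj_classes[symmetric])
  also have "\<dots> = (\<Sum>\<alpha>\<in>partitions d. power_sum \<alpha> a * (\<Sum>p\<in>conj_class \<alpha>. chi_elt \<nu> p))"
    unfolding sum_distrib_left by (intro sum.cong refl) (simp add: tensor_trace_power_sum[OF A])
  also have "\<dots> = (\<Sum>\<alpha>\<in>partitions d. power_sum \<alpha> a * (of_nat (card (conj_class \<alpha>)) * chi \<alpha> \<nu>))"
    by (intro sum.cong refl) (simp add: card_conj_class_chi[OF \<nu>])
  finally show ?thesis .
qed

section \<open>The terms of the series as sums over shapes\<close>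

lemma no_long_inc_nonempty:
  assumes "N \<ge> 1" shows "card (no_long_inc N d) \<noteq> 0"
proof -
  \<comment> \<open>The order-reversing permutation has no increasing subsequence of length 2. A
    nonempty set is required for its cardinality to cancel.\<close>
  define p where "p k = (if k \<in> {1..d} then d + 1 - k else k)" for k
  have "bij_betw p {1..d} {1..d}"
    by (rule bij_betw_byWitness[where f' = p]) (auto simp: p_def)
  then have "p permutes {1..d}" by (rule bij_imp_permutes) (simp only: p_def if_False)
  then have p: "p \<in> perms d" by (simp add: perms_def)
  have "\<not> (\<exists>I\<subseteq>{1..d}. card I = N + 1 \<and> strict_mono_on I p)"
  proof
    assume "\<exists>I\<subseteq>{1..d}. card I = N + 1 \<and> strict_mono_on I p"
    then obtain I where I: "I \<subseteq> {1..d}" "card I = N + 1" "strict_mono_on I p" by blast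
    have "\<not> card I \<le> 1" using I(2) assms by simp
    then obtain i j where ij: "i \<in> I" "j \<in> I" "i \<noteq> j"
      by (metis card_le_Suc0_iff_eq card.infinite One_nat_def le0)
    have "\<exists>i j. i \<in> I \<and> j \<in> I \<and> i < j" using ij by (metis linorder_neqE_nat)
    then obtain i j where ij: "i \<in> I" "j \<in> I" "i < j" by blast
    have "p i < p j" using I(3) ij by (auto simp: strict_mono_on_def)
    moreover have "i \<in> {1..d}" "j \<in> {1..d}" using I(1) ij by auto
    ultimately show False using ij(3) by (auto simp: p_def)
  qed
  then have "p \<in> no_long_inc N d" using p by (simp add: no_long_inc_def)
  moreover have "finite (no_long_inc N d)" by (simp add: no_long_inc_def)
  ultimately show ?thesis by auto
qed

lemma plancherel_simp:
  assumes "N \<ge> 1"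
  shows "of_real (prob_LIS_le d N) * plancherel_expectation N d f =
    (\<Sum>\<nu> | \<nu> \<in> partitions d \<and> length \<nu> \<le> N. f \<nu> * of_nat (dim_specht \<nu>) ^ 2) / fact d"
  using no_long_inc_nonempty[OF assms, of d]
  by (simp add: plancherel_expectation_def prob_LIS_le_def sum_divide_distrib[symmetric])

text \<open>The dimensions in the denominators of the two factors \<open>omega\<close> cancel
  against the squared dimension of the Plancherel weight.\<close>

lemma hciz_term_char_sum:
  fixes A B :: "complex^'n^'n"
  assumes A: "has_eigenvalues A a" and B: "has_eigenvalues B b"
  shows "hciz_term d z a b = z ^ d / (fact d)\<^sup>2 *
    (\<Sum>\<nu> | \<nu> \<in> partitions d \<and> length \<nu> \<le> CARD('n). char_sum A \<nu> * char_sum B \<nu> / Omega CARD('n) \<nu>)"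
proof -
  let ?N = "CARD('n)"
  let ?P = "{\<nu>. \<nu> \<in> partitions d \<and> length \<nu> \<le> ?N}"
  have N: "?N \<ge> 1" by (simp add: Suc_leI)
  have om: "omega \<alpha> \<nu> * inverse (Omega ?N \<nu>) * omega \<beta> \<nu> * of_nat (dim_specht \<nu>) ^ 2 =
     (of_nat (card (conj_class \<alpha>)) * chi \<alpha> \<nu>) * (of_nat (card (conj_class \<beta>)) * chi \<beta> \<nu>) / Omega ?N \<nu>" if "\<nu> \<in> ?P" for \<alpha> \<beta> \<nu>
    using that dim_specht_nonzero[of \<nu> d] by (simp add: omega_def field_simps power2_eq_square)
  have "of_real (prob_LIS_le d ?N) * (\<Sum>\<alpha>\<in>partitions d. \<Sum>\<beta>\<in>partitions d. power_sum \<alpha> a * power_sum \<beta> b *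
         plancherel_expectation ?N d (\<lambda>\<nu>. omega \<alpha> \<nu> * inverse (Omega ?N \<nu>) * omega \<beta> \<nu>)) =
    (\<Sum>\<alpha>\<in>partitions d. \<Sum>\<beta>\<in>partitions d. power_sum \<alpha> a * power_sum \<beta> b *
         (of_real (prob_LIS_le d ?N) * plancherel_expectation ?N d (\<lambda>\<nu>. omega \<alpha> \<nu> * inverse (Omega ?N \<nu>) * omega \<beta> \<nu>)))"
    by (simp add: sum_distrib_left mult_ac)
  also have "\<dots> = (\<Sum>\<alpha>\<in>partitions d. \<Sum>\<beta>\<in>partitions d. power_sum \<alpha> a * power_sum \<beta> b *
         ((\<Sum>\<nu>\<in>?P. (of_nat (card (conj_class \<alpha>)) * chi \<alpha> \<nu>) * (of_nat (card (conj_class \<beta>)) * chi \<beta> \<nu>) / Omega ?N \<nu>) / fact d))"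
    unfolding plancherel_simp[OF N] using om by (intro sum.cong refl) simp
  also have "\<dots> = (\<Sum>\<alpha>\<in>partitions d. \<Sum>\<beta>\<in>partitions d. \<Sum>\<nu>\<in>?P.
      (power_sum \<alpha> a * (of_nat (card (conj_class \<alpha>)) * chi \<alpha> \<nu>)) * (power_sum \<beta> b * (of_nat (card (conj_class \<beta>)) * chi \<beta> \<nu>)) / Omega ?N \<nu> / fact d)"
    by (simp add: sum_distrib_left sum_divide_distrib mult_ac)
  also have "\<dots> = (\<Sum>\<nu>\<in>?P. \<Sum>\<alpha>\<in>partitions d. \<Sum>\<beta>\<in>partitions d.
      (power_sum \<alpha> a * (of_nat (card (conj_class \<alpha>)) * chi \<alpha> \<nu>)) * (power_sum \<beta> b * (of_nat (card (conj_class \<beta>)) * chi \<beta> \<nu>)) / Omega ?N \<nu> / fact d)"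
    by (rule sum_swap3)
  also have "\<dots> = (\<Sum>\<nu>\<in>?P. char_sum A \<nu> * char_sum B \<nu> / Omega ?N \<nu> / fact d)"
  proof (rule sum.cong[OF refl])
    fix \<nu> assume "\<nu> \<in> ?P"
    then have "\<nu> \<in> partitions d" by simp
    from char_sum_power_sum[OF this A] char_sum_power_sum[OF this B]
    show "(\<Sum>\<alpha>\<in>partitions d. \<Sum>\<beta>\<in>partitions d.
      (power_sum \<alpha> a * (of_nat (card (conj_class \<alpha>)) * chi \<alpha> \<nu>)) * (power_sum \<beta> b * (of_nat (card (conj_class \<beta>)) * chi \<beta> \<nu>)) / Omega ?N \<nu> / fact d) =
      char_sum A \<nu> * char_sum B \<nu> / Omega ?N \<nu> / fact d" by (simp only: sum_product sum_divide_distrib)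
  qed
  also have "\<dots> = (\<Sum>\<nu>\<in>?P. char_sum A \<nu> * char_sum B \<nu> / Omega ?N \<nu>) / fact d"
    by (rule sum_divide_distrib[symmetric])
  finally have e: "of_real (prob_LIS_le d ?N) * (\<Sum>\<alpha>\<in>partitions d. \<Sum>\<beta>\<in>partitions d. power_sum \<alpha> a * power_sum \<beta> b *
         plancherel_expectation ?N d (\<lambda>\<nu>. omega \<alpha> \<nu> * inverse (Omega ?N \<nu>) * omega \<beta> \<nu>)) =
     (\<Sum>\<nu>\<in>?P. char_sum A \<nu> * char_sum B \<nu> / Omega ?N \<nu>) / fact d" .
  show ?thesis
    unfolding hciz_term_def Let_def mult.assoc[of "z ^ d / fact d"] e by (simp add: power2_eq_square)
qed

text \<open>With a single factor \<open>omega\<close>, one dimension of the Plancherel weight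
  survives; it is \<open>d!\<close> over \<open>hook \<nu>\<close>.\<close>

lemma bgw_term_char_sum:
  fixes C :: "complex^'n^'n"
  assumes C: "has_eigenvalues C c"
  shows "bgw_term d z c = z ^ (2 * d) * of_nat CARD('n) ^ d / fact d *
    (\<Sum>\<nu> | \<nu> \<in> partitions d \<and> length \<nu> \<le> CARD('n). char_sum C \<nu> / (Omega CARD('n) \<nu> * hook \<nu>))"
proof -
  let ?N = "CARD('n)"
  let ?P = "{\<nu>. \<nu> \<in> partitions d \<and> length \<nu> \<le> ?N}"
  have N: "?N \<ge> 1" by (simp add: Suc_leI)
  have om: "inverse (Omega ?N \<nu>) * omega \<beta> \<nu> * of_nat (dim_specht \<nu>) ^ 2 =
     (of_nat (card (conj_class \<beta>)) * chi \<beta> \<nu>) * fact d / (Omega ?N \<nu> * hook \<nu>)" if "\<nu> \<in> ?P" for \<beta> \<nu>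
    using that dim_specht_nonzero[of \<nu> d] by (simp add: omega_def power2_eq_square dim_specht_eq[of \<nu> d] divide_simps)
  have "of_real (prob_LIS_le d ?N) * (\<Sum>\<beta>\<in>partitions d. power_sum \<beta> c *
         plancherel_expectation ?N d (\<lambda>\<nu>. inverse (Omega ?N \<nu>) * omega \<beta> \<nu>)) =
    (\<Sum>\<beta>\<in>partitions d. power_sum \<beta> c *
         (of_real (prob_LIS_le d ?N) * plancherel_expectation ?N d (\<lambda>\<nu>. inverse (Omega ?N \<nu>) * omega \<beta> \<nu>)))"
    by (simp add: sum_distrib_left mult_ac)
  also have "\<dots> = (\<Sum>\<beta>\<in>partitions d. power_sum \<beta> c *
         ((\<Sum>\<nu>\<in>?P. (of_nat (card (conj_class \<beta>)) * chi \<beta> \<nu>) * fact d / (Omega ?N \<nu> * hook \<nu>)) / fact d))"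
    unfolding plancherel_simp[OF N] using om by (intro sum.cong refl) simp
  also have "\<dots> = (\<Sum>\<beta>\<in>partitions d. \<Sum>\<nu>\<in>?P.
      (power_sum \<beta> c * (of_nat (card (conj_class \<beta>)) * chi \<beta> \<nu>)) / (Omega ?N \<nu> * hook \<nu>))"
    by (simp add: sum_distrib_left sum_divide_distrib mult_ac)
  also have "\<dots> = (\<Sum>\<nu>\<in>?P. \<Sum>\<beta>\<in>partitions d.
      (power_sum \<beta> c * (of_nat (card (conj_class \<beta>)) * chi \<beta> \<nu>)) / (Omega ?N \<nu> * hook \<nu>))"
    by (rule sum.swap)
  also have "\<dots> = (\<Sum>\<nu>\<in>?P. char_sum C \<nu> / (Omega ?N \<nu> * hook \<nu>))"
  proof (rule sum.cong[OF refl])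
    fix \<nu> assume "\<nu> \<in> ?P"
    then have "\<nu> \<in> partitions d" by simp
    from char_sum_power_sum[OF this C]
    show "(\<Sum>\<beta>\<in>partitions d. (power_sum \<beta> c * (of_nat (card (conj_class \<beta>)) * chi \<beta> \<nu>)) / (Omega ?N \<nu> * hook \<nu>)) =
      char_sum C \<nu> / (Omega ?N \<nu> * hook \<nu>)" by (simp only: sum_divide_distrib)
  qed
  finally show ?thesis unfolding bgw_term_def Let_def by (simp add: mult.assoc)
qed

section \<open>Moments of traces under Haar measure\<close>

context
  fixes \<mu> :: "(complex^'n^'n) measure"
  assumes haar: "haar_prob_measure \<mu>"
begin

interpretation prob_space \<mu> using haar by (simp add: haar_prob_measure_def)

lemma conj_moment_weingarten:
  "(\<integral>U. trace (A ** U ** B ** adjoint_mat U) ^ d \<partial>\<mu>) =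
    (\<Sum>\<tau>\<in>perms d. \<Sum>\<sigma>\<in>perms d. weingarten CARD('n) d (inv \<sigma> \<circ> \<tau>) * tensor_trace B d \<sigma> * tensor_trace A d \<tau>)"
proof -
  let ?A = "\<lambda>p q. \<Prod>k\<in>{1..d}. A $ p k $ q k" and ?B = "\<lambda>r s. \<Prod>k\<in>{1..d}. B $ r k $ s k"
  let ?W = "\<lambda>\<sigma> \<tau>. weingarten CARD('n) d (inv \<sigma> \<circ> \<tau>)"
  have "(\<integral>U. trace (A ** U ** B ** adjoint_mat U) ^ d \<partial>\<mu>) =
    (\<integral>U. (\<Sum>p\<in>words d. \<Sum>s\<in>words d. \<Sum>r\<in>words d. \<Sum>q\<in>words d. ?A p q * ?B r s *
      (\<Prod>k\<in>{1..d}. U $ q k $ r k * cnj (U $ p k $ s k))) \<partial>\<mu>)"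
    unfolding trace_conj_expand sum_power_words4 by (simp add: prod.distrib mult_ac)
  also have "\<dots> = (\<Sum>p\<in>words d. \<Sum>s\<in>words d. \<Sum>r\<in>words d. \<Sum>q\<in>words d. ?A p q * ?B r s *
      haar_kernel \<mu> d r s q p)"
  proof -
    note i = haar_integrable[OF haar]
    show ?thesis unfolding haar_kernel_def
      by (subst Bochner_Integration.integral_sum, (rule i, intro continuous_intros), rule sum.cong[OF refl])+ simp
  qed
  also have "\<dots> = (\<Sum>p\<in>words d. \<Sum>s\<in>words d. \<Sum>r\<in>words d. \<Sum>q\<in>words d. \<Sum>\<tau>\<in>perms d.
      (\<Sum>\<sigma>\<in>perms d. ?W \<sigma> \<tau> *
        (agree d q (p \<circ> \<tau>) * ?A p q) * (agree d r (s \<circ> \<sigma>) * ?B r s)))"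
    by (simp only: haar_kernel_weingarten[OF haar] sum_distrib_left mult_ac)
  also have "\<dots> = (\<Sum>\<tau>\<in>perms d. \<Sum>p\<in>words d. \<Sum>s\<in>words d. \<Sum>r\<in>words d. \<Sum>q\<in>words d.
      (\<Sum>\<sigma>\<in>perms d. ?W \<sigma> \<tau> *
        (agree d q (p \<circ> \<tau>) * ?A p q) * (agree d r (s \<circ> \<sigma>) * ?B r s)))"
    by (rule sum_swap5)
  also have "\<dots> = (\<Sum>\<tau>\<in>perms d. \<Sum>\<sigma>\<in>perms d. \<Sum>p\<in>words d. \<Sum>s\<in>words d. \<Sum>r\<in>words d. \<Sum>q\<in>words d.
      ?W \<sigma> \<tau> *
        (agree d q (p \<circ> \<tau>) * ?A p q) * (agree d r (s \<circ> \<sigma>) * ?B r s))"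
    by (intro sum.cong[OF refl] sum_swap5)
  \<comment> \<open>The permutation \<tau> links only the indices of \<open>A\<close>, and \<sigma>
    only those of \<open>B\<close>, so the sum over words factorises.\<close>
  also have "\<dots> = (\<Sum>\<tau>\<in>perms d. \<Sum>\<sigma>\<in>perms d. ?W \<sigma> \<tau> *
      (\<Sum>p\<in>words d. \<Sum>q\<in>words d. agree d q (p \<circ> \<tau>) * ?A p q) *
      (\<Sum>s\<in>words d. \<Sum>r\<in>words d. agree d r (s \<circ> \<sigma>) * ?B r s))"
  proof (intro sum.cong refl)
    have f: "(\<Sum>p\<in>P. \<Sum>s\<in>Q. \<Sum>r\<in>R. \<Sum>q\<in>S. w * g p q * h s r) = w * (\<Sum>p\<in>P. \<Sum>q\<in>S. g p q) * (\<Sum>s\<in>Q. \<Sum>r\<in>R. h s r)"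
      for w :: complex and g h and P Q R S :: "(nat \<Rightarrow> 'n) set"
    proof -
      have "(\<Sum>p\<in>P. \<Sum>s\<in>Q. \<Sum>r\<in>R. \<Sum>q\<in>S. w * g p q * h s r) = (\<Sum>p\<in>P. \<Sum>s\<in>Q. \<Sum>r\<in>R. w * (\<Sum>q\<in>S. g p q) * h s r)"
        by (simp only: sum_distrib_left sum_distrib_right)
      also have "\<dots> = w * (\<Sum>p\<in>P. \<Sum>q\<in>S. g p q) * (\<Sum>s\<in>Q. \<Sum>r\<in>R. h s r)"
        by (simp only: sum_distrib_left[symmetric] sum_distrib_right[symmetric])
      finally show ?thesis .
    qed
    fix \<tau> \<sigma>
    show "(\<Sum>p\<in>words d. \<Sum>s\<in>words d. \<Sum>r\<in>words d. \<Sum>q\<in>words d.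
      ?W \<sigma> \<tau> *
        (agree d q (p \<circ> \<tau>) * ?A p q) * (agree d r (s \<circ> \<sigma>) * ?B r s)) =
      ?W \<sigma> \<tau> *
      (\<Sum>p\<in>words d. \<Sum>q\<in>words d. agree d q (p \<circ> \<tau>) * ?A p q) *
      (\<Sum>s\<in>words d. \<Sum>r\<in>words d. agree d r (s \<circ> \<sigma>) * ?B r s)"
      by (rule f)
  qed
  also have "\<dots> = (\<Sum>\<tau>\<in>perms d. \<Sum>\<sigma>\<in>perms d. ?W \<sigma> \<tau> * tensor_trace B d \<sigma> * tensor_trace A d \<tau>)"
  proof (intro sum.cong refl)
    fix \<tau> \<sigma> assume "\<tau> \<in> perms d" "\<sigma> \<in> perms d"
    have 1: "(\<Sum>p\<in>words d. \<Sum>q\<in>words d. agree d q (p \<circ> \<tau>) * ?A p q) = tensor_trace A d \<tau>"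
      unfolding tensor_trace_def using prod_agree_collapse[of d _ "\<lambda>a b. A $ b $ a"] by (simp add: o_def)
    have 2: "(\<Sum>s\<in>words d. \<Sum>r\<in>words d. agree d r (s \<circ> \<sigma>) * ?B r s) = tensor_trace B d \<sigma>"
      unfolding prod_agree_collapse[of d _ "\<lambda>a b. B $ a $ b"] using tensor_trace_right[OF \<open>\<sigma> \<in> perms d\<close>, of B] by (simp add: o_def)
    show "?W \<sigma> \<tau> *
      (\<Sum>p\<in>words d. \<Sum>q\<in>words d. agree d q (p \<circ> \<tau>) * ?A p q) *
      (\<Sum>s\<in>words d. \<Sum>r\<in>words d. agree d r (s \<circ> \<sigma>) * ?B r s) = ?W \<sigma> \<tau> * tensor_trace B d \<sigma> * tensor_trace A d \<tau>"
      unfolding 1 2 by (simp add: mult_ac)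
  qed
  finally show ?thesis .
qed

lemma conj_moment:
  "(\<integral>U. trace (A ** U ** B ** adjoint_mat U) ^ d \<partial>\<mu>) =
    (\<Sum>\<nu> | \<nu> \<in> partitions d \<and> length \<nu> \<le> CARD('n). char_sum A \<nu> * char_sum B \<nu> / Omega CARD('n) \<nu>) / (of_nat CARD('n) ^ d * fact d)"
proof -
  let ?P = "{\<nu>. \<nu> \<in> partitions d \<and> length \<nu> \<le> CARD('n)}"
  let ?w = "\<lambda>\<nu>. 1 / (of_nat CARD('n) ^ d * Omega CARD('n) \<nu> * hook \<nu>)"
  have "(\<integral>U. trace (A ** U ** B ** adjoint_mat U) ^ d \<partial>\<mu>) =
    (\<Sum>\<sigma>\<in>perms d. \<Sum>\<tau>\<in>perms d. weingarten CARD('n) d (inv \<sigma> \<circ> \<tau>) * tensor_trace B d \<sigma> * tensor_trace A d \<tau>)"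
    unfolding conj_moment_weingarten by (rule sum.swap)
  also have "\<dots> = (\<Sum>\<sigma>\<in>perms d. \<Sum>\<tau>\<in>perms d. \<Sum>\<nu>\<in>?P. ?w \<nu> * (chi_elt \<nu> (inv \<sigma> \<circ> \<tau>) * tensor_trace B d \<sigma> * tensor_trace A d \<tau>))"
    by (simp only: weingarten_def sum_fun_apply fscale_def sum_distrib_right mult.assoc)
  also have "\<dots> = (\<Sum>\<nu>\<in>?P. \<Sum>\<sigma>\<in>perms d. \<Sum>\<tau>\<in>perms d. ?w \<nu> * (chi_elt \<nu> (inv \<sigma> \<circ> \<tau>) * tensor_trace B d \<sigma> * tensor_trace A d \<tau>))"
    by (rule sum_swap3)
  also have "\<dots> = (\<Sum>\<nu>\<in>?P. ?w \<nu> * (hook \<nu> / fact d * char_sum B \<nu> * char_sum A \<nu>))"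
    by (simp only: sum_distrib_left[symmetric]) (intro sum.cong refl, simp add: char_sum_conv)
  also have "\<dots> = (\<Sum>\<nu>\<in>?P. char_sum A \<nu> * char_sum B \<nu> / Omega CARD('n) \<nu> / (of_nat CARD('n) ^ d * fact d))"
    by (intro sum.cong refl) (auto simp: hook_nonzero mult_ac)
  finally show ?thesis by (simp only: sum_divide_distrib)
qed

end

text \<open>Entries of a unitary matrix have modulus at most 1; the fourth power of \<open>N\<close>
  counts the summands over four indices.\<close>

lemma trace_conj_bound:
  fixes A B U :: "complex^'n^'n"
  assumes "U \<in> unitary_group" "\<And>i j. norm (A $ i $ j) \<le> R" "\<And>i j. norm (B $ i $ j) \<le> R"
  shows "norm (trace (A ** U ** B ** adjoint_mat U)) \<le> real CARD('n) ^ 4 * R\<^sup>2"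
proof -
  have R: "0 \<le> R" using assms(2) norm_ge_zero order_trans by blast
  have "norm (A $ p $ q * U $ q $ r * B $ r $ s * cnj (U $ p $ s)) \<le> R * 1 * R * 1" for p q r s
    unfolding norm_mult using assms(2,3) unitary_entry_le[OF assms(1)] R
    by (intro mult_mono mult_nonneg_nonneg norm_ge_zero) auto
  then have b: "norm (A $ p $ q * U $ q $ r * B $ r $ s * cnj (U $ p $ s)) \<le> R\<^sup>2" for p q r s
    by (simp add: power2_eq_square)
  have "norm (trace (A ** U ** B ** adjoint_mat U)) \<le> (\<Sum>p\<in>(UNIV::'n set). \<Sum>s\<in>(UNIV::'n set). \<Sum>r\<in>(UNIV::'n set). \<Sum>q\<in>(UNIV::'n set). R\<^sup>2)"
    unfolding trace_conj_expand by (rule sum_norm_le, rule sum_norm_le, rule sum_norm_le, rule sum_norm_le, rule b)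
  then show ?thesis by (simp add: power4_eq_xxxx mult_ac)
qed

lemma trace_linear_bound:
  fixes A B U :: "complex^'n^'n"
  assumes "U \<in> unitary_group" "\<And>i j. norm (A $ i $ j) \<le> R" "\<And>i j. norm (B $ i $ j) \<le> R"
  shows "norm (trace (B ** adjoint_mat U) + trace (A ** U)) \<le> 2 * real CARD('n) ^ 2 * R"
proof -
  have R: "0 \<le> R" using assms(2) norm_ge_zero order_trans by blast
  have "norm (A $ p $ q * U $ q $ p) \<le> R * 1" "norm (B $ p $ q * cnj (U $ p $ q)) \<le> R * 1" for p q
    unfolding norm_mult using assms(2,3) unitary_entry_le[OF assms(1)] R
    by (intro mult_mono norm_ge_zero; simp)+
  then have b: "norm (A $ p $ q * U $ q $ p) \<le> R" "norm (B $ p $ q * cnj (U $ p $ q)) \<le> R" for p q by simp_all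
  have "norm (trace (B ** adjoint_mat U)) \<le> (\<Sum>p\<in>(UNIV::'n set). \<Sum>s\<in>(UNIV::'n set). R)"
    unfolding trace_mult_adjoint_expand by (rule sum_norm_le, rule sum_norm_le, rule b)
  moreover have "norm (trace (A ** U)) \<le> (\<Sum>p\<in>(UNIV::'n set). \<Sum>s\<in>(UNIV::'n set). R)"
    unfolding trace_mult_expand by (rule sum_norm_le, rule sum_norm_le, rule b)
  ultimately show ?thesis
    using norm_triangle_ineq[of "trace (B ** adjoint_mat U)" "trace (A ** U)"] by (simp add: power2_eq_square)
qed

context
  fixes \<mu> :: "(complex^'n^'n) measure"
  assumes haar: "haar_prob_measure \<mu>"
begin

interpretation prob_space \<mu> using haar by (simp add: haar_prob_measure_def)

text \<open>Both permutations act on the indices of \<open>A\<close>, and collapsing the sums leaves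
  entries of \<open>A ** B\<close>. The result depends only on the quotient of the two permutations,
  so one of the two sums merely contributes a factor \<open>d!\<close>.\<close>

lemma linear_moment_weingarten:
  "(\<integral>U. trace (B ** adjoint_mat U) ^ d * trace (A ** U) ^ d \<partial>\<mu>) =
    fact d * (\<Sum>\<pi>\<in>perms d. weingarten CARD('n) d \<pi> * tensor_trace (A ** B) d \<pi>)"
proof -
  let ?A = "\<lambda>p q. \<Prod>k\<in>{1..d}. A $ p k $ q k" and ?B = "\<lambda>r s. \<Prod>k\<in>{1..d}. B $ r k $ s k"
  let ?W = "\<lambda>\<sigma> \<tau>. weingarten CARD('n) d (inv \<sigma> \<circ> \<tau>)"
  have "(\<integral>U. trace (B ** adjoint_mat U) ^ d * trace (A ** U) ^ d \<partial>\<mu>) =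
    (\<integral>U. (\<Sum>r\<in>words d. \<Sum>s\<in>words d. \<Sum>p\<in>words d. \<Sum>q\<in>words d. ?A p q * ?B r s *
      (\<Prod>k\<in>{1..d}. U $ q k $ p k * cnj (U $ r k $ s k))) \<partial>\<mu>)"
    unfolding trace_mult_adjoint_expand
    unfolding trace_mult_expand sum_power_words sum_distrib_right
    unfolding sum_distrib_left by (simp add: prod.distrib mult_ac)
  also have "\<dots> = (\<Sum>r\<in>words d. \<Sum>s\<in>words d. \<Sum>p\<in>words d. \<Sum>q\<in>words d. ?A p q * ?B r s *
      haar_kernel \<mu> d p s q r)"
  proof -
    note i = haar_integrable[OF haar]
    show ?thesis unfolding haar_kernel_def
      by (subst Bochner_Integration.integral_sum, (rule i, intro continuous_intros), rule sum.cong[OF refl])+ simp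
  qed
  also have "\<dots> = (\<Sum>r\<in>words d. \<Sum>s\<in>words d. \<Sum>p\<in>words d. \<Sum>q\<in>words d. \<Sum>\<tau>\<in>perms d.
      (\<Sum>\<sigma>\<in>perms d. ?W \<sigma> \<tau> * ?B r s *
        (agree d p (s \<circ> \<sigma>) * (agree d q (r \<circ> \<tau>) * ?A p q))))"
    by (simp only: haar_kernel_weingarten[OF haar] sum_distrib_left mult_ac)
  also have "\<dots> = (\<Sum>\<tau>\<in>perms d. \<Sum>r\<in>words d. \<Sum>s\<in>words d. \<Sum>p\<in>words d. \<Sum>q\<in>words d.
      (\<Sum>\<sigma>\<in>perms d. ?W \<sigma> \<tau> * ?B r s *
        (agree d p (s \<circ> \<sigma>) * (agree d q (r \<circ> \<tau>) * ?A p q))))"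
    by (rule sum_swap5)
  also have "\<dots> = (\<Sum>\<tau>\<in>perms d. \<Sum>\<sigma>\<in>perms d. \<Sum>r\<in>words d. \<Sum>s\<in>words d. \<Sum>p\<in>words d. \<Sum>q\<in>words d.
      ?W \<sigma> \<tau> * ?B r s *
        (agree d p (s \<circ> \<sigma>) * (agree d q (r \<circ> \<tau>) * ?A p q)))"
    by (intro sum.cong[OF refl] sum_swap5)
  also have "\<dots> = (\<Sum>\<tau>\<in>perms d. \<Sum>\<sigma>\<in>perms d. ?W \<sigma> \<tau> * tensor_trace (A ** B) d (inv \<sigma> \<circ> \<tau>))"
  proof (intro sum.cong refl)
    fix \<tau> \<sigma> assume t: "\<tau> \<in> perms d" and s: "\<sigma> \<in> perms d"
    have q: "(\<Sum>q\<in>words d. agree d q z * ?A p q) = (\<Prod>k\<in>{1..d}. A $ p k $ z k)" for p z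
      by (rule prod_agree_collapse[of d z "\<lambda>a b. A $ b $ a"])
    have p: "(\<Sum>p\<in>words d. agree d p w * (\<Prod>k\<in>{1..d}. A $ p k $ z k)) = (\<Prod>k\<in>{1..d}. A $ w k $ z k)" for w z
      by (rule prod_agree_collapse)
    have "(\<Sum>r\<in>words d. \<Sum>s\<in>words d. \<Sum>p\<in>words d. \<Sum>q\<in>words d.
      ?W \<sigma> \<tau> * ?B r s *
        (agree d p (s \<circ> \<sigma>) * (agree d q (r \<circ> \<tau>) * ?A p q))) =
      (\<Sum>r\<in>words d. \<Sum>s\<in>words d. ?W \<sigma> \<tau> * ?B r s * ?A (s \<circ> \<sigma>) (r \<circ> \<tau>))"
      unfolding sum_distrib_left[symmetric] q p ..
    also have "\<dots> = (\<Sum>s\<in>words d. \<Sum>r\<in>words d. ?W \<sigma> \<tau> * ?B r s * ?A (s \<circ> \<sigma>) (r \<circ> \<tau>))"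
      by (rule sum.swap)
    also have "\<dots> = (\<Sum>s\<in>words d. ?W \<sigma> \<tau> * (\<Prod>k\<in>{1..d}. (A ** B) $ s (\<sigma> k) $ s (\<tau> k)))"
    proof (rule sum.cong[OF refl])
      fix s :: "nat \<Rightarrow> 'n"
      have "(\<Sum>r\<in>words d. ?W \<sigma> \<tau> * ?B r s * ?A (s \<circ> \<sigma>) (r \<circ> \<tau>)) =
        (\<Sum>r\<in>words d. ?W \<sigma> \<tau> * (\<Prod>k\<in>{1..d}. A $ s (\<sigma> k) $ (restrict (r \<circ> \<tau>) {1..d}) k * B $ (restrict (r \<circ> \<tau>) {1..d}) k $ s (\<tau> k)))"
        using prod_perms[OF t, of "\<lambda>k. B $ r k $ s k" for r] by (simp add: prod.distrib mult_ac)
      also have "\<dots> = (\<Sum>r\<in>words d. ?W \<sigma> \<tau> * (\<Prod>k\<in>{1..d}. A $ s (\<sigma> k) $ r k * B $ r k $ s (\<tau> k)))"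
        by (rule sum_words_perm[OF t])
      also have "\<dots> = ?W \<sigma> \<tau> * (\<Prod>k\<in>{1..d}. \<Sum>e\<in>UNIV. A $ s (\<sigma> k) $ e * B $ e $ s (\<tau> k))"
        by (simp only: sum_distrib_left[symmetric] prod_sum_words)
      finally show "(\<Sum>r\<in>words d. ?W \<sigma> \<tau> * ?B r s * ?A (s \<circ> \<sigma>) (r \<circ> \<tau>)) =
         ?W \<sigma> \<tau> * (\<Prod>k\<in>{1..d}. (A ** B) $ s (\<sigma> k) $ s (\<tau> k))"
        by (simp add: matrix_matrix_mult_def)
    qed
    also have "\<dots> = (\<Sum>x\<in>words d. ?W \<sigma> \<tau> * (\<Prod>k\<in>{1..d}. (A ** B) $ x k $ x ((\<tau> \<circ> inv \<sigma>) k)))"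
      using prod_perms[OF s, of "\<lambda>k. (A ** B) $ x k $ x ((\<tau> \<circ> inv \<sigma>) k)" for x] s by simp
    also have "\<dots> = ?W \<sigma> \<tau> * tensor_trace (A ** B) d (\<tau> \<circ> inv \<sigma>)" by (simp add: tensor_trace_def sum_distrib_left)
    also have "tensor_trace (A ** B) d (\<tau> \<circ> inv \<sigma>) = tensor_trace (A ** B) d (inv \<sigma> \<circ> \<tau>)" using s t by (intro tensor_trace_commute) simp_all
    finally show "(\<Sum>r\<in>words d. \<Sum>s\<in>words d. \<Sum>p\<in>words d. \<Sum>q\<in>words d.
      ?W \<sigma> \<tau> * ?B r s *
        (agree d p (s \<circ> \<sigma>) * (agree d q (r \<circ> \<tau>) * ?A p q))) = ?W \<sigma> \<tau> * tensor_trace (A ** B) d (inv \<sigma> \<circ> \<tau>)" .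
  qed
  also have "\<dots> = (\<Sum>\<sigma>\<in>perms d. \<Sum>\<tau>\<in>perms d. ?W \<sigma> \<tau> * tensor_trace (A ** B) d (inv \<sigma> \<circ> \<tau>))"
    by (rule sum.swap)
  also have "\<dots> = (\<Sum>\<sigma>\<in>perms d. \<Sum>\<tau>\<in>perms d. weingarten CARD('n) d \<tau> * tensor_trace (A ** B) d \<tau>)"
    by (rule sum.cong[OF refl], rule sum_perms_left) simp
  finally show ?thesis by (simp add: card_perms)
qed

lemma linear_moment:
  "(\<integral>U. trace (B ** adjoint_mat U) ^ d * trace (A ** U) ^ d \<partial>\<mu>) =
    fact d / of_nat CARD('n) ^ d * (\<Sum>\<nu> | \<nu> \<in> partitions d \<and> length \<nu> \<le> CARD('n). char_sum (A ** B) \<nu> / (Omega CARD('n) \<nu> * hook \<nu>))"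
proof -
  let ?P = "{\<nu>. \<nu> \<in> partitions d \<and> length \<nu> \<le> CARD('n)}"
  let ?w = "\<lambda>\<nu>. 1 / (of_nat CARD('n) ^ d * Omega CARD('n) \<nu> * hook \<nu>)"
  have "(\<Sum>\<pi>\<in>perms d. weingarten CARD('n) d \<pi> * tensor_trace (A ** B) d \<pi>) =
     (\<Sum>\<pi>\<in>perms d. \<Sum>\<nu>\<in>?P. ?w \<nu> * (chi_elt \<nu> \<pi> * tensor_trace (A ** B) d \<pi>))"
    by (simp only: weingarten_def sum_fun_apply fscale_def sum_distrib_right mult.assoc)
  also have "\<dots> = (\<Sum>\<nu>\<in>?P. ?w \<nu> * (\<Sum>\<pi>\<in>perms d. chi_elt \<nu> \<pi> * tensor_trace (A ** B) d \<pi>))"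
    unfolding sum_distrib_left by (rule sum.swap)
  also have "\<dots> = (\<Sum>\<nu>\<in>?P. 1 / of_nat CARD('n) ^ d * (char_sum (A ** B) \<nu> / (Omega CARD('n) \<nu> * hook \<nu>)))"
    by (intro sum.cong refl) (auto simp: char_sum_def sum_list_partition)
  finally have e: "(\<Sum>\<pi>\<in>perms d. weingarten CARD('n) d \<pi> * tensor_trace (A ** B) d \<pi>) =
    (\<Sum>\<nu>\<in>?P. 1 / of_nat CARD('n) ^ d * (char_sum (A ** B) \<nu> / (Omega CARD('n) \<nu> * hook \<nu>)))" .
  show ?thesis unfolding linear_moment_weingarten e by (simp add: sum_distrib_left)
qed

text \<open>Invariance under the scalar matrix \<open>mat z\<close> with \<open>z\<close> of modulus
  1 multiplies the integral by \<open>cnj z ^ p * z ^ q\<close>. The angle \<open>t\<close> is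
  chosen so that this factor is -1.\<close>

lemma linear_moment_unbalanced:
  assumes "p \<noteq> q"
  shows "(\<integral>U. trace (B ** adjoint_mat U) ^ p * trace (A ** U) ^ q \<partial>\<mu>) = 0"
proof -
  define t where "t = pi / (real q - real p)"
  define z where "z = cis t"
  define f where "f U = trace (B ** adjoint_mat U) ^ p * trace (A ** U) ^ q" for U
  have zz: "z * cnj z = 1" by (simp add: z_def cis_cnj cis_mult)
  have "cnj z ^ p * z ^ q = cis (real q * t - real p * t)"
    by (simp only: z_def cis_cnj Complex.DeMoivre cis_mult) (simp add: algebra_simps)
  also have "real q * t - real p * t = pi" using assms unfolding left_diff_distrib[symmetric] by (simp add: t_def)
  finally have z: "cnj z ^ p * z ^ q = - 1" by simp
  have "adjoint_mat (mat z :: complex^'n^'n) = mat (cnj z)"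
    by (auto simp: adjoint_mat_def mat_def vec_eq_iff)
  then have V: "(mat z :: complex^'n^'n) \<in> unitary_group"
    using zz by (simp add: unitary_group_def mat_mult_mat mult.commute)
  have "continuous_on UNIV f"
    unfolding f_def trace_mult_adjoint_expand unfolding trace_mult_expand by (intro continuous_intros)
  then have "(\<integral>U. f U \<partial>\<mu>) = (\<integral>U. f (mat z ** U) \<partial>\<mu>)" by (rule haar_invariant[OF haar _ V, symmetric])
  also have "(\<lambda>U. f (mat z ** U)) = (\<lambda>U. (cnj z ^ p * z ^ q) * f U)"
  proof
    fix U
    have "trace (B ** adjoint_mat (mat z ** U)) = cnj z * trace (B ** adjoint_mat U)"
      unfolding trace_mult_adjoint_expand mat_mult_left by (simp add: sum_distrib_left mult_ac)
    moreover have "trace (A ** (mat z ** U)) = z * trace (A ** U)"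
      unfolding trace_mult_expand mat_mult_left by (simp add: sum_distrib_left mult_ac)
    ultimately show "f (mat z ** U) = (cnj z ^ p * z ^ q) * f U"
      by (simp add: f_def power_mult_distrib mult_ac)
  qed
  finally have "(\<integral>U. f U \<partial>\<mu>) = - (\<integral>U. f U \<partial>\<mu>)" by (simp add: z)
  then show ?thesis unfolding f_def by (simp add: eq_neg_iff_add_eq_0)
qed

section \<open>The exponential series and its moments\<close>

lemma haar_norm_integral_le:
  fixes f :: "complex^'n^'n \<Rightarrow> complex"
  assumes "continuous_on UNIV f" "\<And>U. U \<in> unitary_group \<Longrightarrow> norm (f U) \<le> C"
  shows "(\<integral>U. norm (f U) \<partial>\<mu>) \<le> C" "norm (\<integral>U. f U \<partial>\<mu>) \<le> C"
proof -
  have i: "integrable \<mu> (\<lambda>U. norm (f U))" using haar_integrable[OF haar assms(1)] by simp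
  show "(\<integral>U. norm (f U) \<partial>\<mu>) \<le> C"
    by (rule integral_le_const[OF i AE_I2]) (simp add: haar_space[OF haar] assms(2))
  then show "norm (\<integral>U. f U \<partial>\<mu>) \<le> C" using integral_norm_bound[of \<mu> f] by linarith
qed

lemma haar_exp_sums:
  fixes f :: "complex^'n^'n \<Rightarrow> complex"
  assumes f: "continuous_on UNIV f"
  shows "(\<lambda>n. w ^ n / fact n * (\<integral>U. f U ^ n \<partial>\<mu>)) sums (\<integral>U. exp (w * f U) \<partial>\<mu>)"
proof -
  have "compact (f ` unitary_group)"
    using f compact_unitary_group by (intro compact_continuous_image) (auto intro: continuous_on_subset)
  then have "bounded (f ` unitary_group)" by (rule compact_imp_bounded)
  then obtain C where C: "\<And>U. U \<in> unitary_group \<Longrightarrow> norm (f U) \<le> C"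
    by (auto simp: bounded_iff)
  define F where "F n U = (w * f U) ^ n /\<^sub>R fact n" for n U
  have cF: "continuous_on UNIV (F n)" for n unfolding F_def by (intro continuous_intros f)
  have bF: "norm (F n U) \<le> inverse (fact n) * (norm w * C) ^ n" if "U \<in> unitary_group" for n U
  proof -
    have "norm (w * f U) ^ n \<le> (norm w * C) ^ n"
      using C[OF that] by (intro power_mono) (auto simp: norm_mult mult_left_mono)
    moreover have "norm (F n U) = inverse (fact n) * norm (w * f U) ^ n"
      by (simp only: F_def norm_scaleR norm_power) simp
    ultimately show ?thesis by (simp only: mult_left_mono inverse_nonnegative_iff_nonnegative fact_ge_zero)
  qed
  have "(\<lambda>n. integral\<^sup>L \<mu> (F n)) sums (\<integral>U. (\<Sum>n. F n U) \<partial>\<mu>)"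
  proof (rule sums_integral)
    show "integrable \<mu> (F n)" for n by (rule haar_integrable[OF haar cF])
    have "summable (\<lambda>n. norm (F n U))" for U
      unfolding F_def by (rule summable_norm_exp)
    then show "AE U in \<mu>. summable (\<lambda>n. norm (F n U))" by simp
    show "summable (\<lambda>n. \<integral>U. norm (F n U) \<partial>\<mu>)"
    proof (rule summable_comparison_test')
      show "summable (\<lambda>n. inverse (fact n) * (norm w * C) ^ n)" by (rule summable_exp)
      show "norm (\<integral>U. norm (F n U) \<partial>\<mu>) \<le> inverse (fact n) * (norm w * C) ^ n" if "n \<ge> 0" for n
        using haar_norm_integral_le(1)[OF cF bF, of n] by simp
    qed
  qed
  moreover have "(\<Sum>n. F n U) = exp (w * f U)" for U
    unfolding F_def using exp_converges[of "w * f U"] by (simp add: sums_iff)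
  moreover have "integral\<^sup>L \<mu> (F n) = w ^ n / fact n * (\<integral>U. f U ^ n \<partial>\<mu>)" for n
    unfolding F_def by (simp add: power_mult_distrib scaleR_conv_of_real divide_inverse mult_ac)
  ultimately show ?thesis by simp
qed

text \<open>This identifies the terms of the series with those of the expanded exponential. It is
  used twice: for the value of the integral and for bounds on the terms.\<close>

lemma hciz_term_moment:
  assumes "has_eigenvalues A a" "has_eigenvalues B b"
  shows "hciz_term d z a b = (z * of_nat CARD('n)) ^ d / fact d * (\<integral>U. trace (A ** U ** B ** adjoint_mat U) ^ d \<partial>\<mu>)"
  unfolding hciz_term_char_sum[OF assms] conj_moment[OF haar]
  by (simp add: power_mult_distrib power2_eq_square)

text \<open>In the binomial expansion only equal powers of the two traces survive, which requires an
  even exponent.\<close>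

lemma linear_moment_expand:
  "(\<integral>U. (trace (B ** adjoint_mat U) + trace (A ** U)) ^ n \<partial>\<mu>) =
    (if even n then of_nat (n choose (n div 2)) * (\<integral>U. trace (B ** adjoint_mat U) ^ (n div 2) * trace (A ** U) ^ (n div 2) \<partial>\<mu>) else 0)"
proof -
  let ?I = "\<lambda>k. \<integral>U. trace (B ** adjoint_mat U) ^ k * trace (A ** U) ^ (n - k) \<partial>\<mu>"
  have "(\<integral>U. (trace (B ** adjoint_mat U) + trace (A ** U)) ^ n \<partial>\<mu>) =
    (\<integral>U. (\<Sum>k\<le>n. of_nat (n choose k) * (trace (B ** adjoint_mat U) ^ k * trace (A ** U) ^ (n - k))) \<partial>\<mu>)"
    by (simp only: binomial_ring mult.assoc)
  also have "\<dots> = (\<Sum>k\<le>n. of_nat (n choose k) * ?I k)"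
  proof (subst Bochner_Integration.integral_sum)
    show "integrable \<mu> (\<lambda>U. of_nat (n choose k) * (trace (B ** adjoint_mat U) ^ k * trace (A ** U) ^ (n - k)))" for k
      unfolding trace_mult_adjoint_expand unfolding trace_mult_expand
      by (rule haar_integrable[OF haar]) (intro continuous_intros)
  qed simp
  also have "\<dots> = (\<Sum>k\<le>n. if even n \<and> k = n div 2 then of_nat (n choose k) * ?I k else 0)"
  proof (rule sum.cong[OF refl])
    fix k assume "k \<in> {..n}"
    then have "k \<le> n" by simp
    then have "even n \<and> k = n div 2 \<longleftrightarrow> k = n - k" by presburger
    then show "of_nat (n choose k) * ?I k = (if even n \<and> k = n div 2 then of_nat (n choose k) * ?I k else 0)"
      using linear_moment_unbalanced[of k "n - k"] by auto
  qed
  also have "\<dots> = (if even n then of_nat (n choose (n div 2)) * ?I (n div 2) else 0)"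
    by auto
  also have "\<dots> = (if even n then of_nat (n choose (n div 2)) * (\<integral>U. trace (B ** adjoint_mat U) ^ (n div 2) * trace (A ** U) ^ (n div 2) \<partial>\<mu>) else 0)"
    by (auto elim!: evenE)
  finally show ?thesis .
qed

text \<open>The central binomial coefficient replaces \<open>(2d)!\<close> by \<open>(d!)^2\<close>.
  One factor \<open>d!\<close> cancels against that of \<open>linear_moment\<close>, and
  \<open>N^(2d)\<close> against its \<open>N^d\<close>.\<close>

lemma bgw_term_moment:
  assumes "has_eigenvalues (A ** B) c"
  shows "bgw_term d z c = (z * of_nat CARD('n)) ^ (2 * d) / fact (2 * d) * (\<integral>U. (trace (B ** adjoint_mat U) + trace (A ** U)) ^ (2 * d) \<partial>\<mu>)"
proof -
  define S where "S = (\<Sum>\<nu> | \<nu> \<in> partitions d \<and> length \<nu> \<le> CARD('n). char_sum (A ** B) \<nu> / (Omega CARD('n) \<nu> * hook \<nu>))"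
  have ch: "of_nat ((2 * d) choose d) = fact (2 * d) / (fact d * fact d :: complex)"
    using binomial_fact[of d "2 * d", where 'a = complex] by simp
  have "(z * of_nat CARD('n)) ^ (2 * d) / fact (2 * d) * (\<integral>U. (trace (B ** adjoint_mat U) + trace (A ** U)) ^ (2 * d) \<partial>\<mu>) =
    (z * of_nat CARD('n)) ^ (2 * d) / fact (2 * d) * (fact (2 * d) / (fact d * fact d) * (fact d / of_nat CARD('n) ^ d * S))"
    unfolding linear_moment_expand by (simp add: linear_moment S_def[symmetric] ch)
  also have "\<dots> = z ^ (2 * d) * of_nat CARD('n) ^ d / fact d * S"
    by (simp add: power_mult_distrib mult_2 power_add)
  finally show ?thesis unfolding bgw_term_char_sum[OF assms] S_def by simp
qed

end

text \<open>Realises an arbitrary vector as eigenvalues, so that the terms of the series are Haar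
  moments at every point of the domain.\<close>

definition diag_mat :: "complex^'n \<Rightarrow> complex^'n^'n" where
  "diag_mat a = (\<chi> i j. if i = j then a $ i else 0)"

lemma has_eigenvalues_diag_mat: "has_eigenvalues (diag_mat a) a"
proof -
  have "mat x - diag_mat a = (\<chi> i j. if i = j then x - a $ i else 0)" for x
    by (auto simp: diag_mat_def mat_def vec_eq_iff)
  then show ?thesis by (simp add: has_eigenvalues_def det_diagonal)
qed

lemma diag_mat_bound:
  assumes "norm a \<le> R" shows "norm (diag_mat a $ i $ j) \<le> R"
  using Finite_Cartesian_Product.norm_nth_le[of a i] assms order_trans[OF norm_ge_zero assms] by (auto simp: diag_mat_def)

section \<open>Absolute and uniform convergence on compact sets\<close>

lemma uniformly_convergent_exp_majorant:
  fixes F :: "nat \<Rightarrow> 'a \<Rightarrow> complex"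
  assumes "\<And>d x. x \<in> K \<Longrightarrow> norm (F d x) \<le> C ^ d / fact d"
  shows "uniformly_convergent_on K (\<lambda>m x. \<Sum>d<m. norm (F (Suc d) x))"
    "uniformly_convergent_on K (\<lambda>m x. \<Sum>d<m. F (Suc d) x)"
proof -
  have "summable (\<lambda>d. inverse (fact d) * C ^ d)" by (rule summable_exp)
  then have "summable (\<lambda>d. C ^ d / fact d)" by (simp add: divide_inverse mult.commute)
  then have s: "summable (\<lambda>d. C ^ Suc d / fact (Suc d))" by (subst summable_Suc_iff)
  show "uniformly_convergent_on K (\<lambda>m x. \<Sum>d<m. norm (F (Suc d) x))"
    unfolding uniformly_convergent_on_def by (rule exI, rule Weierstrass_m_test[OF _ s]) (simp only: real_norm_def abs_norm_cancel assms)
  show "uniformly_convergent_on K (\<lambda>m x. \<Sum>d<m. F (Suc d) x)"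
    unfolding uniformly_convergent_on_def by (rule exI, rule Weierstrass_m_test[OF _ s]) (simp only: assms)
qed

text \<open>The term is a moment for diagonal matrices. The factor \<open>R * N\<close> bounds
  \<open>z * N\<close>, and the remaining factor is the bound of
  \<open>trace_conj_bound\<close>.\<close>

lemma hciz_term_bound:
  fixes \<mu> :: "(complex^'n^'n) measure" and a b :: "complex^'n"
  assumes haar: "haar_prob_measure \<mu>" and R: "norm z \<le> R" "norm a \<le> R" "norm b \<le> R"
  shows "norm (hciz_term d z a b) \<le> (R * real CARD('n) * (real CARD('n) ^ 4 * R\<^sup>2)) ^ d / fact d"
proof -
  let ?f = "\<lambda>U. trace (diag_mat a ** U ** diag_mat b ** adjoint_mat U)"
  have "norm (\<integral>U. ?f U ^ d \<partial>\<mu>) \<le> (real CARD('n) ^ 4 * R\<^sup>2) ^ d"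
  proof (rule haar_norm_integral_le(2)[OF haar])
    show "continuous_on UNIV (\<lambda>U. ?f U ^ d)" unfolding trace_conj_expand by (intro continuous_intros)
    fix U :: "complex^'n^'n" assume "U \<in> unitary_group"
    from trace_conj_bound[OF this diag_mat_bound[OF R(2)] diag_mat_bound[OF R(3)]]
    show "norm (?f U ^ d) \<le> (real CARD('n) ^ 4 * R\<^sup>2) ^ d" unfolding norm_power by (intro power_mono) auto
  qed
  moreover have "norm (z * of_nat CARD('n)) ^ d \<le> (R * real CARD('n)) ^ d"
    using R(1) by (intro power_mono) (auto simp: norm_mult mult_right_mono)
  ultimately have "norm (z * of_nat CARD('n)) ^ d * norm (\<integral>U. ?f U ^ d \<partial>\<mu>) \<le> (R * real CARD('n)) ^ d * (real CARD('n) ^ 4 * R\<^sup>2) ^ d"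
    using order_trans[OF norm_ge_zero R(1)] by (intro mult_mono) auto
  then show ?thesis
    unfolding hciz_term_moment[OF haar has_eigenvalues_diag_mat has_eigenvalues_diag_mat] norm_mult norm_divide norm_power
    by (simp add: power_mult_distrib[symmetric] divide_right_mono)
qed

text \<open>The pair of \<open>diag_mat c\<close> and the identity has a product with eigenvalues
  \<open>c\<close>. The assumption \<open>1 \<le> R\<close> bounds the entries of the identity by
  \<open>R\<close>.\<close>

lemma bgw_term_bound:
  fixes \<mu> :: "(complex^'n^'n) measure" and c :: "complex^'n"
  assumes haar: "haar_prob_measure \<mu>" and R: "norm z \<le> R" "norm c \<le> R" "1 \<le> R"
  shows "norm (bgw_term d z c) \<le> ((R * real CARD('n) * (2 * real CARD('n) ^ 2 * R))\<^sup>2) ^ d / fact d"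
proof -
  let ?f = "\<lambda>U. trace (mat 1 ** adjoint_mat U) + trace (diag_mat c ** U)"
  have e: "has_eigenvalues (diag_mat c ** mat 1) c" by (simp add: matrix_mul_rid has_eigenvalues_diag_mat)
  have "norm (\<integral>U. ?f U ^ (2 * d) \<partial>\<mu>) \<le> (2 * real CARD('n) ^ 2 * R) ^ (2 * d)"
  proof (rule haar_norm_integral_le(2)[OF haar])
    show "continuous_on UNIV (\<lambda>U. ?f U ^ (2 * d))" unfolding trace_mult_adjoint_expand unfolding trace_mult_expand by (intro continuous_intros)
    fix U :: "complex^'n^'n" assume U: "U \<in> unitary_group"
    have "norm ((mat 1 :: complex^'n^'n) $ i $ j) \<le> R" for i j using R(3) by (simp add: mat_def)
    from trace_linear_bound[OF U diag_mat_bound[OF R(2)] this]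
    show "norm (?f U ^ (2 * d)) \<le> (2 * real CARD('n) ^ 2 * R) ^ (2 * d)" unfolding norm_power by (intro power_mono) auto
  qed
  moreover have "norm (z * of_nat CARD('n)) ^ (2 * d) \<le> (R * real CARD('n)) ^ (2 * d)"
    using R(1) by (intro power_mono) (auto simp: norm_mult mult_right_mono)
  ultimately have m: "norm (z * of_nat CARD('n)) ^ (2 * d) * norm (\<integral>U. ?f U ^ (2 * d) \<partial>\<mu>) \<le> (R * real CARD('n)) ^ (2 * d) * (2 * real CARD('n) ^ 2 * R) ^ (2 * d)"
    using R(3) by (intro mult_mono) auto
  have "norm (bgw_term d z c) = norm (z * of_nat CARD('n)) ^ (2 * d) * norm (\<integral>U. ?f U ^ (2 * d) \<partial>\<mu>) / fact (2 * d)"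
    unfolding bgw_term_moment[OF haar e] norm_mult norm_divide norm_power by simp
  \<comment> \<open>Weakening \<open>1 / (2d)!\<close> to \<open>1 / d!\<close> gives the form that
    \<open>uniformly_convergent_exp_majorant\<close> expects.\<close>
  also have "\<dots> \<le> (R * real CARD('n)) ^ (2 * d) * (2 * real CARD('n) ^ 2 * R) ^ (2 * d) / fact d"
    by (rule frac_le[OF _ m]) (use R(3) in \<open>auto intro: fact_mono\<close>)
  also have "\<dots> = ((R * real CARD('n) * (2 * real CARD('n) ^ 2 * R))\<^sup>2) ^ d / fact d"
    by (simp only: power_mult power_mult_distrib[symmetric])
  finally show ?thesis .
qed

theorem theorem1p2:
  fixes \<mu> :: "(complex^'n^'n) measure"
  assumes haar: "haar_prob_measure \<mu>"
  shows
    "(\<forall>(z :: complex) (A :: complex^'n^'n) (B :: complex^'n^'n)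
        (a :: complex^'n) (b :: complex^'n) (c :: complex^'n).
        has_eigenvalues A a \<longrightarrow> has_eigenvalues B b \<longrightarrow> has_eigenvalues (A ** B) c \<longrightarrow>
        (\<integral>U. exp (z * of_nat CARD('n) * trace (A ** U ** B ** matrix_inv U)) \<partial>\<mu>)
          = 1 + (\<Sum>d. hciz_term (Suc d) z a b) \<and>
        (\<integral>U. exp (z * of_nat CARD('n) * trace (A ** U + B ** matrix_inv U)) \<partial>\<mu>)
          = 1 + (\<Sum>d. bgw_term (Suc d) z c)) \<and>
     (\<forall>K :: (complex \<times> (complex^'n) \<times> (complex^'n)) set. compact K \<longrightarrow>
        uniformly_convergent_on K (\<lambda>m (z, a, b). \<Sum>d<m. norm (hciz_term (Suc d) z a b)) \<and>
        uniformly_convergent_on K (\<lambda>m (z, a, b). \<Sum>d<m. hciz_term (Suc d) z a b)) \<and>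
     (\<forall>K :: (complex \<times> (complex^'n)) set. compact K \<longrightarrow>
        uniformly_convergent_on K (\<lambda>m (z, c). \<Sum>d<m. norm (bgw_term (Suc d) z c)) \<and>
        uniformly_convergent_on K (\<lambda>m (z, c). \<Sum>d<m. bgw_term (Suc d) z c))"
proof (intro conjI allI impI)
  interpret prob_space \<mu> using haar by (simp add: haar_prob_measure_def)
  fix z :: complex and A B :: "complex^'n^'n" and a b c :: "complex^'n"
  assume A: "has_eigenvalues A a" and B: "has_eigenvalues B b" and C: "has_eigenvalues (A ** B) c"
  let ?w = "z * of_nat CARD('n)"
  let ?f = "\<lambda>U. trace (A ** U ** B ** adjoint_mat U)"
  let ?g = "\<lambda>U. trace (B ** adjoint_mat U) + trace (A ** U)"
  \<comment> \<open>The series of the theorem start at degree 1. The term of degree 0 is a moment of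
    order 0 under a probability measure and accounts for the leading 1.\<close>
  have split: "s = f 0 + (\<Sum>d. f (Suc d))" if "f sums s" for f :: "nat \<Rightarrow> complex" and s
    using that suminf_split_head[of f] by (simp add: sums_iff)
  have "continuous_on UNIV ?f" unfolding trace_conj_expand by (intro continuous_intros)
  from haar_exp_sums[OF haar this, of ?w]
  have "(\<lambda>d. hciz_term d z a b) sums (\<integral>U. exp (?w * ?f U) \<partial>\<mu>)"
    by (simp only: hciz_term_moment[OF haar A B])
  from split[OF this] have "(\<integral>U. exp (?w * ?f U) \<partial>\<mu>) = 1 + (\<Sum>d. hciz_term (Suc d) z a b)"
    using hciz_term_moment[OF haar A B, of 0 z] by (simp add: prob_space)
  moreover have "(\<integral>U. exp (?w * trace (A ** U ** B ** matrix_inv U)) \<partial>\<mu>) = (\<integral>U. exp (?w * ?f U) \<partial>\<mu>)"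
    by (rule Bochner_Integration.integral_cong[OF refl]) (simp add: haar_space[OF haar] matrix_inv_unitary)
  ultimately show "(\<integral>U. exp (?w * trace (A ** U ** B ** matrix_inv U)) \<partial>\<mu>) = 1 + (\<Sum>d. hciz_term (Suc d) z a b)"
    by (simp only:)
  have "continuous_on UNIV ?g" unfolding trace_mult_adjoint_expand unfolding trace_mult_expand by (intro continuous_intros)
  from haar_exp_sums[OF haar this, of ?w]
  have g: "(\<lambda>n. ?w ^ n / fact n * (\<integral>U. ?g U ^ n \<partial>\<mu>)) sums (\<integral>U. exp (?w * ?g U) \<partial>\<mu>)" .
  \<comment> \<open>The exponential series runs over all powers; as its odd moments vanish, it may
    be reindexed by the even ones.\<close>
  have "(\<lambda>d. ?w ^ (2 * d) / fact (2 * d) * (\<integral>U. ?g U ^ (2 * d) \<partial>\<mu>)) sums (\<integral>U. exp (?w * ?g U) \<partial>\<mu>)"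
  proof (subst sums_mono_reindex[of "\<lambda>d. 2 * d"])
    show "strict_mono (\<lambda>d::nat. 2 * d)" by (simp add: strict_mono_def)
    fix n :: nat assume "n \<notin> range (\<lambda>d. 2 * d)"
    then have "odd n" by (auto elim: evenE)
    then show "?w ^ n / fact n * (\<integral>U. ?g U ^ n \<partial>\<mu>) = 0" by (simp add: linear_moment_expand[OF haar])
  qed (rule g)
  then have "(\<lambda>d. bgw_term d z c) sums (\<integral>U. exp (?w * ?g U) \<partial>\<mu>)"
    by (simp only: bgw_term_moment[OF haar C])
  from split[OF this] have "(\<integral>U. exp (?w * ?g U) \<partial>\<mu>) = 1 + (\<Sum>d. bgw_term (Suc d) z c)"
    using bgw_term_moment[OF haar C, of 0 z] by (simp add: prob_space)
  moreover have "(\<integral>U. exp (?w * trace (A ** U + B ** matrix_inv U)) \<partial>\<mu>) = (\<integral>U. exp (?w * ?g U) \<partial>\<mu>)"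
    by (rule Bochner_Integration.integral_cong[OF refl]) (simp add: haar_space[OF haar] matrix_inv_unitary trace_add add.commute)
  ultimately show "(\<integral>U. exp (?w * trace (A ** U + B ** matrix_inv U)) \<partial>\<mu>) = 1 + (\<Sum>d. bgw_term (Suc d) z c)"
    by (simp only:)
next
  fix K :: "(complex \<times> (complex^'n) \<times> (complex^'n)) set" assume "compact K"
  then have "bounded K" by (rule compact_imp_bounded)
  then obtain R where R: "\<And>x. x \<in> K \<Longrightarrow> norm x \<le> R" by (auto simp only: bounded_iff)
  define F where "F d = (\<lambda>(z, a, b). hciz_term d z a (b :: complex^'n))" for d
  have b: "norm (F d x) \<le> (R * real CARD('n) * (real CARD('n) ^ 4 * R\<^sup>2)) ^ d / fact d" if "x \<in> K" for d x
  proof -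
    obtain z a b where x: "x = (z, a, b)" by (metis prod.exhaust)
    have "norm z \<le> R" "norm a \<le> R" "norm b \<le> R"
      using R[OF that] norm_fst_le[of z "(a, b)"] norm_snd_le[of "(a, b)" z] norm_fst_le[of a b] norm_snd_le[of b a]
      unfolding x by linarith+
    then show ?thesis unfolding F_def x prod.case by (rule hciz_term_bound[OF haar])
  qed
  have "(\<lambda>m (z, a, b). \<Sum>d<m. norm (hciz_term (Suc d) z a b)) = (\<lambda>m x. \<Sum>d<m. norm (F (Suc d) x))"
    "(\<lambda>m (z, a, b). \<Sum>d<m. hciz_term (Suc d) z a b) = (\<lambda>m x. \<Sum>d<m. F (Suc d) x)"
    by (auto simp: F_def fun_eq_iff)
  then show "uniformly_convergent_on K (\<lambda>m (z, a, b). \<Sum>d<m. norm (hciz_term (Suc d) z a b))"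
    "uniformly_convergent_on K (\<lambda>m (z, a, b). \<Sum>d<m. hciz_term (Suc d) z a b)"
    using uniformly_convergent_exp_majorant[OF b] by simp_all
next
  fix K :: "(complex \<times> (complex^'n)) set" assume "compact K"
  then have "bounded K" by (rule compact_imp_bounded)
  then obtain R0 where R0: "\<And>x. x \<in> K \<Longrightarrow> norm x \<le> R0" by (auto simp only: bounded_iff)
  \<comment> \<open>The bound is raised to at least 1 because \<open>bgw_term_bound\<close> also has
    to dominate the entries of the identity matrix.\<close>
  define R where "R = max 1 R0"
  define F where "F d = (\<lambda>(z, c). bgw_term d z (c :: complex^'n))" for d
  have b: "norm (F d x) \<le> ((R * real CARD('n) * (2 * real CARD('n) ^ 2 * R))\<^sup>2) ^ d / fact d" if "x \<in> K" for d x
  proof -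
    obtain z c where x: "x = (z, c)" by (metis prod.exhaust)
    have "norm z \<le> R" "norm c \<le> R" "1 \<le> R"
      using R0[OF that] norm_fst_le[of z c] norm_snd_le[of c z] unfolding x R_def by linarith+
    then show ?thesis unfolding F_def x prod.case by (rule bgw_term_bound[OF haar])
  qed
  have "(\<lambda>m (z, c). \<Sum>d<m. norm (bgw_term (Suc d) z c)) = (\<lambda>m x. \<Sum>d<m. norm (F (Suc d) x))"
    "(\<lambda>m (z, c). \<Sum>d<m. bgw_term (Suc d) z c) = (\<lambda>m x. \<Sum>d<m. F (Suc d) x)"
    by (auto simp: F_def fun_eq_iff)
  then show "uniformly_convergent_on K (\<lambda>m (z, c). \<Sum>d<m. norm (bgw_term (Suc d) z c))"
    "uniformly_convergent_on K (\<lambda>m (z, c). \<Sum>d<m. bgw_term (Suc d) z c)"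
    using uniformly_convergent_exp_majorant[OF b] by simp_all
qed

end
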